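(* Let $\boldsymbol{s}=(s,s_L,s_U)$ be a scaling triple with $R_0=\infty$ and associated constant $c_s$, and let $Z$ be an additive process on $\mathbb{R}^d$ with a bounded triplet $(a(t),0,\Lambda_t)_{t\ge0}$. Assume that there exist a Lévy measure $\nu$ on $\mathbb{R}^d$ and a positive constant $N_\nu$ such that for every $t\ge0$ and every nonnegative Borel measurable function $f$ on $\mathbb{R}^d$, $$s(r)\int_{\mathbb{R}^d}f\Big(\frac yr\Big)\Lambda_t(dy)\ge\int_{\mathbb{R}^d}f(y)\,\nu(dy)\qquad\forall r\in(0,\infty),$$ and $$\inf_{|\xi|=1}\int_{|y|\le N_\nu}|y\cdot\xi|^2\,\nu(dy)>0.$$ Then, for every $T\in(0,\infty)$ and every $\varphi\in\mathcal{S}(\mathbb{R}^d)$ with $\mathcal{F}[\varphi]\in C_c^\infty(B_{c_s}\setminus B_{c_s^{-1}})$, there exist positive constants $N_0$ and $N_1$ such that $$\int_{\mathbb{R}^d}\big|\mathbb{E}[\varphi(x+r^{-1}Z_t)]\big|\,dx\le N_0e^{-\frac{N_1t}{s(r)}}\qquad\forall(r,t)\in(0,1)\times[0,T].$$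
   Context: $B_r=\{x\in\mathbb{R}^d:|x|<r\}$; $\mathcal{F}$ is the Fourier transform $\mathcal{F}[f](\xi)=(2\pi)^{-d/2}\int e^{-i\xi\cdot x}f(x)dx$. A Lévy measure is a nonnegative Borel measure $\nu$ on $\mathbb{R}^d$ with $\nu(\{0\})=0$, $\int(1\wedge|y|^2)\nu(dy)<\infty$. Additive processes: fix a complete probability space with a filtration $(\mathcal{F}_t)$ satisfying the usual conditions; processes are adapted, $\mathbb{R}^d$-valued, start at $0$. $Z$ is an additive process with a bounded triplet $(a(t),0,\Lambda_t)_{t\ge0}$ if $Z_t-Z_s$ is independent of $\mathcal{F}_s$ for $t>s\ge0$; $a:[0,\infty)\to\mathbb{R}^d$ is Borel; $(\Lambda_t)$ is a measurable family of Lévy measures on $\mathbb{R}^d$ ($t\mapsto\int f\,d\Lambda_t$ is measurable for every integrable $f$); $\mathbb{E}[e^{i\xi\cdot(Z_t-Z_s)}]=\exp(\int_s^t\Psi_Z(r,\xi)dr)$ for $0\le s\le t$ with $\Psi_Z(r,\xi)=ia(r)\cdot\xi+\int(e^{iy\cdot\xi}-1-iy\cdot\xi1_{|y|\le1})\Lambda_r(dy)$; and $a$ and $t\mapsto\int(1\wedge|y|^2)\Lambda_t(dy)$ belong to $L_\infty([0,T])$ for each $T<\infty$. Scaling triple with $R_0=\infty$: $s,s_L,s_U:(0,\infty)\to(0,\infty)$ are measurable, $s_L,s_U$ are non-decreasing with limit $0$ at $0$ and $\infty$ at $\infty$, and $s_L(R/r)\le s(R)/s(r)\le s_U(R/r)$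 for all $0<r\le R<\infty$. $m_s=\min\{m\in\mathbb{N}:s_L(2^m)>1\}$, $c_s=2^{m_s}$. *)

theory Defs
  imports "HOL-Probability.Probability"
begin

text \<open>
  The space \<open>\<real>\<^sup>d\<close> is an arbitrary Euclidean space \<open>'a\<close> with \<open>d = DIM('a)\<close>.
\<close>

text \<open>
  The three functions live on \<open>(0,\<infinity>)\<close>; their values elsewhere are never used.
  This is the case \<open>R\<^sub>0 = \<infinity>\<close>.
\<close>

definition scaling_triple :: "(real \<Rightarrow> real) \<Rightarrow> (real \<Rightarrow> real) \<Rightarrow> (real \<Rightarrow> real) \<Rightarrow> bool" where
  "scaling_triple s sL sU \<longleftrightarrow>
     (\<forall>g\<in>{s, sL, sU}. g \<in> borel_measurable (restrict_space borel {0<..}) \<and> (\<forall>r>0. 0 < g r)) \<and>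
     (\<forall>g\<in>{sL, sU}. mono_on {0<..} g \<and> (g \<longlongrightarrow> 0) (at_right 0) \<and> filterlim g at_top at_top) \<and>
     (\<forall>r R. 0 < r \<longrightarrow> r \<le> R \<longrightarrow> sL (R / r) \<le> s R / s r \<and> s R / s r \<le> sU (R / r))"

definition scaling_m :: "(real \<Rightarrow> real) \<Rightarrow> nat" where
  "scaling_m sL = (LEAST m. 1 < sL (2 ^ m))"

definition scaling_c :: "(real \<Rightarrow> real) \<Rightarrow> real" where
  "scaling_c sL = 2 ^ scaling_m sL"

definition levy_measure :: "'a::euclidean_space measure \<Rightarrow> bool" where
  "levy_measure \<nu> \<longleftrightarrow> sets \<nu> = sets borel \<and> emeasure \<nu> {0} = 0 \<and>
     (\<integral>\<^sup>+ y. ennreal (min 1 ((norm y)\<^sup>2)) \<partial>\<nu>) < \<infinity>"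

text \<open>Time is \<open>real\<close>, but only times \<open>t \<ge> 0\<close> matter.\<close>

definition usual_filtered_space :: "'w measure \<Rightarrow> (real \<Rightarrow> 'w measure) \<Rightarrow> bool" where
  "usual_filtered_space M F \<longleftrightarrow>
     prob_space M \<and> complete_measure M \<and>
     (\<forall>t\<ge>0. subalgebra M (F t)) \<and>
     (\<forall>s t. 0 \<le> s \<longrightarrow> s \<le> t \<longrightarrow> sets (F s) \<subseteq> sets (F t)) \<and>
     null_sets M \<subseteq> sets (F 0) \<and>
     (\<forall>t\<ge>0. sets (F t) = (\<Inter>u\<in>{t<..}. sets (F u)))"

text \<open>
  In the measurability condition, ``every integrable function'' means every Borel function that
  is integrable with respect to each \<open>\<Lambda> t\<close>.
\<close>

definition measurable_levy_family :: "(real \<Rightarrow> 'a::euclidean_space measure) \<Rightarrow> bool" where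
  "measurable_levy_family \<Lambda> \<longleftrightarrow>
     (\<forall>t\<ge>0. levy_measure (\<Lambda> t)) \<and>
     (\<forall>f :: 'a \<Rightarrow> real. f \<in> borel_measurable borel \<longrightarrow> (\<forall>t\<ge>0. integrable (\<Lambda> t) f) \<longrightarrow>
        (\<lambda>t. \<integral>y. f y \<partial>\<Lambda> t) \<in> borel_measurable (restrict_space borel {0..}))"

definition levy_symbol ::
    "(real \<Rightarrow> 'a::euclidean_space) \<Rightarrow> (real \<Rightarrow> 'a measure) \<Rightarrow> real \<Rightarrow> 'a \<Rightarrow> complex" where
  "levy_symbol a \<Lambda> r \<xi> = \<i> * of_real (a r \<bullet> \<xi>) +
     (\<integral>y. (iexp (y \<bullet> \<xi>) - 1 - \<i> * of_real (y \<bullet> \<xi>) * indicator (cball 0 1) y) \<partial>\<Lambda> r)"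

text \<open>
  The last two conjuncts say that \<open>a\<close> and \<open>t \<mapsto> \<integral> min 1 |y|\<^sup>2 d\<Lambda>\<^sub>t\<close> belong to \<open>L\<^sub>\<infinity>([0,T])\<close>
  for each finite \<open>T\<close>; their measurability comes from the earlier conjuncts.
\<close>

definition bounded_triplet ::
    "(real \<Rightarrow> 'a::euclidean_space) \<Rightarrow> (real \<Rightarrow> 'a measure) \<Rightarrow> bool" where
  "bounded_triplet a \<Lambda> \<longleftrightarrow>
     a \<in> borel_measurable (restrict_space borel {0..}) \<and>
     measurable_levy_family \<Lambda> \<and>
     (\<forall>T>0. \<exists>C. AE t in lborel. t \<in> {0..T} \<longrightarrow> norm (a t) \<le> C) \<and>
     (\<forall>T>0. \<exists>C::real. AE t in lborel. t \<in> {0..T} \<longrightarrow>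
        (\<integral>\<^sup>+ y. ennreal (min 1 ((norm y)\<^sup>2)) \<partial>\<Lambda> t) \<le> ennreal C)"

definition additive_process ::
    "'w measure \<Rightarrow> (real \<Rightarrow> 'w measure) \<Rightarrow> (real \<Rightarrow> 'w \<Rightarrow> 'a::euclidean_space)
     \<Rightarrow> (real \<Rightarrow> 'a) \<Rightarrow> (real \<Rightarrow> 'a measure) \<Rightarrow> bool" where
  "additive_process M F Z a \<Lambda> \<longleftrightarrow>
     usual_filtered_space M F \<and>
     bounded_triplet a \<Lambda> \<and>
     (\<forall>t\<ge>0. Z t \<in> borel_measurable (F t)) \<and>
     (AE \<omega> in M. Z 0 \<omega> = 0) \<and>
     (\<forall>s t. 0 \<le> s \<longrightarrow> s < t \<longrightarrow>
        prob_space.indep_set M (sets (F s))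
          (sets (vimage_algebra (space M) (\<lambda>\<omega>. Z t \<omega> - Z s \<omega>) borel))) \<and>
     (\<forall>s t \<xi>. 0 \<le> s \<longrightarrow> s \<le> t \<longrightarrow>
        (\<integral>\<omega>. iexp (\<xi> \<bullet> (Z t \<omega> - Z s \<omega>)) \<partial>M) =
        exp (LINT r:{s..t}|lborel. levy_symbol a \<Lambda> r \<xi>))"

primrec iter_deriv ::
    "'a::euclidean_space list \<Rightarrow> ('a \<Rightarrow> complex) \<Rightarrow> 'a \<Rightarrow> complex" where
  "iter_deriv [] f = f"
| "iter_deriv (v # vs) f = (\<lambda>x. frechet_derivative (iter_deriv vs f) (at x) v)"

text \<open>
  \<open>C\<^sup>\<infinity>\<close>: all iterated partial derivatives are Frechet differentiable, hence also continuous.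
\<close>

definition smooth :: "('a::euclidean_space \<Rightarrow> complex) \<Rightarrow> bool" where
  "smooth f \<longleftrightarrow> (\<forall>vs\<in>lists Basis. iter_deriv vs f differentiable_on UNIV)"

text \<open>
  The multi-index monomial \<open>x\<^sup>\<alpha>\<close> is the product over \<open>Basis\<close>; the derivative \<open>D\<^sup>\<beta>\<close> is given by
  a list of basis vectors.
\<close>

definition schwartz :: "('a::euclidean_space \<Rightarrow> complex) \<Rightarrow> bool" where
  "schwartz f \<longleftrightarrow> smooth f \<and>
     (\<forall>\<alpha> :: 'a \<Rightarrow> nat. \<forall>vs\<in>lists Basis.
        bounded (range (\<lambda>x. (\<Prod>b\<in>Basis. (x \<bullet> b) ^ \<alpha> b) *\<^sub>R iter_deriv vs f x)))"

definition Cc_infty :: "'a::euclidean_space set \<Rightarrow> ('a \<Rightarrow> complex) \<Rightarrow> bool" where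
  "Cc_infty U g \<longleftrightarrow> smooth g \<and>
     compact (closure (support_on UNIV g)) \<and> closure (support_on UNIV g) \<subseteq> U"

definition fourier :: "('a::euclidean_space \<Rightarrow> complex) \<Rightarrow> 'a \<Rightarrow> complex" where
  "fourier f \<xi> = of_real ((2 * pi) powr (- (real DIM('a) / 2))) *
     (\<integral>x. iexp (- (\<xi> \<bullet> x)) * f x \<partial>lborel)"

end

theory Submission
  imports Defs
begin

text \<open>
  By hypothesis \<open>\<Lambda>\<^sub>u\<close> dominates, up to the factor \<open>1 / s (\<epsilon> r)\<close>, the image of \<open>\<nu>\<close> under \<open>y \<mapsto> \<epsilon> r y\<close>, and one may
  replace \<open>\<nu>\<close> by its restriction to an annulus, which is finite and still nondegenerate.  Hence the law of
  \<open>Z\<^sub>t / r\<close> is the convolution of a probability law with a compound Poisson law of intensity proportional to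
  \<open>\<tau> = t / s (\<epsilon> r)\<close>.  The first factor does not increase \<open>L\<^sub>1\<close> norms; instead of constructing it, one
  discards the jumps below a threshold, expands the exponential of a finite measure, and passes to the limit
  with Fatou's lemma.

  For the compound Poisson factor, \<open>\<epsilon>\<close> is chosen so small that \<open>|\<epsilon> y \<bullet> \<xi>| \<le> 1\<close> for the jumps \<open>y\<close> and all
  frequencies \<open>\<xi>\<close> of \<open>\<phi>\<close>; then \<open>1 - cos u \<ge> u\<^sup>2 / 4\<close> bounds its characteristic function there by
  \<open>exp (-c \<tau>)\<close>.  This gives a supremum bound for the convolution with \<open>\<phi>\<close>, and a first moment bound
  controls its tails, so the \<open>L\<^sub>1\<close> norm decays exponentially in \<open>\<tau>\<close>.
\<close>

section \<open>Convolution with compound Poisson laws\<close>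

text \<open>Characteristic functions equal 1 at the origin, so only frequencies away from 0 can be
  damped. This is where \<open>inverse c \<le> norm \<xi>\<close> on the support of the transform of
  \<phi> matters: together with nondegeneracy it bounds the second moment of the restricted measure
  in direction \<xi> below by \<open>k / c\<^sup>2\<close>.

  The jumps are compared at scale \<open>\<epsilon> * r\<close> but the claimed rate is
  \<open>t / s r\<close>. The inequality
  \<open>sL (1 / \<epsilon>) \<le> s r / s (\<epsilon> * r)\<close> converts one rate into the
  other, at the price of a factor \<open>sL (1 / \<epsilon>)\<close> in the exponent.

  After the compound Poisson part is split off, the remaining factor may have infinitely many small
  jumps, together with a compensator and a time-dependent drift. Once the jump measure is truncated
  to a finite one, the compensator is itself a drift, and a drift is a translation, which no L1 norm
  sees. Hence finite measures and their unnormalized characteristic functions suffice, and every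
  operation on \<phi> becomes a multiplication of the function \<open>h\<close> with
  \<open>inv_fourier h = \<phi>\<close>.\<close>

definition inv_fourier :: "('a::euclidean_space \<Rightarrow> complex) \<Rightarrow> 'a \<Rightarrow> complex" where
  "inv_fourier h x = (\<integral>\<xi>. iexp (x \<bullet> \<xi>) * h \<xi> \<partial>lborel)"

text \<open>Not normalized to a probability: the value at 0 is the total mass, which is why
  exponents always contain
  \<open>mchar \<kappa> \<xi> - measure \<kappa> (space \<kappa>)\<close>.\<close>

definition mchar :: "'a::euclidean_space measure \<Rightarrow> 'a \<Rightarrow> complex" where
  "mchar \<kappa> \<xi> = (\<integral>y. iexp (y \<bullet> \<xi>) \<partial>\<kappa>)"

lemma borel_measurable_mchar [measurable]:
  assumes "finite_measure \<kappa>" and [measurable_cong]: "sets \<kappa> = sets borel"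
  shows "mchar \<kappa> \<in> borel_measurable borel"
proof -
  interpret finite_measure \<kappa> by fact
  show ?thesis unfolding mchar_def by measurable
qed

lemma norm_mchar_le:
  assumes "finite_measure \<kappa>"
  shows "cmod (mchar \<kappa> \<xi>) \<le> measure \<kappa> (space \<kappa>)"
proof -
  interpret finite_measure \<kappa> by fact
  have "cmod (mchar \<kappa> \<xi>) \<le> (\<integral>y. cmod (iexp (y \<bullet> \<xi>)) \<partial>\<kappa>)"
    unfolding mchar_def by (rule integral_norm_bound)
  then show ?thesis by simp
qed

lemma borel_measurable_inv_fourier [measurable]:
  assumes [measurable]: "h \<in> borel_measurable borel"
  shows "inv_fourier h \<in> borel_measurable borel"
  unfolding inv_fourier_def by measurable

lemma norm_inv_fourier_le: "cmod (inv_fourier h x) \<le> (\<integral>\<xi>. cmod (h \<xi>) \<partial>lborel)"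
  unfolding inv_fourier_def by (rule order_trans[OF integral_norm_bound]) (simp add: norm_mult)

lemma integrable_mult_bounded:
  fixes g h :: "'a \<Rightarrow> complex"
  assumes "integrable M h" "g \<in> borel_measurable M" "\<And>x. cmod (g x) \<le> B"
  shows "integrable M (\<lambda>x. g x * h x)"
proof (rule Bochner_Integration.integrable_bound)
  show "integrable M (\<lambda>x. B *\<^sub>R cmod (h x))" using assms by auto
  have "cmod (g x * h x) \<le> norm (B *\<^sub>R cmod (h x))" for x
    using mult_right_mono[OF assms(3)[of x] norm_ge_zero[of "h x"]] 
    by (simp add: norm_mult abs_mult order_trans[OF _ mult_right_mono[OF abs_ge_self]])
  then show "AE x in M. cmod (g x * h x) \<le> norm (B *\<^sub>R cmod (h x))" by simp
qed (use assms in measurable)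

text \<open>The convolution theorem, by Fubini: the integrand has modulus
  \<open>cmod (h \<xi>)\<close>, which is integrable on the product because \<kappa> is finite. The
  shift is \<open>x + y\<close>, matching the expectation of \<phi> at \<open>x\<close> plus a
  random vector.\<close>

lemma inv_fourier_mult_mchar:
  assumes "finite_measure \<kappa>" and [measurable_cong]: "sets \<kappa> = sets borel" and h: "integrable lborel h"
  shows "inv_fourier (\<lambda>\<xi>. mchar \<kappa> \<xi> * h \<xi>) x = (\<integral>y. inv_fourier h (x + y) \<partial>\<kappa>)"
proof -
  interpret finite_measure \<kappa> by fact
  have [measurable]: "h \<in> borel_measurable borel" using h by auto
  interpret P: pair_sigma_finite lborel \<kappa> by standard
  have "integrable (lborel \<Otimes>\<^sub>M \<kappa>) (\<lambda>(\<xi>, y). iexp ((x + y) \<bullet> \<xi>) * h \<xi>)"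
  proof (rule P.Fubini_integrable)
    have "(\<lambda>\<xi>. \<integral>y. cmod (h \<xi>) \<partial>\<kappa>) = (\<lambda>\<xi>. measure \<kappa> (space \<kappa>) *\<^sub>R cmod (h \<xi>))" by simp
    then show "integrable lborel (\<lambda>\<xi>. \<integral>y. norm (case (\<xi>, y) of (\<xi>, y) \<Rightarrow> iexp ((x + y) \<bullet> \<xi>) * h \<xi>) \<partial>\<kappa>)"
      using h by (simp add: norm_mult)
    have "integrable \<kappa> (\<lambda>y. iexp ((x + y) \<bullet> \<xi>) * h \<xi>)" for \<xi>
      by (intro integrable_mult_left, rule integrable_const_bound[where B=1]) auto
    then show "AE \<xi> in lborel. integrable \<kappa> (\<lambda>y. case (\<xi>, y) of (\<xi>, y) \<Rightarrow> iexp ((x + y) \<bullet> \<xi>) * h \<xi>)"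
      by simp
  qed measurable
  then have "(\<integral>y. \<integral>\<xi>. iexp ((x + y) \<bullet> \<xi>) * h \<xi> \<partial>lborel \<partial>\<kappa>) =
      (\<integral>\<xi>. \<integral>y. iexp ((x + y) \<bullet> \<xi>) * h \<xi> \<partial>\<kappa> \<partial>lborel)"
    by (rule P.Fubini_integral)
  also have "(\<lambda>\<xi>. \<integral>y. iexp ((x + y) \<bullet> \<xi>) * h \<xi> \<partial>\<kappa>) = (\<lambda>\<xi>. iexp (x \<bullet> \<xi>) * (mchar \<kappa> \<xi> * h \<xi>))"
    unfolding mchar_def by (simp add: inner_add_left distrib_left exp_add mult_ac)
  finally show ?thesis unfolding inv_fourier_def by simp
qed

lemma nn_integral_lborel_shift:
  fixes f :: "'a::euclidean_space \<Rightarrow> ennreal"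
  assumes [measurable]: "f \<in> borel_measurable borel"
  shows "(\<integral>\<^sup>+x. f (x + y) \<partial>lborel) = (\<integral>\<^sup>+x. f x \<partial>lborel)"
proof -
  have "(\<integral>\<^sup>+x. f x \<partial>lborel) = (\<integral>\<^sup>+x. f x \<partial>distr lborel borel ((+) y))"
    by (simp add: lborel_distr_plus)
  also have "\<dots> = (\<integral>\<^sup>+x. f (x + y) \<partial>lborel)"
    by (subst nn_integral_distr) (auto simp: add.commute)
  finally show ?thesis by simp
qed

text \<open>Young's inequality with a weight: Tonelli and translation invariance, where
  \<open>K\<close> is the price of moving the weight along a shift in the support of \<kappa>. With
  \<open>w = 1\<close> and \<open>K = 1\<close> it is the plain L1 contraction; the weight
  \<open>1 + \<eta> * norm x\<close> serves for first moments.\<close>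

lemma weighted_nn_integral_convolution_le:
  fixes w :: "'a::euclidean_space \<Rightarrow> real" and f :: "'a \<Rightarrow> complex"
  assumes "finite_measure \<kappa>" and [measurable_cong]: "sets \<kappa> = sets borel"
    and [measurable]: "f \<in> borel_measurable borel" "w \<in> borel_measurable borel"
    and w: "\<And>x. 0 \<le> w x" and K: "0 \<le> K" "AE y in \<kappa>. \<forall>x. w x \<le> K * w (x + y)"
  shows "(\<integral>\<^sup>+x. ennreal (w x * cmod (\<integral>y. f (x + y) \<partial>\<kappa>)) \<partial>lborel)
    \<le> ennreal (K * measure \<kappa> (space \<kappa>)) * (\<integral>\<^sup>+x. ennreal (w x * cmod (f x)) \<partial>lborel)"
proof -
  interpret finite_measure \<kappa> by fact
  interpret P: pair_sigma_finite lborel \<kappa> by standard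
  have "(\<integral>\<^sup>+x. ennreal (w x * cmod (\<integral>y. f (x + y) \<partial>\<kappa>)) \<partial>lborel)
      \<le> (\<integral>\<^sup>+x. (\<integral>\<^sup>+y. ennreal (w x) * ennreal (cmod (f (x + y))) \<partial>\<kappa>) \<partial>lborel)"
  proof (rule nn_integral_mono)
    fix x
    show "ennreal (w x * cmod (\<integral>y. f (x + y) \<partial>\<kappa>)) \<le> (\<integral>\<^sup>+y. ennreal (w x) * ennreal (cmod (f (x + y))) \<partial>\<kappa>)"
    proof (cases "integrable \<kappa> (\<lambda>y. f (x + y))")
      case True
      then show ?thesis
        by (subst nn_integral_cmult) (auto simp: ennreal_mult w intro!: mult_left_mono integral_norm_bound_ennreal)
    next
      \<comment> \<open>The Bochner integral is then 0 by convention, so the left side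
        vanishes.\<close>
      case False
      then show ?thesis by (simp add: not_integrable_integral_eq)
    qed
  qed
  also have "\<dots> = (\<integral>\<^sup>+y. (\<integral>\<^sup>+x. ennreal (w x) * ennreal (cmod (f (x + y))) \<partial>lborel) \<partial>\<kappa>)"
    by (rule P.Fubini'[symmetric]) measurable
  also have "\<dots> \<le> (\<integral>\<^sup>+y. ennreal K * (\<integral>\<^sup>+x. ennreal (w x * cmod (f x)) \<partial>lborel) \<partial>\<kappa>)"
  proof (rule nn_integral_mono_AE, use K(2) in eventually_elim)
    fix y assume y: "\<forall>x. w x \<le> K * w (x + y)"
    have "(\<integral>\<^sup>+x. ennreal (w x) * ennreal (cmod (f (x + y))) \<partial>lborel)
        \<le> (\<integral>\<^sup>+x. ennreal K * ennreal (w (x + y) * cmod (f (x + y))) \<partial>lborel)"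
    proof (rule nn_integral_mono)
      fix x
      have "w x * cmod (f (x + y)) \<le> K * w (x + y) * cmod (f (x + y))"
        using y by (intro mult_right_mono) auto
      then show "ennreal (w x) * ennreal (cmod (f (x + y))) \<le> ennreal K * ennreal (w (x + y) * cmod (f (x + y)))"
        using K(1) w by (simp add: ennreal_mult[symmetric] mult_ac)
    qed
    also have "\<dots> = ennreal K * (\<integral>\<^sup>+x. ennreal (w (x + y) * cmod (f (x + y))) \<partial>lborel)"
      by (rule nn_integral_cmult) measurable
    also have "(\<integral>\<^sup>+x. ennreal (w (x + y) * cmod (f (x + y))) \<partial>lborel) = (\<integral>\<^sup>+x. ennreal (w x * cmod (f x)) \<partial>lborel)"
      by (rule nn_integral_lborel_shift) measurable
    finally show "(\<integral>\<^sup>+x. ennreal (w x) * ennreal (cmod (f (x + y))) \<partial>lborel)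
      \<le> ennreal K * (\<integral>\<^sup>+x. ennreal (w x * cmod (f x)) \<partial>lborel)" .
  qed
  also have "\<dots> = ennreal (K * measure \<kappa> (space \<kappa>)) * (\<integral>\<^sup>+x. ennreal (w x * cmod (f x)) \<partial>lborel)"
    using K(1) by (simp add: emeasure_eq_measure ennreal_mult mult_ac)
  finally show ?thesis .
qed

text \<open>Iterated convolution. Integrability is part of the induction because the convolution
  theorem for the next factor is applied to the product built so far.\<close>

lemma weighted_nn_integral_mchar_power_le:
  fixes w :: "'a::euclidean_space \<Rightarrow> real"
  assumes \<kappa>: "finite_measure \<kappa>" "sets \<kappa> = sets borel" and h: "integrable lborel h"
    and [measurable]: "w \<in> borel_measurable borel"
    and w: "\<And>x. 0 \<le> w x" and K: "0 \<le> K" "AE y in \<kappa>. \<forall>x. w x \<le> K * w (x + y)"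
  shows "integrable lborel (\<lambda>\<xi>. mchar \<kappa> \<xi> ^ n * h \<xi>) \<and>
    (\<integral>\<^sup>+x. ennreal (w x * cmod (inv_fourier (\<lambda>\<xi>. mchar \<kappa> \<xi> ^ n * h \<xi>) x)) \<partial>lborel)
    \<le> ennreal ((K * measure \<kappa> (space \<kappa>)) ^ n) * (\<integral>\<^sup>+x. ennreal (w x * cmod (inv_fourier h x)) \<partial>lborel)"
    (is "_ \<and> ?I n \<le> _ * ?J")
proof (induction n)
  case 0
  then show ?case using h by simp
next
  case (Suc n)
  note [measurable] = borel_measurable_mchar[OF \<kappa>] borel_measurable_integrable[OF h]
  let ?h = "\<lambda>\<xi>. mchar \<kappa> \<xi> ^ n * h \<xi>"
  have int: "integrable lborel (\<lambda>\<xi>. mchar \<kappa> \<xi> * ?h \<xi>)"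
    using Suc norm_mchar_le[OF \<kappa>(1)]
    by (rule_tac integrable_mult_bounded[where B="measure \<kappa> (space \<kappa>)"]) auto
  have "?I (Suc n) = (\<integral>\<^sup>+x. ennreal (w x * cmod (\<integral>y. inv_fourier ?h (x + y) \<partial>\<kappa>)) \<partial>lborel)"
    using inv_fourier_mult_mchar[OF \<kappa>, of ?h] Suc by (simp add: mult_ac)
  also have "\<dots> \<le> ennreal (K * measure \<kappa> (space \<kappa>)) * ?I n"
    using \<kappa> w K by (intro weighted_nn_integral_convolution_le) auto
  also have "\<dots> \<le> ennreal (K * measure \<kappa> (space \<kappa>)) * (ennreal ((K * measure \<kappa> (space \<kappa>)) ^ n) * ?J)"
    using Suc by (intro mult_left_mono) auto
  also have "\<dots> = ennreal ((K * measure \<kappa> (space \<kappa>)) ^ Suc n) * ?J"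
    using K(1) by (simp add: ennreal_mult mult_ac)
  finally show ?case using int by (simp add: mult_ac)
qed

text \<open>
  The factor \<open>exp (mchar \<kappa> \<xi> - \<kappa>(UNIV))\<close> is the characteristic function of a compound Poisson
  law.  Expanding the exponential avoids constructing that law.
\<close>

lemma weighted_nn_integral_compound_poisson_le:
  fixes w :: "'a::euclidean_space \<Rightarrow> real"
  assumes \<kappa>: "finite_measure \<kappa>" "sets \<kappa> = sets borel" and h: "integrable lborel h"
    and [measurable]: "w \<in> borel_measurable borel"
    and w: "\<And>x. 0 \<le> w x" and K: "0 \<le> K" "AE y in \<kappa>. \<forall>x. w x \<le> K * w (x + y)"
  shows "(\<integral>\<^sup>+x. ennreal (w x * cmod (inv_fourier (\<lambda>\<xi>. exp (mchar \<kappa> \<xi> - measure \<kappa> (space \<kappa>)) * h \<xi>) x)) \<partial>lborel)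
    \<le> ennreal (exp ((K - 1) * measure \<kappa> (space \<kappa>))) * (\<integral>\<^sup>+x. ennreal (w x * cmod (inv_fourier h x)) \<partial>lborel)"
    (is "?L \<le> _ * ?J")
proof -
  note [measurable] = borel_measurable_mchar[OF \<kappa>] borel_measurable_integrable[OF h]
  define m where "m = measure \<kappa> (space \<kappa>)"
  have m: "0 \<le> m" unfolding m_def by simp
  note pow = weighted_nn_integral_mchar_power_le[OF \<kappa> h \<open>w \<in> _\<close> w K]
  \<comment> \<open>The n-th term of the exponential series; its inverse transform is the
    contribution of exactly n jumps.\<close>
  define T where "T n \<xi> = (mchar \<kappa> \<xi> ^ n /\<^sub>R fact n) * (exp (- m) *\<^sub>R h \<xi>)" for n \<xi>
  define u where "u n x = inv_fourier (T n) x" for n x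
  have u: "u n x = (exp (- m) / fact n) *\<^sub>R inv_fourier (\<lambda>\<xi>. mchar \<kappa> \<xi> ^ n * h \<xi>) x" for n x
  proof -
    have "u n x = (\<integral>\<xi>. (exp (- m) / fact n) *\<^sub>R (iexp (x \<bullet> \<xi>) * (mchar \<kappa> \<xi> ^ n * h \<xi>)) \<partial>lborel)"
      unfolding u_def T_def inv_fourier_def
      by (intro Bochner_Integration.integral_cong) (auto simp: scaleR_conv_of_real field_simps)
    then show ?thesis unfolding inv_fourier_def by simp
  qed
  have Tmeas [measurable]: "T n \<in> borel_measurable borel" for n unfolding T_def by measurable
  have umeas [measurable]: "u n \<in> borel_measurable borel" for n unfolding u_def by measurable
  have un: "(\<integral>\<^sup>+x. ennreal (w x * cmod (u n x)) \<partial>lborel) \<le> ennreal (exp (- m) * ((K * m) ^ n / fact n)) * ?J" for n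
  proof -
    have "(\<integral>\<^sup>+x. ennreal (w x * cmod (u n x)) \<partial>lborel) =
        (\<integral>\<^sup>+x. ennreal (exp (- m) / fact n) * ennreal (w x * cmod (inv_fourier (\<lambda>\<xi>. mchar \<kappa> \<xi> ^ n * h \<xi>) x)) \<partial>lborel)"
      using w by (intro nn_integral_cong) (auto simp: u ennreal_mult[symmetric] mult_ac)
    also have "\<dots> = ennreal (exp (- m) / fact n) * (\<integral>\<^sup>+x. ennreal (w x * cmod (inv_fourier (\<lambda>\<xi>. mchar \<kappa> \<xi> ^ n * h \<xi>) x)) \<partial>lborel)"
      by (rule nn_integral_cmult) measurable
    also have "\<dots> \<le> ennreal (exp (- m) / fact n) * (ennreal ((K * m) ^ n) * ?J)"
      using pow[of n] unfolding m_def by (intro mult_left_mono) auto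
    also have "\<dots> = ennreal (exp (- m) * ((K * m) ^ n / fact n)) * ?J"
      using K m by (simp add: ennreal_mult[symmetric] mult_ac flip: mult.assoc)
    finally show ?thesis .
  qed
  have sumT: "(\<lambda>n. T n \<xi>) sums (exp (mchar \<kappa> \<xi> - m) * h \<xi>)" for \<xi>
  proof -
    have "(\<lambda>n. T n \<xi>) sums (exp (mchar \<kappa> \<xi>) * (exp (- m) *\<^sub>R h \<xi>))"
      unfolding T_def by (intro sums_mult2 exp_converges)
    then show ?thesis
      by (simp add: exp_diff scaleR_conv_of_real exp_of_real exp_minus field_simps)
  qed
  \<comment> \<open>The series is exchanged with the Fourier integral: every partial sum is
    dominated by \<open>exp m * cmod (exp (- m) *\<^sub>R h \<xi>)\<close>, since
    \<open>mchar \<kappa>\<close> is bounded by \<open>m\<close>.\<close>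
  have lim: "(\<lambda>n. \<Sum>k<n. u k x) \<longlonglongrightarrow> inv_fourier (\<lambda>\<xi>. exp (mchar \<kappa> \<xi> - m) * h \<xi>) x" for x
  proof -
    have bnd: "cmod (T n \<xi>) \<le> (m ^ n /\<^sub>R fact n) * cmod (exp (- m) *\<^sub>R h \<xi>)" for n \<xi>
      unfolding T_def norm_mult using norm_mchar_le[OF \<kappa>(1), of \<xi>]
      by (intro mult_right_mono) (auto simp: norm_power m_def divide_right_mono power_mono)
    have intT: "integrable lborel (\<lambda>\<xi>. iexp (x \<bullet> \<xi>) * T n \<xi>)" for n
      using pow[of n] unfolding T_def
      by (intro integrable_mult_bounded[where B=1] integrable_mult_bounded[where B="m ^ n / fact n"] integrable_scaleR_right h)
         (auto simp: norm_power norm_divide m_def divide_simps norm_mchar_le[OF \<kappa>(1)] intro!: power_mono)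
    have "(\<lambda>n. \<integral>\<xi>. (\<Sum>k<n. iexp (x \<bullet> \<xi>) * T k \<xi>) \<partial>lborel) \<longlonglongrightarrow> (\<integral>\<xi>. iexp (x \<bullet> \<xi>) * (exp (mchar \<kappa> \<xi> - m) * h \<xi>) \<partial>lborel)"
    proof (rule integral_dominated_convergence)
      show "integrable lborel (\<lambda>\<xi>. exp m * cmod (exp (- m) *\<^sub>R h \<xi>))"
        using h by (intro integrable_mult_right integrable_norm integrable_scaleR_right)
      show "AE \<xi> in lborel. (\<lambda>n. \<Sum>k<n. iexp (x \<bullet> \<xi>) * T k \<xi>) \<longlonglongrightarrow> iexp (x \<bullet> \<xi>) * (exp (mchar \<kappa> \<xi> - m) * h \<xi>)"
        using sums_mult[OF sumT, of "iexp (x \<bullet> _)"] unfolding sums_def by auto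
      fix n
      show "AE \<xi> in lborel. cmod (\<Sum>k<n. iexp (x \<bullet> \<xi>) * T k \<xi>) \<le> exp m * cmod (exp (- m) *\<^sub>R h \<xi>)"
      proof (rule AE_I2)
        fix \<xi>
        have "cmod (\<Sum>k<n. iexp (x \<bullet> \<xi>) * T k \<xi>) \<le> (\<Sum>k<n. (m ^ k /\<^sub>R fact k) * cmod (exp (- m) *\<^sub>R h \<xi>))"
          using bnd by (intro sum_norm_le) (auto simp: norm_mult)
        also have "\<dots> = (\<Sum>k<n. m ^ k /\<^sub>R fact k) * cmod (exp (- m) *\<^sub>R h \<xi>)"
          by (simp add: sum_distrib_right)
        also have "\<dots> \<le> exp m * cmod (exp (- m) *\<^sub>R h \<xi>)"
          using m unfolding exp_def by (intro mult_right_mono sum_le_suminf summable_exp_generic) auto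
        finally show "cmod (\<Sum>k<n. iexp (x \<bullet> \<xi>) * T k \<xi>) \<le> exp m * cmod (exp (- m) *\<^sub>R h \<xi>)" .
      qed
    qed measurable
    then show ?thesis
      unfolding u_def inv_fourier_def using intT by (subst (asm) Bochner_Integration.integral_sum) auto
  qed
  have "?L = (\<integral>\<^sup>+x. liminf (\<lambda>n. ennreal (w x * cmod (\<Sum>k<n. u k x))) \<partial>lborel)"
  proof (rule nn_integral_cong)
    fix x
    have "(\<lambda>n. ennreal (w x * cmod (\<Sum>k<n. u k x))) \<longlonglongrightarrow> ennreal (w x * cmod (inv_fourier (\<lambda>\<xi>. exp (mchar \<kappa> \<xi> - m) * h \<xi>) x))"
      by (intro tendsto_ennrealI tendsto_mult tendsto_const tendsto_norm lim)
    from lim_imp_Liminf[OF _ this] show "ennreal (w x * cmod (inv_fourier (\<lambda>\<xi>. exp (mchar \<kappa> \<xi> - measure \<kappa> (space \<kappa>)) * h \<xi>) x)) = liminf (\<lambda>n. ennreal (w x * cmod (\<Sum>k<n. u k x)))"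
      by (simp add: m_def)
  qed
  also have "\<dots> \<le> liminf (\<lambda>n. \<integral>\<^sup>+x. ennreal (w x * cmod (\<Sum>k<n. u k x)) \<partial>lborel)"
    by (rule nn_integral_liminf) measurable
  also have "\<dots> \<le> ennreal (exp ((K - 1) * m)) * ?J"
  proof (rule Liminf_le[OF sequentially_bot eventuallyI])
    fix n
    have "(\<integral>\<^sup>+x. ennreal (w x * cmod (\<Sum>k<n. u k x)) \<partial>lborel) \<le> (\<integral>\<^sup>+x. (\<Sum>k<n. ennreal (w x * cmod (u k x))) \<partial>lborel)"
      using w by (intro nn_integral_mono) (auto simp: sum_ennreal sum_distrib_left[symmetric] intro!: ennreal_leI mult_left_mono norm_sum)
    also have "\<dots> = (\<Sum>k<n. \<integral>\<^sup>+x. ennreal (w x * cmod (u k x)) \<partial>lborel)"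
      by (rule nn_integral_sum) measurable
    also have "\<dots> \<le> (\<Sum>k<n. ennreal (exp (- m) * ((K * m) ^ k / fact k)) * ?J)"
      by (intro sum_mono un)
    also have "\<dots> = (\<Sum>k<n. ennreal (exp (- m) * ((K * m) ^ k / fact k))) * ?J"
      by (rule sum_distrib_right[symmetric])
    also have "(\<Sum>k<n. ennreal (exp (- m) * ((K * m) ^ k / fact k))) = ennreal (exp (- m) * (\<Sum>k<n. (K * m) ^ k /\<^sub>R fact k))"
      using K m by (subst sum_ennreal) (auto simp: sum_distrib_left divide_inverse mult_ac)
    also have "ennreal (exp (- m) * (\<Sum>k<n. (K * m) ^ k /\<^sub>R fact k)) * ?J \<le> ennreal (exp (- m) * exp (K * m)) * ?J"
    proof -
      have "(\<Sum>k<n. (K * m) ^ k /\<^sub>R fact k) \<le> exp (K * m)"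
        using K m unfolding exp_def by (intro sum_le_suminf summable_exp_generic) auto
      then show ?thesis by (intro mult_right_mono ennreal_leI mult_left_mono) auto
    qed
    \<comment> \<open>The generating function at \<open>K\<close> of the Poisson law with mean
      \<open>m\<close>: each jump costs one factor \<open>K\<close>.\<close>
    also have "exp (- m) * exp (K * m) = exp ((K - 1) * m)"
      by (simp add: exp_add[symmetric] algebra_simps)
    finally show "(\<integral>\<^sup>+x. ennreal (w x * cmod (\<Sum>k<n. u k x)) \<partial>lborel) \<le> ennreal (exp ((K - 1) * m)) * ?J" .
  qed
  finally show ?thesis by (simp add: m_def)
qed

text \<open>The supremum bound is used on the ball of radius \<open>R\<close>; outside it
  \<open>1 + \<eta> * norm x\<close> is at least \<open>\<eta> * R\<close>, so the weighted norm
  controls the rest as in Chebyshev's inequality.\<close>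

lemma nn_integral_weighted_tail_le:
  fixes f :: "'a::euclidean_space \<Rightarrow> complex"
  assumes [measurable]: "f \<in> borel_measurable borel" and b: "\<And>x. cmod (f x) \<le> b"
    and "0 < \<eta>" "0 < R"
  shows "(\<integral>\<^sup>+x. ennreal (cmod (f x)) \<partial>lborel) \<le> ennreal (b * (unit_ball_vol DIM('a) * R ^ DIM('a))) +
    ennreal (1 / (\<eta> * R)) * (\<integral>\<^sup>+x. ennreal ((1 + \<eta> * norm x) * cmod (f x)) \<partial>lborel)"
proof -
  have b0: "0 \<le> b" using order_trans[OF norm_ge_zero b[of 0]] .
  have "(\<integral>\<^sup>+x. ennreal (cmod (f x)) \<partial>lborel) \<le>
      (\<integral>\<^sup>+x. ennreal b * indicator (cball 0 R) x + ennreal (1 / (\<eta> * R)) * ennreal ((1 + \<eta> * norm x) * cmod (f x)) \<partial>lborel)"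
  proof (rule nn_integral_mono)
    fix x :: 'a
    show "ennreal (cmod (f x)) \<le> ennreal b * indicator (cball 0 R) x + ennreal (1 / (\<eta> * R)) * ennreal ((1 + \<eta> * norm x) * cmod (f x))"
    proof (cases "norm x \<le> R")
      case True
      then show ?thesis using b[of x] by (simp add: add_increasing2 ennreal_leI)
    next
      case False
      then have "\<eta> * R * cmod (f x) \<le> (1 + \<eta> * norm x) * cmod (f x)"
        using assms by (intro mult_right_mono add_increasing mult_left_mono) auto
      then have "cmod (f x) \<le> 1 / (\<eta> * R) * ((1 + \<eta> * norm x) * cmod (f x))"
        using assms by (simp add: field_simps)
      then have "ennreal (cmod (f x)) \<le> ennreal (1 / (\<eta> * R)) * ennreal ((1 + \<eta> * norm x) * cmod (f x))"
        using assms by (subst ennreal_mult[symmetric]) (auto intro: ennreal_leI)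
      then show ?thesis by (simp add: add_increasing)
    qed
  qed
  also have "\<dots> = ennreal b * emeasure lborel (cball (0::'a) R) +
      ennreal (1 / (\<eta> * R)) * (\<integral>\<^sup>+x. ennreal ((1 + \<eta> * norm x) * cmod (f x)) \<partial>lborel)"
    by (subst nn_integral_add) (auto simp: nn_integral_cmult nn_integral_cmult_indicator intro!: borel_measurable_times_ennreal borel_measurable_indicator)
  also have "emeasure lborel (cball (0::'a) R) = ennreal (unit_ball_vol DIM('a) * R ^ DIM('a))"
    using assms by (intro emeasure_cball) auto
  finally show ?thesis using b0 assms by (simp add: ennreal_mult)
qed

text \<open>
  The supremum bound decays like \<open>exp (-c\<tau>)\<close>, while the weight \<open>1 + \<eta>|x|\<close> makes the weighted
  norm grow only like \<open>exp (\<eta>\<rho>m\<tau>)\<close>.  Splitting at radius \<open>exp (c\<tau>/2d)\<close> and taking \<open>\<eta>\<close> small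
  leaves exponential decay, without differentiating the symbol.
\<close>

lemma compound_poisson_exponential_decay:
  fixes h :: "'a::euclidean_space \<Rightarrow> complex"
  assumes "0 < c" "0 \<le> m" "0 \<le> \<rho>" and h: "integrable lborel h"
    and fin: "(\<integral>\<^sup>+x. ennreal ((1 + norm x) * cmod (inv_fourier h x)) \<partial>lborel) < \<infinity>"
  obtains C c' where "0 < C" "0 < c'"
    "\<And>\<tau> \<kappa>. \<lbrakk>0 \<le> \<tau>; finite_measure \<kappa>; sets \<kappa> = sets borel; AE y in \<kappa>. norm y \<le> \<rho>;
       measure \<kappa> (space \<kappa>) \<le> m * \<tau>;
       \<forall>\<xi>. h \<xi> \<noteq> 0 \<longrightarrow> Re (mchar \<kappa> \<xi>) - measure \<kappa> (space \<kappa>) \<le> - (c * \<tau>)\<rbrakk> \<Longrightarrow>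
       (\<integral>\<^sup>+x. ennreal (cmod (inv_fourier (\<lambda>\<xi>. exp (mchar \<kappa> \<xi> - measure \<kappa> (space \<kappa>)) * h \<xi>) x)) \<partial>lborel)
       \<le> ennreal (C * exp (- (c' * \<tau>)))"
proof -
  note [measurable] = borel_measurable_integrable[OF h]
  define d where "d = real DIM('a)"
  have d: "d > 0" unfolding d_def by simp
  \<comment> \<open>The weighted norm grows with exponent \<open>\<eta> * \<rho> * m\<close> per
    unit of \<tau>; this choice keeps it below \<open>c / (4 * d)\<close>. The added ones keep the
    denominator positive when \<open>m\<close> or \<rho> is 0.\<close>
  define \<eta> where "\<eta> = c / (4 * d * (m + 1) * (\<rho> + 1))"
  have \<eta>: "\<eta> > 0" unfolding \<eta>_def using assms d by simp
  have \<eta>\<rho>m: "\<eta> * \<rho> * m \<le> c / (4 * d)"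
  proof -
    have "\<eta> * \<rho> * m \<le> \<eta> * (\<rho> + 1) * (m + 1)" using \<eta> assms by (intro mult_mono) auto
    also have "\<dots> = c / (4 * d)" using assms d unfolding \<eta>_def by (simp add: add_nonneg_eq_0_iff field_simps)
    finally show ?thesis .
  qed
  define I where "I = (\<integral>\<xi>. cmod (h \<xi>) \<partial>lborel)"
  have I: "I \<ge> 0" unfolding I_def by simp
  define V where "V = unit_ball_vol DIM('a)"
  have V: "V \<ge> 0" unfolding V_def by simp
  define J where "J = (\<integral>\<^sup>+x. ennreal ((1 + \<eta> * norm x) * cmod (inv_fourier h x)) \<partial>lborel)"
  have "J \<le> (\<integral>\<^sup>+x. ennreal (1 + \<eta>) * ennreal ((1 + norm x) * cmod (inv_fourier h x)) \<partial>lborel)"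
    unfolding J_def
  proof (intro nn_integral_mono)
    fix x :: 'a
    have "1 + \<eta> * norm x \<le> (1 + \<eta>) * (1 + norm x)" using \<eta> by (simp add: algebra_simps)
    then have "(1 + \<eta> * norm x) * cmod (inv_fourier h x) \<le> (1 + \<eta>) * (1 + norm x) * cmod (inv_fourier h x)"
      by (rule mult_right_mono) simp
    then show "ennreal ((1 + \<eta> * norm x) * cmod (inv_fourier h x)) \<le> ennreal (1 + \<eta>) * ennreal ((1 + norm x) * cmod (inv_fourier h x))"
      using \<eta> by (subst ennreal_mult[symmetric]) (auto simp: mult.assoc intro: ennreal_leI)
  qed
  also have "\<dots> < \<infinity>" using fin \<eta> by (simp add: nn_integral_cmult ennreal_mult_less_top)
  finally obtain j where j: "J = ennreal j" "0 \<le> j" by (cases J) auto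
  \<comment> \<open>\<open>I * V\<close> comes from the ball, \<open>j / \<eta>\<close> from the
    tail, and 1 makes the constant positive.\<close>
  define C where "C = I * V + j / \<eta> + 1"
  have "C > 0" unfolding C_def using I V j \<eta> by (simp add: add_nonneg_pos)
  moreover have "c / (4 * d) > 0" using assms d by simp
  moreover
  { fix \<tau> \<kappa>
    assume \<tau>: "0 \<le> \<tau>" and \<kappa>: "finite_measure \<kappa>" "sets \<kappa> = sets borel" and supp: "AE y in \<kappa>. norm y \<le> \<rho>"
      and m: "measure \<kappa> (space \<kappa>) \<le> m * \<tau>"
      and re: "\<forall>\<xi>. h \<xi> \<noteq> 0 \<longrightarrow> Re (mchar \<kappa> \<xi>) - measure \<kappa> (space \<kappa>) \<le> - (c * \<tau>)"
    note [measurable] = borel_measurable_mchar[OF \<kappa>]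
    define f where "f = inv_fourier (\<lambda>\<xi>. exp (mchar \<kappa> \<xi> - measure \<kappa> (space \<kappa>)) * h \<xi>)"
    have [measurable]: "f \<in> borel_measurable borel" unfolding f_def by measurable
    have bnd: "cmod (f x) \<le> exp (- (c * \<tau>)) * I" for x
    proof -
      \<comment> \<open>Where \<open>h\<close> vanishes both sides are 0, so damping is required
        only on the support of \<open>h\<close>.\<close>
      have pt: "cmod (exp (mchar \<kappa> \<xi> - measure \<kappa> (space \<kappa>)) * h \<xi>) \<le> exp (- (c * \<tau>)) * cmod (h \<xi>)" for \<xi>
        using re[rule_format, of \<xi>] by (cases "h \<xi> = 0") (auto simp: norm_mult)
      have "cmod (f x) \<le> (\<integral>\<xi>. cmod (exp (mchar \<kappa> \<xi> - measure \<kappa> (space \<kappa>)) * h \<xi>) \<partial>lborel)"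
        unfolding f_def by (rule norm_inv_fourier_le)
      also have "\<dots> \<le> (\<integral>\<xi>. exp (- (c * \<tau>)) * cmod (h \<xi>) \<partial>lborel)"
      proof (rule integral_mono)
        show *: "integrable lborel (\<lambda>\<xi>. exp (- (c * \<tau>)) * cmod (h \<xi>))" using h by simp
        show "integrable lborel (\<lambda>\<xi>. cmod (exp (mchar \<kappa> \<xi> - measure \<kappa> (space \<kappa>)) * h \<xi>))"
          by (rule Bochner_Integration.integrable_bound[OF *]) (use pt in auto)
      qed (rule pt)
      also have "\<dots> = exp (- (c * \<tau>)) * I" by (simp add: I_def)
      finally show ?thesis .
    qed
    have w: "(\<integral>\<^sup>+x. ennreal ((1 + \<eta> * norm x) * cmod (f x)) \<partial>lborel) \<le> ennreal (exp (c / (4 * d) * \<tau>) * j)"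
    proof -
      have "(\<integral>\<^sup>+x. ennreal ((1 + \<eta> * norm x) * cmod (f x)) \<partial>lborel)
        \<le> ennreal (exp ((1 + \<eta> * \<rho> - 1) * measure \<kappa> (space \<kappa>))) * J"
        unfolding f_def J_def
      proof (rule weighted_nn_integral_compound_poisson_le[OF \<kappa> h])
        \<comment> \<open>Jumps of size at most \<rho> change the weight by at most the factor
          \<open>K = 1 + \<eta> * \<rho>\<close>, by the triangle inequality; thus
          \<open>K - 1\<close> is small with \<eta>.\<close>
        show "AE y in \<kappa>. \<forall>x. 1 + \<eta> * norm x \<le> (1 + \<eta> * \<rho>) * (1 + \<eta> * norm (x + y))"
          using supp
        proof eventually_elim
          case (elim y)
          show ?case
          proof
            fix x
            have "norm x \<le> norm (x + y) + \<rho>" using elim norm_triangle_ineq4[of "x + y" y] by simp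
            then have "1 + \<eta> * norm x \<le> 1 + \<eta> * (norm (x + y) + \<rho>)" using \<eta> by simp
            also have "\<dots> \<le> (1 + \<eta> * \<rho>) * (1 + \<eta> * norm (x + y))"
              using \<eta> assms by (simp add: algebra_simps)
            finally show "1 + \<eta> * norm x \<le> (1 + \<eta> * \<rho>) * (1 + \<eta> * norm (x + y))" .
          qed
        qed
      qed (use \<eta> assms in auto)
      also have "\<eta> * \<rho> * measure \<kappa> (space \<kappa>) \<le> c / (4 * d) * \<tau>"
      proof -
        have "\<eta> * \<rho> * measure \<kappa> (space \<kappa>) \<le> \<eta> * \<rho> * (m * \<tau>)"
          using m \<eta> assms by (intro mult_left_mono) auto
        also have "\<dots> = (\<eta> * \<rho> * m) * \<tau>" by simp
        also have "\<dots> \<le> c / (4 * d) * \<tau>" by (rule mult_right_mono[OF \<eta>\<rho>m \<tau>])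
        finally show ?thesis .
      qed
      then have "ennreal (exp ((1 + \<eta> * \<rho> - 1) * measure \<kappa> (space \<kappa>))) * J \<le> ennreal (exp (c / (4 * d) * \<tau>)) * J"
        by (intro mult_right_mono ennreal_leI) auto
      finally show ?thesis using j by (simp add: ennreal_mult)
    qed
    \<comment> \<open>In the ball term the volume factor \<open>R ^ d = exp (c * \<tau> / 2)\<close>
      uses up only half of the decay. In the tail term \<open>1 / R\<close> beats the growth
      \<open>exp (c * \<tau> / (4 * d))\<close> and leaves its reciprocal.\<close>
    define R where "R = exp (c * \<tau> / (2 * d))"
    have R: "R > 0" unfolding R_def by simp
    have "(\<integral>\<^sup>+x. ennreal (cmod (f x)) \<partial>lborel) \<le> ennreal (exp (- (c * \<tau>)) * I * (unit_ball_vol DIM('a) * R ^ DIM('a))) +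
      ennreal (1 / (\<eta> * R)) * (\<integral>\<^sup>+x. ennreal ((1 + \<eta> * norm x) * cmod (f x)) \<partial>lborel)"
      by (rule nn_integral_weighted_tail_le[OF _ bnd \<eta> R]) measurable
    also have "\<dots> \<le> ennreal (exp (- (c * \<tau>)) * I * (V * R ^ DIM('a))) + ennreal (1 / (\<eta> * R)) * ennreal (exp (c / (4 * d) * \<tau>) * j)"
      unfolding V_def using w by (intro add_left_mono mult_left_mono) auto
    also have "\<dots> = ennreal (exp (- (c * \<tau>)) * I * (V * R ^ DIM('a)) + 1 / (\<eta> * R) * (exp (c / (4 * d) * \<tau>) * j))"
    proof -
      have "0 \<le> exp (- (c * \<tau>)) * I * (V * R ^ DIM('a))" "0 \<le> 1 / (\<eta> * R)" "0 \<le> exp (c / (4 * d) * \<tau>) * j"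
        using I V R \<eta> j by auto
      then show ?thesis by (metis ennreal_mult ennreal_plus mult_nonneg_nonneg)
    qed
    also have "\<dots> \<le> ennreal (C * exp (- (c / (4 * d) * \<tau>)))"
    proof (rule ennreal_leI)
      have "R ^ DIM('a) = exp (c * \<tau> / 2)"
        unfolding R_def using d by (simp add: exp_of_nat_mult[symmetric] d_def)
      then have "exp (- (c * \<tau>)) * I * (V * R ^ DIM('a)) = I * V * (exp (- (c * \<tau>)) * exp (c * \<tau> / 2))"
        by (simp only: mult_ac)
      also have "exp (- (c * \<tau>)) * exp (c * \<tau> / 2) = exp (- (c * \<tau> / 2))"
        unfolding exp_add[symmetric] by simp
      also have "I * V * exp (- (c * \<tau> / 2)) \<le> I * V * exp (- (c / (4 * d) * \<tau>))"
      proof -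
        have "1 \<le> d" unfolding d_def by (simp add: Suc_leI)
        then have "c / (4 * d) \<le> c / 2" using assms by (intro divide_left_mono) auto
        from mult_right_mono[OF this \<tau>] show ?thesis using I V by (intro mult_left_mono) auto
      qed
      finally have 1: "exp (- (c * \<tau>)) * I * (V * R ^ DIM('a)) \<le> I * V * exp (- (c / (4 * d) * \<tau>))" .
      have "1 / (\<eta> * R) * (exp (c / (4 * d) * \<tau>) * j) = j / \<eta> * (exp (c / (4 * d) * \<tau>) / R)"
        by simp
      also have "exp (c / (4 * d) * \<tau>) / R = exp (- (c / (4 * d) * \<tau>))"
        unfolding R_def exp_diff[symmetric] by (simp add: field_simps)
      finally show "exp (- (c * \<tau>)) * I * (V * R ^ DIM('a)) + 1 / (\<eta> * R) * (exp (c / (4 * d) * \<tau>) * j) \<le> C * exp (- (c / (4 * d) * \<tau>))"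
        using 1 unfolding C_def distrib_right by (simp add: add_increasing2)
    qed
    finally have "(\<integral>\<^sup>+x. ennreal (cmod (f x)) \<partial>lborel) \<le> ennreal (C * exp (- (c / (4 * d) * \<tau>)))" . }
  ultimately show thesis by (intro that[of C "c / (4 * d)"]) auto
qed

section \<open>Averages of kernels\<close>

text \<open>\<open>M\<close> is the mixture of the measures \<open>K u\<close> with respect to
  \<open>P\<close>. The masses of the \<open>K u\<close> may exceed 1 and vary, so this is not a
  monadic bind of probability kernels. It is used for time averages of truncated jump measures and,
  over a two-point space, for sums of two measures.\<close>

definition kernel_average :: "'u measure \<Rightarrow> ('u \<Rightarrow> 'a measure) \<Rightarrow> 'a measure \<Rightarrow> 'a measure \<Rightarrow> bool" where
  "kernel_average P K S M \<longleftrightarrow> sets M = sets S \<and> (\<forall>u\<in>space P. sets (K u) = sets S) \<and>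
     (\<forall>f :: 'a \<Rightarrow> ennreal. f \<in> borel_measurable S \<longrightarrow> (\<lambda>u. \<integral>\<^sup>+y. f y \<partial>K u) \<in> borel_measurable P \<and>
        (\<integral>\<^sup>+y. f y \<partial>M) = (\<integral>\<^sup>+u. \<integral>\<^sup>+y. f y \<partial>K u \<partial>P))"

text \<open>The averaged set function is countably additive because a series of nonnegative
  functions may be integrated termwise. The integral formula then passes from indicators to all
  nonnegative measurable functions by induction over sums, multiples and monotone limits.\<close>

lemma kernel_average_exists:
  fixes K :: "'u \<Rightarrow> 'a measure" and S :: "'a measure"
  assumes sets: "\<And>u. u \<in> space P \<Longrightarrow> sets (K u) = sets S"
    and meas: "\<And>B. B \<in> sets S \<Longrightarrow> (\<lambda>u. emeasure (K u) B) \<in> borel_measurable P"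
  obtains M where "kernel_average P K S M"
proof -
  define \<mu> where "\<mu> B = (\<integral>\<^sup>+u. emeasure (K u) B \<partial>P)" for B
  define M where "M = measure_of (space S) (sets S) \<mu>"
  have setsM: "sets M = sets S" unfolding M_def by simp
  have emM: "emeasure M B = \<mu> B" if "B \<in> sets S" for B
    unfolding M_def
  proof (rule emeasure_measure_of_sigma[OF sets.sigma_algebra_axioms _ _ that])
    show "positive (sets S) \<mu>" unfolding positive_def \<mu>_def by simp
    show "countably_additive (sets S) \<mu>"
    proof (rule countably_additiveI)
      fix B :: "nat \<Rightarrow> 'a set" assume B: "range B \<subseteq> sets S" "disjoint_family B"
      have "(\<Sum>i. \<mu> (B i)) = (\<integral>\<^sup>+u. (\<Sum>i. emeasure (K u) (B i)) \<partial>P)"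
        unfolding \<mu>_def using B meas by (intro nn_integral_suminf[symmetric]) auto
      also have "\<dots> = (\<integral>\<^sup>+u. emeasure (K u) (\<Union>i. B i) \<partial>P)"
        using B sets by (intro nn_integral_cong suminf_emeasure) auto
      finally show "(\<Sum>i. \<mu> (B i)) = \<mu> (\<Union>i. B i)" unfolding \<mu>_def .
    qed
  qed
  have sp: "space (K u) = space S" if "u \<in> space P" for u
    using sets[OF that] by (rule sets_eq_imp_space_eq)
  have KS: "g \<in> borel_measurable (K u) \<longleftrightarrow> g \<in> borel_measurable S" if "u \<in> space P" for u and g :: "'a \<Rightarrow> ennreal"
    using measurable_cong_sets[OF sets[OF that] refl] by blast
  have MS: "g \<in> borel_measurable M \<longleftrightarrow> g \<in> borel_measurable S" for g :: "'a \<Rightarrow> ennreal"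
    using measurable_cong_sets[OF setsM refl] by blast
  have *: "(\<lambda>u. \<integral>\<^sup>+y. f y \<partial>K u) \<in> borel_measurable P \<and> (\<integral>\<^sup>+y. f y \<partial>M) = (\<integral>\<^sup>+u. \<integral>\<^sup>+y. f y \<partial>K u \<partial>P)"
    if "f \<in> borel_measurable S" for f :: "'a \<Rightarrow> ennreal"
    using that
  proof (induction rule: borel_measurable_induct)
    case (cong f g)
    have "(\<integral>\<^sup>+y. f y \<partial>K u) = (\<integral>\<^sup>+y. g y \<partial>K u)" if "u \<in> space P" for u
      using cong(3) sp[OF that] by (intro nn_integral_cong) auto
    moreover have "(\<integral>\<^sup>+y. f y \<partial>M) = (\<integral>\<^sup>+y. g y \<partial>M)"
      using cong(3) sets_eq_imp_space_eq[OF setsM] by (intro nn_integral_cong) auto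
    ultimately show ?case using cong(4) by (simp cong: measurable_cong nn_integral_cong)
  next
    case (set A)
    have "(\<integral>\<^sup>+y. indicator A y \<partial>K u) = emeasure (K u) A" if "u \<in> space P" for u
      using set sets[OF that] by simp
    moreover have "(\<integral>\<^sup>+y. indicator A y \<partial>M) = \<mu> A"
      using set setsM emM by simp
    ultimately show ?case unfolding \<mu>_def using meas[OF set] by (simp cong: measurable_cong nn_integral_cong)
  next
    case (mult f c)
    have "(\<integral>\<^sup>+y. c * f y \<partial>K u) = c * (\<integral>\<^sup>+y. f y \<partial>K u)" if "u \<in> space P" for u
      using mult KS[OF that] by (intro nn_integral_cmult) auto
    moreover have "(\<integral>\<^sup>+y. c * f y \<partial>M) = c * (\<integral>\<^sup>+y. f y \<partial>M)"
      using mult MS by (intro nn_integral_cmult) auto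
    ultimately show ?case using mult
      by (auto simp: nn_integral_cmult intro!: borel_measurable_times_ennreal cong: measurable_cong nn_integral_cong)
  next
    case (add f g)
    have "(\<integral>\<^sup>+y. g y + f y \<partial>K u) = (\<integral>\<^sup>+y. g y \<partial>K u) + (\<integral>\<^sup>+y. f y \<partial>K u)" if "u \<in> space P" for u
      using add KS[OF that] by (intro nn_integral_add) auto
    moreover have "(\<integral>\<^sup>+y. g y + f y \<partial>M) = (\<integral>\<^sup>+y. g y \<partial>M) + (\<integral>\<^sup>+y. f y \<partial>M)"
      using add MS by (intro nn_integral_add) auto
    ultimately show ?case using add
      by (auto simp: nn_integral_add intro!: borel_measurable_add cong: measurable_cong nn_integral_cong)
  next
    case (seq U)
    have "(\<integral>\<^sup>+y. (SUP i. U i) y \<partial>K u) = (SUP i. \<integral>\<^sup>+y. U i y \<partial>K u)" if "u \<in> space P" for u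
      using seq KS[OF that] unfolding SUP_apply
      by (intro nn_integral_monotone_convergence_SUP) auto
    moreover have "(\<integral>\<^sup>+y. (SUP i. U i) y \<partial>M) = (SUP i. \<integral>\<^sup>+y. U i y \<partial>M)"
      using seq MS unfolding SUP_apply
      by (intro nn_integral_monotone_convergence_SUP) auto
    moreover have "(\<integral>\<^sup>+u. (SUP i. \<integral>\<^sup>+y. U i y \<partial>K u) \<partial>P) = (SUP i. \<integral>\<^sup>+u. \<integral>\<^sup>+y. U i y \<partial>K u \<partial>P)"
      using seq by (intro nn_integral_monotone_convergence_SUP)
        (auto simp: incseq_def le_fun_def intro!: nn_integral_mono)
    moreover have "(\<lambda>u. SUP i. \<integral>\<^sup>+y. U i y \<partial>K u) \<in> borel_measurable P"
      using seq by (intro borel_measurable_SUP) auto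
    ultimately show ?case using seq by (simp cong: measurable_cong nn_integral_cong)
  qed
  show thesis by (rule that[of M]) (use setsM sets * in \<open>simp add: kernel_average_def\<close>)
qed

text \<open>Apply the defining identity to the positive and negative parts. The obstacle is that
  \<open>f\<close> may fail to be integrable under some \<open>K u\<close>; finiteness of the
  averaged integrals confines this to a null set of \<open>P\<close>.\<close>

lemma kernel_average_integral_real:
  fixes K :: "'u \<Rightarrow> 'a measure" and f :: "'a \<Rightarrow> real"
  assumes avg: "kernel_average P K S M"
    and f: "integrable M f"
  shows "integrable P (\<lambda>u. \<integral>y. f y \<partial>K u)" and "(\<integral>y. f y \<partial>M) = (\<integral>u. \<integral>y. f y \<partial>K u \<partial>P)"
proof -
  have setsM: "sets M = sets S" and sets: "\<And>u. u \<in> space P \<Longrightarrow> sets (K u) = sets S"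
    using avg by (auto simp: kernel_average_def)
  have meas: "(\<lambda>u. \<integral>\<^sup>+y. g y \<partial>K u) \<in> borel_measurable P"
    and avg: "(\<integral>\<^sup>+y. g y \<partial>M) = (\<integral>\<^sup>+u. \<integral>\<^sup>+y. g y \<partial>K u \<partial>P)"
    if "g \<in> borel_measurable S" for g :: "'a \<Rightarrow> ennreal"
    using avg that by (auto simp: kernel_average_def)
  have fS [measurable]: "f \<in> borel_measurable S"
    using borel_measurable_integrable[OF f] measurable_cong_sets[OF setsM refl] by blast
  have KS: "f \<in> borel_measurable (K u)" if "u \<in> space P" for u
    using fS measurable_cong_sets[OF sets[OF that] refl] by blast
  have *: "integrable P (\<lambda>u. enn2real (\<integral>\<^sup>+y. ennreal (g y) \<partial>K u)) \<and>
      enn2real (\<integral>\<^sup>+y. ennreal (g y) \<partial>M) = (\<integral>u. enn2real (\<integral>\<^sup>+y. ennreal (g y) \<partial>K u) \<partial>P) \<and>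
      (AE u in P. (\<integral>\<^sup>+y. ennreal (g y) \<partial>K u) < \<infinity>)"
    if g [measurable]: "g \<in> borel_measurable S" and "(\<integral>\<^sup>+y. ennreal (g y) \<partial>M) < \<infinity>" for g
  proof -
    have [measurable]: "(\<lambda>u. \<integral>\<^sup>+y. ennreal (g y) \<partial>K u) \<in> borel_measurable P"
      by (rule meas) measurable
    have eq: "(\<integral>\<^sup>+y. ennreal (g y) \<partial>M) = (\<integral>\<^sup>+u. \<integral>\<^sup>+y. ennreal (g y) \<partial>K u \<partial>P)"
      by (rule avg) measurable
    with that have "(\<integral>\<^sup>+u. \<integral>\<^sup>+y. ennreal (g y) \<partial>K u \<partial>P) \<noteq> \<infinity>" by simp
    then have ae: "AE u in P. (\<integral>\<^sup>+y. ennreal (g y) \<partial>K u) \<noteq> \<infinity>"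
      by (rule nn_integral_PInf_AE[rotated]) measurable
    then have "(\<integral>\<^sup>+u. ennreal (enn2real (\<integral>\<^sup>+y. ennreal (g y) \<partial>K u)) \<partial>P) = (\<integral>\<^sup>+u. \<integral>\<^sup>+y. ennreal (g y) \<partial>K u \<partial>P)"
      by (intro nn_integral_cong_AE) (auto elim!: eventually_mono simp: less_top[symmetric])
    moreover from this have "integrable P (\<lambda>u. enn2real (\<integral>\<^sup>+y. ennreal (g y) \<partial>K u))"
      using that eq by (intro integrableI_nonneg) auto
    ultimately show ?thesis
      using ae by (auto simp: integral_eq_nn_integral eq less_top[symmetric])
  qed
  have fin: "(\<integral>\<^sup>+y. ennreal (f y) \<partial>M) < \<infinity>" "(\<integral>\<^sup>+y. ennreal (- f y) \<partial>M) < \<infinity>"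
    using f unfolding real_integrable_def by (auto simp: less_top)
  note p = *[OF fS fin(1)] and n = *[OF borel_measurable_uminus[OF fS] fin(2)]
  have ae: "AE u in P. integrable (K u) f \<and> (\<integral>y. f y \<partial>K u) =
      enn2real (\<integral>\<^sup>+y. ennreal (f y) \<partial>K u) - enn2real (\<integral>\<^sup>+y. ennreal (- f y) \<partial>K u)"
  proof -
    have "AE u in P. u \<in> space P" by simp
    moreover have "AE u in P. (\<integral>\<^sup>+y. ennreal (f y) \<partial>K u) < \<infinity>" using p by simp
    moreover have "AE u in P. (\<integral>\<^sup>+y. ennreal (- f y) \<partial>K u) < \<infinity>" using n by simp
    ultimately show ?thesis
    proof eventually_elim
      case (elim u)
      then have "integrable (K u) f"
        using KS elim unfolding real_integrable_def by auto
      then show ?case using real_lebesgue_integral_def by blast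
    qed
  qed
  have fmeas: "(\<lambda>u. \<integral>y. f y \<partial>K u) \<in> borel_measurable P"
  proof -
    have [measurable]: "(\<lambda>u. \<integral>\<^sup>+y. ennreal (g y) \<partial>K u) \<in> borel_measurable P"
      if [measurable]: "g \<in> borel_measurable S" for g :: "'a \<Rightarrow> real"
      by (rule meas) measurable
    \<comment> \<open>The case distinction reproduces the default value 0 of a nonexistent integral,
      so that measurability holds for the actual function and not merely up to a null set.\<close>
    have "(\<lambda>u. if (\<integral>\<^sup>+y. ennreal (f y) \<partial>K u) < \<infinity> \<and> (\<integral>\<^sup>+y. ennreal (- f y) \<partial>K u) < \<infinity> then
        enn2real (\<integral>\<^sup>+y. ennreal (f y) \<partial>K u) - enn2real (\<integral>\<^sup>+y. ennreal (- f y) \<partial>K u) else 0) \<in> borel_measurable P"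
      by measurable
    also have "?this \<longleftrightarrow> ?thesis"
    proof (rule measurable_cong)
      fix u assume u: "u \<in> space P"
      have "integrable (K u) f \<longleftrightarrow> (\<integral>\<^sup>+y. ennreal (f y) \<partial>K u) < \<infinity> \<and> (\<integral>\<^sup>+y. ennreal (- f y) \<partial>K u) < \<infinity>"
        using KS[OF u] unfolding real_integrable_def by (auto simp: less_top)
      then show "(if (\<integral>\<^sup>+y. ennreal (f y) \<partial>K u) < \<infinity> \<and> (\<integral>\<^sup>+y. ennreal (- f y) \<partial>K u) < \<infinity> then
        enn2real (\<integral>\<^sup>+y. ennreal (f y) \<partial>K u) - enn2real (\<integral>\<^sup>+y. ennreal (- f y) \<partial>K u) else 0) = (\<integral>y. f y \<partial>K u)"
        by (auto simp: real_lebesgue_integral_def not_integrable_integral_eq)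
    qed
    finally show ?thesis .
  qed
  let ?p = "\<lambda>u. enn2real (\<integral>\<^sup>+y. ennreal (f y) \<partial>K u)" and ?n = "\<lambda>u. enn2real (\<integral>\<^sup>+y. ennreal (- f y) \<partial>K u)"
  have p: "integrable P ?p" "enn2real (\<integral>\<^sup>+y. ennreal (f y) \<partial>M) = (\<integral>u. ?p u \<partial>P)"
    and n: "integrable P ?n" "enn2real (\<integral>\<^sup>+y. ennreal (- f y) \<partial>M) = (\<integral>u. ?n u \<partial>P)"
    using p n by auto
  have pn: "AE u in P. ?p u - ?n u = (\<integral>y. f y \<partial>K u)"
    using ae by (rule eventually_mono) linarith
  have ipn: "integrable P (\<lambda>u. ?p u - ?n u)" using p(1) n(1) by (rule Bochner_Integration.integrable_diff)
  show "integrable P (\<lambda>u. \<integral>y. f y \<partial>K u)"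
    by (rule integrable_cong_AE_imp[OF ipn fmeas pn])
  have "(\<integral>y. f y \<partial>M) = (\<integral>u. ?p u \<partial>P) - (\<integral>u. ?n u \<partial>P)"
    unfolding real_lebesgue_integral_def[OF f] p(2) n(2) ..
  also have "\<dots> = (\<integral>u. ?p u - ?n u \<partial>P)"
    by (rule Bochner_Integration.integral_diff[OF p(1) n(1), symmetric])
  also have "\<dots> = (\<integral>u. \<integral>y. f y \<partial>K u \<partial>P)"
    by (rule integral_cong_AE[OF borel_measurable_integrable[OF ipn] fmeas pn])
  finally show "(\<integral>y. f y \<partial>M) = (\<integral>u. \<integral>y. f y \<partial>K u \<partial>P)" .
qed

text \<open>Integrability under every \<open>K u\<close> lets the inner integral be split into real
  and imaginary parts at each point, not only almost everywhere.\<close>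

lemma kernel_average_integral_complex:
  fixes K :: "'u \<Rightarrow> 'a measure" and f :: "'a \<Rightarrow> complex"
  assumes avg: "kernel_average P K S M"
    and f: "integrable M f" and int: "\<And>u. u \<in> space P \<Longrightarrow> integrable (K u) f"
  shows "integrable P (\<lambda>u. \<integral>y. f y \<partial>K u)" and "(\<integral>y. f y \<partial>M) = (\<integral>u. \<integral>y. f y \<partial>K u \<partial>P)"
proof -
  note R = kernel_average_integral_real[OF avg integrable_Re[OF f]]
  note I = kernel_average_integral_real[OF avg integrable_Im[OF f]]
  have eq: "(\<integral>y. f y \<partial>K u) = of_real (\<integral>y. Re (f y) \<partial>K u) + \<i> * of_real (\<integral>y. Im (f y) \<partial>K u)" if "u \<in> space P" for u
    using int[OF that] by (simp add: integral_Re integral_Im complex_eq)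
  have "integrable P (\<lambda>u. of_real (\<integral>y. Re (f y) \<partial>K u) + \<i> * of_real (\<integral>y. Im (f y) \<partial>K u) :: complex)"
    using R(1) I(1) by (intro Bochner_Integration.integrable_add integrable_mult_right integrable_of_real)
  then show P: "integrable P (\<lambda>u. \<integral>y. f y \<partial>K u)"
    using eq by (simp cong: Bochner_Integration.integrable_cong)
  have "(\<integral>u. \<integral>y. f y \<partial>K u \<partial>P) = of_real (\<integral>u. \<integral>y. Re (f y) \<partial>K u \<partial>P) + \<i> * of_real (\<integral>u. \<integral>y. Im (f y) \<partial>K u \<partial>P)"
    using R(1) I(1) eq by (simp cong: Bochner_Integration.integral_cong)
  also have "\<dots> = (\<integral>y. f y \<partial>M)"
    using R(2) I(2) f by (simp add: complex_eq_iff)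
  finally show "(\<integral>y. f y \<partial>M) = (\<integral>u. \<integral>y. f y \<partial>K u \<partial>P)" by simp
qed

section \<open>Characteristic functions of additive processes\<close>

text \<open>Supplies the jumps that remain in \<open>M\<close> once those of \<open>N\<close> are
  removed. Additivity of the integral in the measure is an instance of averaging kernels.\<close>

lemma measure_difference_integral:
  fixes M N :: "'a measure"
  assumes fin: "finite_measure M" "finite_measure N" and sets: "sets N = sets M"
    and le: "\<And>A. A \<in> sets M \<Longrightarrow> emeasure N A \<le> emeasure M A"
  obtains \<kappa> where "finite_measure \<kappa>" "sets \<kappa> = sets M"
    "\<And>(f :: 'a \<Rightarrow> complex) B. \<lbrakk>f \<in> borel_measurable M; \<And>x. cmod (f x) \<le> B\<rbrakk> \<Longrightarrow>
       (\<integral>x. f x \<partial>M) = (\<integral>x. f x \<partial>\<kappa>) + (\<integral>x. f x \<partial>N)"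
proof -
  interpret M: finite_measure M by fact
  interpret N: finite_measure N by fact
  define \<kappa> where "\<kappa> = diff_measure M N"
  have sets\<kappa>: "sets \<kappa> = sets M" unfolding \<kappa>_def by simp
  have em\<kappa>: "emeasure \<kappa> A = emeasure M A - emeasure N A" if "A \<in> sets M" for A
    unfolding \<kappa>_def using fin sets le that by (intro emeasure_diff_measure) auto
  interpret \<kappa>: finite_measure \<kappa>
    by standard (use em\<kappa>[OF sets.top] sets_eq_imp_space_eq[OF sets\<kappa>] M.emeasure_finite in \<open>auto simp: top_unique diff_eq_0_iff_ennreal ennreal_minus_eq_top\<close>)
  \<comment> \<open>Counting measure on a two-point space turns the sum of \<kappa> and
    \<open>N\<close> into a kernel average, which is then identified with \<open>M\<close>.\<close>
  let ?K = "\<lambda>b. if b then \<kappa> else N" and ?P = "count_space (UNIV :: bool set)"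
  obtain M' where avg: "kernel_average ?P ?K M M'"
    using sets\<kappa> sets by (rule_tac kernel_average_exists[of ?P ?K M]) auto
  then have setsM': "sets M' = sets M" by (simp add: kernel_average_def)
  have "M' = M"
  proof (rule measure_eqI[OF setsM'])
    fix A assume A: "A \<in> sets M'"
    have "(\<integral>\<^sup>+y. indicator A y \<partial>M') = (\<integral>\<^sup>+u. \<integral>\<^sup>+y. indicator A y \<partial>?K u \<partial>?P)"
    proof -
      have "(indicator A :: 'a \<Rightarrow> ennreal) \<in> borel_measurable M" using A setsM' by auto
      with avg show ?thesis unfolding kernel_average_def by blast
    qed
    moreover have "(\<lambda>u. integral\<^sup>N (?K u) (indicator A)) = (\<lambda>u. emeasure (?K u) A)"
      using A setsM' sets sets\<kappa> by (intro ext) simp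
    ultimately have "emeasure M' A = emeasure \<kappa> A + emeasure N A"
      using A setsM' sets sets\<kappa> by (simp add: nn_integral_count_space_finite UNIV_bool add.commute)
    then show "emeasure M' A = emeasure M A"
      using A setsM' em\<kappa> le by (simp add: diff_add_cancel_ennreal)
  qed
  with avg have avg: "kernel_average ?P ?K M M" by simp
  show thesis
  proof (rule that[of \<kappa>])
    fix f :: "'a \<Rightarrow> complex" and B
    assume f: "f \<in> borel_measurable M" "\<And>x. cmod (f x) \<le> B"
    have "integrable M f" by (rule M.integrable_const_bound[of _ B]) (use f in auto)
    moreover have "integrable \<kappa> f"
      by (rule \<kappa>.integrable_const_bound[of _ B]) (use f measurable_cong_sets[OF sets\<kappa> refl, of borel] in auto)
    moreover have "integrable N f"
      by (rule N.integrable_const_bound[of _ B]) (use f measurable_cong_sets[OF sets refl, of borel] in auto)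
    ultimately show "(\<integral>x. f x \<partial>M) = (\<integral>x. f x \<partial>\<kappa>) + (\<integral>x. f x \<partial>N)"
      using kernel_average_integral_complex(2)[OF avg, of f]
      by (simp add: lebesgue_integral_count_space_finite UNIV_bool)
  qed (fact \<kappa>.finite_measure_axioms sets\<kappa>)+
qed

lemma borel_measurable_indicator_cball [measurable]:
  fixes x :: "'a::euclidean_space"
  shows "(indicator (cball x r) :: 'a \<Rightarrow> 'b::real_normed_div_algebra) \<in> borel_measurable borel"
  by (rule borel_measurable_indicator) simp

section \<open>The compensated integrand of the Levy-Khintchine formula\<close>

definition levy_integrand :: "'a::euclidean_space \<Rightarrow> 'a \<Rightarrow> complex" where
  "levy_integrand \<xi> y = iexp (y \<bullet> \<xi>) - 1 - \<i> * of_real (y \<bullet> \<xi>) * indicator (cball 0 1) y"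

lemma borel_measurable_levy_integrand [measurable]: "levy_integrand \<xi> \<in> borel_measurable borel"
  unfolding levy_integrand_def by measurable

text \<open>For \<open>norm y \<le> 1\<close> the compensator leaves a second order Taylor
  remainder, at most \<open>(y \<bullet> \<xi>)\<^sup>2 / 2\<close>; beyond that the bound 2 is
  trivial. The constant is the sum of what the two regimes need.\<close>

lemma norm_levy_integrand_le: "cmod (levy_integrand \<xi> y) \<le> (2 + (norm \<xi>)\<^sup>2) * min 1 ((norm y)\<^sup>2)"
proof (cases "norm y \<le> 1")
  case True
  have "cmod (iexp (y \<bullet> \<xi>) - (1 + \<i> * of_real (y \<bullet> \<xi>))) \<le> (y \<bullet> \<xi>)\<^sup>2 / 2"
    using iexp_approx1[of "y \<bullet> \<xi>" 1] by (simp add: numeral_2_eq_2)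
  also have "\<dots> \<le> (norm y * norm \<xi>)\<^sup>2"
    using power_mono[OF Cauchy_Schwarz_ineq2[of y \<xi>] abs_ge_zero, of 2] by (simp add: field_simps) (smt (verit) zero_le_power2)
  also have "\<dots> \<le> (2 + (norm \<xi>)\<^sup>2) * (norm y)\<^sup>2" by (simp add: algebra_simps power_mult_distrib)
  also have "(norm y)\<^sup>2 = min 1 ((norm y)\<^sup>2)" using True by (simp add: power_le_one)
  finally show ?thesis using True by (simp add: levy_integrand_def algebra_simps)
next
  case False
  then have "1 < (norm y)\<^sup>2" by (simp add: one_less_power)
  moreover have "cmod (iexp (y \<bullet> \<xi>) - 1) \<le> 2"
    using norm_triangle_ineq4[of "iexp (y \<bullet> \<xi>)" 1] by simp
  ultimately show ?thesis using False by (simp add: levy_integrand_def add_increasing2)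
qed

lemma norm_levy_integrand_le': "cmod (levy_integrand \<xi> y) \<le> 2 + (norm \<xi>)\<^sup>2"
proof -
  have "(2 + (norm \<xi>)\<^sup>2) * min 1 ((norm y)\<^sup>2) \<le> (2 + (norm \<xi>)\<^sup>2) * 1"
    by (intro mult_left_mono) auto
  then show ?thesis using norm_levy_integrand_le[of \<xi> y] by simp
qed

definition small_jump_drift :: "'a::euclidean_space measure \<Rightarrow> 'a" where
  "small_jump_drift \<kappa> = (\<integral>y. indicator (cball 0 1) y *\<^sub>R y \<partial>\<kappa>)"

text \<open>For a finite measure the three terms of the integrand are integrable one by one, so
  compensation amounts to a drift and the rest is a compound Poisson exponent.\<close>

lemma integral_levy_integrand:
  assumes "finite_measure \<kappa>" and [measurable_cong]: "sets \<kappa> = sets borel"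
  shows "(\<integral>y. levy_integrand \<xi> y \<partial>\<kappa>) =
    mchar \<kappa> \<xi> - measure \<kappa> (space \<kappa>) - \<i> * of_real (small_jump_drift \<kappa> \<bullet> \<xi>)"
proof -
  interpret finite_measure \<kappa> by fact
  have 1: "integrable \<kappa> (\<lambda>y. iexp (y \<bullet> \<xi>))" by (rule integrable_const_bound[of _ 1]) auto
  have 2: "integrable \<kappa> (\<lambda>y. indicator (cball 0 1) y *\<^sub>R y)"
    by (rule integrable_const_bound[of _ 1]) (auto split: split_indicator)
  have 3: "integrable \<kappa> (\<lambda>y. (indicator (cball 0 1) y *\<^sub>R y) \<bullet> \<xi>)"
    by (rule integrable_inner_left) (rule 2)
  define g where "g y = (indicator (cball 0 1) y *\<^sub>R y) \<bullet> \<xi>" for y :: 'a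
  have g: "integrable \<kappa> (\<lambda>y. \<i> * complex_of_real (g y))"
    using 3 unfolding g_def by (intro integrable_mult_right integrable_of_real)
  have "levy_integrand \<xi> y = iexp (y \<bullet> \<xi>) - 1 - \<i> * complex_of_real (g y)" for y
    unfolding levy_integrand_def g_def by (simp split: split_indicator)
  then have "(\<integral>y. levy_integrand \<xi> y \<partial>\<kappa>) = (\<integral>y. iexp (y \<bullet> \<xi>) \<partial>\<kappa>) - (\<integral>y. 1 \<partial>\<kappa>) - \<i> * of_real (\<integral>y. g y \<partial>\<kappa>)"
    using 1 g by (simp add: Bochner_Integration.integral_diff)
  also have "(\<integral>y. g y \<partial>\<kappa>) = small_jump_drift \<kappa> \<bullet> \<xi>"
    unfolding small_jump_drift_def g_def by (rule integral_inner_left) (rule 2)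
  finally show ?thesis by (simp add: mchar_def scaleR_conv_of_real)
qed

lemma borel_measurable_sets_eq_borel:
  assumes "sets M = sets borel" "f \<in> borel_measurable borel"
  shows "f \<in> borel_measurable M"
  using measurable_cong_sets[OF assms(1) refl, of borel] assms(2) by blast

text \<open>Integrating over [0,t] the measures \<Lambda> u truncated to
  \<open>norm y > \<delta> n\<close> gives a finite measure \<open>Q n\<close>. It dominates
  \<open>N\<close>, since \<open>N\<close> is below \<open>t\<close> times each \<Lambda> u and
  charges no small jumps. The measures \<open>\<kappa> n\<close> are the differences, and the
  exponents converge as the truncation is removed.\<close>

lemma additive_process_char_limit:
  fixes a :: "real \<Rightarrow> 'a::euclidean_space"
  assumes add: "additive_process M F Z a \<Lambda>" and t: "0 \<le> t"
    and N: "finite_measure N" "sets N = sets borel" and \<delta>0: "0 < \<delta>\<^sub>0" "AE y in N. \<delta>\<^sub>0 \<le> norm y"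
    and le: "\<And>u B. 0 \<le> u \<Longrightarrow> B \<in> sets borel \<Longrightarrow> emeasure N B \<le> ennreal t * emeasure (\<Lambda> u) B"
  obtains \<kappa> :: "nat \<Rightarrow> 'a measure" and c :: "nat \<Rightarrow> 'a" where
    "\<And>n. finite_measure (\<kappa> n)" "\<And>n. sets (\<kappa> n) = sets borel"
    "\<And>\<xi>. (\<lambda>n. exp (\<i> * of_real (c n \<bullet> \<xi>) + (mchar (\<kappa> n) \<xi> - measure (\<kappa> n) (space (\<kappa> n)))
        + (mchar N \<xi> - measure N (space N)))) \<longlonglongrightarrow> (\<integral>\<omega>. iexp (\<xi> \<bullet> Z t \<omega>) \<partial>M)"
proof -
  interpret N: finite_measure N by fact
  have triplet: "bounded_triplet a \<Lambda>" using add by (simp add: additive_process_def)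
  then have fam: "measurable_levy_family \<Lambda>" by (simp add: bounded_triplet_def)
  have levy: "levy_measure (\<Lambda> u)" if "0 \<le> u" for u
    using fam that by (simp add: measurable_levy_family_def)
  then have sets\<Lambda>: "sets (\<Lambda> u) = sets borel" if "0 \<le> u" for u
    using that by (simp add: levy_measure_def)
  have fin\<Lambda>: "(\<integral>\<^sup>+y. ennreal (min 1 ((norm y)\<^sup>2)) \<partial>\<Lambda> u) < \<infinity>" if "0 \<le> u" for u
    using levy[OF that] by (simp add: levy_measure_def)
  have min_int: "integrable (\<Lambda> u) (\<lambda>y. min 1 ((norm y)\<^sup>2))" if "0 \<le> u" for u
    using fin\<Lambda>[OF that]
    by (intro integrableI_nonneg borel_measurable_sets_eq_borel[OF sets\<Lambda>[OF that]]) auto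
  define P where "P = restrict_space lborel {0..t}"
  have spP: "space P = {0..t}" unfolding P_def by (simp add: space_restrict_space)
  interpret P: finite_measure P
    by standard (use t in \<open>simp add: P_def space_restrict_space emeasure_restrict_space\<close>)
  have emP: "emeasure P (space P) = ennreal t"
    using t unfolding P_def by (simp add: space_restrict_space emeasure_restrict_space)
  have restr: "f \<in> borel_measurable P" if "f \<in> borel_measurable (restrict_space borel {0..})" for f :: "real \<Rightarrow> 'c::topological_space"
  proof -
    have "f \<in> borel_measurable (restrict_space (restrict_space borel {0..}) {0..t})"
      using that by (rule measurable_restrict_space1)
    also have "restrict_space (restrict_space borel {0..}) {0..t} = (restrict_space borel {0..t} :: real measure)"
      by (subst restrict_restrict_space) (auto simp: Int_absorb1)
    finally show ?thesis
      unfolding P_def by (subst measurable_cong_sets[OF sets_restrict_space_cong[OF sets_lborel] refl])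
  qed
  have AEP: "AE u in P. Q u" if "AE u in lborel. u \<in> {0..T} \<longrightarrow> Q u" "t \<le> T" for Q T
    unfolding P_def using that by (subst AE_restrict_space_iff) auto
  have meas_int: "(\<lambda>u. \<integral>y. f y \<partial>\<Lambda> u) \<in> borel_measurable P"
    if "f \<in> borel_measurable borel" "\<And>u. 0 \<le> u \<Longrightarrow> integrable (\<Lambda> u) f" for f :: "'a \<Rightarrow> real"
    using fam that by (intro restr) (simp add: measurable_levy_family_def)
  obtain C where C0: "0 \<le> C" and C: "AE u in P. (\<integral>\<^sup>+y. ennreal (min 1 ((norm y)\<^sup>2)) \<partial>\<Lambda> u) \<le> ennreal C"
  proof -
    have "t + 1 > 0" using t by simp
    then obtain C where "AE u in lborel. u \<in> {0..t + 1} \<longrightarrow> (\<integral>\<^sup>+y. ennreal (min 1 ((norm y)\<^sup>2)) \<partial>\<Lambda> u) \<le> ennreal C"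
      using triplet unfolding bounded_triplet_def by meson
    from AEP[OF this] have "AE u in P. (\<integral>\<^sup>+y. ennreal (min 1 ((norm y)\<^sup>2)) \<partial>\<Lambda> u) \<le> ennreal (max 0 C)"
      by (auto simp: max_def ennreal_neg)
    then show thesis by (intro that[of "max 0 C"]) auto
  qed
  have a_int: "integrable P a"
  proof -
    have "t + 1 > 0" using t by simp
    then obtain C where "AE u in lborel. u \<in> {0..t + 1} \<longrightarrow> norm (a u) \<le> C"
      using triplet unfolding bounded_triplet_def by meson
    from AEP[OF this] have "AE u in P. norm (a u) \<le> C" by simp
    moreover have "a \<in> borel_measurable P"
      using triplet by (intro restr) (simp add: bounded_triplet_def)
    ultimately show ?thesis by (intro P.integrable_const_bound)
  qed
  define A where "A = (\<integral>u. a u \<partial>P)"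
  \<comment> \<open>Tends to 0 but stays strictly below \<open>\<delta>\<^sub>0\<close>, so every
    \<open>D n\<close> carries all of \<open>N\<close>.\<close>
  define \<delta> where "\<delta> n = \<delta>\<^sub>0 / (real n + 2)" for n
  have \<delta>: "0 < \<delta> n" "\<delta> n < \<delta>\<^sub>0" for n using \<delta>0(1) by (auto simp: \<delta>_def field_simps add_pos_nonneg)
  define D where "D n = {y :: 'a. \<delta> n < norm y}" for n
  have D [measurable]: "D n \<in> sets borel" for n unfolding D_def by measurable
  have indD: "indicator (D n) y \<le> min 1 ((norm y)\<^sup>2) / min 1 ((\<delta> n)\<^sup>2)" for n and y :: 'a
  proof (cases "y \<in> D n")
    case True
    then have "(\<delta> n)\<^sup>2 \<le> (norm y)\<^sup>2" using \<delta>(1)[of n] by (intro power_mono) (auto simp: D_def)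
    then have "min 1 ((\<delta> n)\<^sup>2) \<le> min 1 ((norm y)\<^sup>2)" by auto
    then show ?thesis using True \<delta>(1)[of n] by (simp add: min_def divide_simps)
  qed (use \<delta>(1)[of n] in auto)
  have emD: "emeasure (\<Lambda> u) (D n) \<le> ennreal (1 / min 1 ((\<delta> n)\<^sup>2)) * (\<integral>\<^sup>+y. ennreal (min 1 ((norm y)\<^sup>2)) \<partial>\<Lambda> u)"
    if u: "0 \<le> u" for u n
  proof -
    have "emeasure (\<Lambda> u) (D n) = (\<integral>\<^sup>+y. indicator (D n) y \<partial>\<Lambda> u)" using sets\<Lambda>[OF u] D by simp
    also have "\<dots> \<le> (\<integral>\<^sup>+y. ennreal (1 / min 1 ((\<delta> n)\<^sup>2)) * ennreal (min 1 ((norm y)\<^sup>2)) \<partial>\<Lambda> u)"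
    proof (rule nn_integral_mono)
      fix y :: 'a
      have "indicator (D n) y = ennreal (indicator (D n) y)" by (simp split: split_indicator)
      also have "\<dots> \<le> ennreal (1 / min 1 ((\<delta> n)\<^sup>2) * min 1 ((norm y)\<^sup>2))"
        using indD[of n y] by (intro ennreal_leI) simp
      finally show "indicator (D n) y \<le> ennreal (1 / min 1 ((\<delta> n)\<^sup>2)) * ennreal (min 1 ((norm y)\<^sup>2))"
        using \<delta>(1)[of n] by (subst (asm) ennreal_mult) auto
    qed
    also have "\<dots> = ennreal (1 / min 1 ((\<delta> n)\<^sup>2)) * (\<integral>\<^sup>+y. ennreal (min 1 ((norm y)\<^sup>2)) \<partial>\<Lambda> u)"
      by (intro nn_integral_cmult borel_measurable_sets_eq_borel[OF sets\<Lambda>[OF u]]) measurable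
    finally show ?thesis .
  qed
  have finD: "emeasure (\<Lambda> u) (D n) < \<infinity>" if "0 \<le> u" for u n
    using order_le_less_trans[OF emD[OF that]] fin\<Lambda>[OF that] by (simp add: ennreal_mult_less_top)
  define K where "K n u = density (\<Lambda> u) (indicator (D n))" for n u
  have setsK: "sets (K n u) = sets borel" if "0 \<le> u" for n u
    unfolding K_def using sets\<Lambda>[OF that] by simp
  have emK: "emeasure (K n u) B = emeasure (\<Lambda> u) (D n \<inter> B)" if "0 \<le> u" "B \<in> sets borel" for n u B
    unfolding K_def using sets\<Lambda>[OF that(1)] that D by (intro emeasure_restricted) auto
  have "\<exists>Mn. kernel_average P (K n) borel Mn" for n
  proof -
    \<comment> \<open>The measurability of the family speaks only of functions integrable under each
      \<Lambda> u. Away from 0 a Levy measure is finite, so the indicator of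
      \<open>D n \<inter> B\<close> is such a function.\<close>
    have "(\<lambda>u. emeasure (K n u) B) \<in> borel_measurable P" if B: "B \<in> sets borel" for B
    proof -
      have int: "integrable (\<Lambda> u) (indicator (D n \<inter> B) :: 'a \<Rightarrow> real)" if u: "0 \<le> u" for u
      proof (rule integrable_real_indicator)
        show "D n \<inter> B \<in> sets (\<Lambda> u)" using B D sets\<Lambda>[OF u] by auto
        have "emeasure (\<Lambda> u) (D n \<inter> B) \<le> emeasure (\<Lambda> u) (D n)"
          using D sets\<Lambda>[OF u] by (intro emeasure_mono) auto
        with finD[OF u] show "emeasure (\<Lambda> u) (D n \<inter> B) < \<infinity>" using order_le_less_trans by blast
      qed
      have "(\<lambda>u. ennreal (\<integral>y. indicator (D n \<inter> B) y \<partial>\<Lambda> u)) \<in> borel_measurable P"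
        using B D int by (intro measurable_compose[OF meas_int measurable_ennreal]) auto
      also have "?this \<longleftrightarrow> ?thesis"
      proof (rule measurable_cong)
        fix u assume "u \<in> space P"
        then have u: "0 \<le> u" using spP by simp
        have "D n \<inter> B \<in> sets (\<Lambda> u)" using B D sets\<Lambda>[OF u] by auto
        then have "(\<integral>y. indicator (D n \<inter> B) y \<partial>\<Lambda> u) = measure (\<Lambda> u) (D n \<inter> B)" by simp
        moreover have "emeasure (\<Lambda> u) (D n \<inter> B) \<noteq> \<infinity>"
          using int[OF u] \<open>D n \<inter> B \<in> _\<close> by (simp add: integrable_indicator_iff less_top)
        ultimately show "ennreal (\<integral>y. indicator (D n \<inter> B) y \<partial>\<Lambda> u) = emeasure (K n u) B"
          using emK[OF u B] by (simp add: emeasure_eq_ennreal_measure)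
      qed
      finally show ?thesis .
    qed
    then show ?thesis
      using setsK spP by (metis atLeastAtMost_iff kernel_average_exists)
  qed
  then obtain Q where Q: "\<And>n. kernel_average P (K n) borel (Q n)" by metis
  then have setsQ: "sets (Q n) = sets borel" for n by (simp add: kernel_average_def)
  have emQ: "emeasure (Q n) B = (\<integral>\<^sup>+u. emeasure (\<Lambda> u) (D n \<inter> B) \<partial>P)" if B: "B \<in> sets borel" for n B
  proof -
    have "(indicator B :: 'a \<Rightarrow> ennreal) \<in> borel_measurable borel" using B by simp
    then have "(\<integral>\<^sup>+y. indicator B y \<partial>Q n) = (\<integral>\<^sup>+u. \<integral>\<^sup>+y. indicator B y \<partial>K n u \<partial>P)"
      using Q[of n] unfolding kernel_average_def by blast
    also have "\<dots> = (\<integral>\<^sup>+u. emeasure (\<Lambda> u) (D n \<inter> B) \<partial>P)"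
      using B setsK emK spP by (intro nn_integral_cong) simp
    finally show ?thesis using B setsQ by simp
  qed
  have finQ: "finite_measure (Q n)" for n
  proof
    have "emeasure (Q n) (space (Q n)) = (\<integral>\<^sup>+u. emeasure (\<Lambda> u) (D n) \<partial>P)"
      using emQ[of UNIV n] sets_eq_imp_space_eq[OF setsQ] by simp
    also have "\<dots> \<le> (\<integral>\<^sup>+u. ennreal (1 / min 1 ((\<delta> n)\<^sup>2)) * ennreal C \<partial>P)"
    proof (rule nn_integral_mono_AE)
      have "AE u in P. 0 \<le> u" using spP by (intro AE_I2) simp
      with C show "AE u in P. emeasure (\<Lambda> u) (D n) \<le> ennreal (1 / min 1 ((\<delta> n)\<^sup>2)) * ennreal C"
      proof eventually_elim
        case (elim u)
        show ?case by (rule order_trans[OF emD[OF elim(2)] mult_left_mono[OF elim(1)]]) simp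
      qed
    qed
    also have "\<dots> < \<infinity>" using emP by (simp add: ennreal_mult_less_top)
    finally show "emeasure (Q n) (space (Q n)) \<noteq> \<infinity>" by simp
  qed
  \<comment> \<open>The constant \<open>measure N B / t\<close> is compared with the truncated mass
    at each time and then integrated over [0,t]. For \<open>t = 0\<close> the hypothesis itself says
    that \<open>N\<close> vanishes, as 0 times infinity is 0 in \<open>ennreal\<close>.\<close>
  have NQ: "emeasure N B \<le> emeasure (Q n) B" if B: "B \<in> sets borel" for n B
  proof (cases "t = 0")
    case True
    then show ?thesis using le[OF order_refl B] by simp
  next
    case False
    with t have t0: "0 < t" by simp
    have NB: "emeasure N B = emeasure N (D n \<inter> B)"
    proof (rule emeasure_eq_AE)
      show "AE x in N. (x \<in> B) = (x \<in> D n \<inter> B)"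
        using \<delta>0(2) by eventually_elim (use \<delta>(2)[of n] in \<open>auto simp: D_def\<close>)
    qed (use B D N(2) in auto)
    have "emeasure N B = ennreal t * ennreal (measure N B / t)"
      using t0 by (simp add: N.emeasure_eq_measure ennreal_mult[symmetric])
    also have "\<dots> = (\<integral>\<^sup>+u. ennreal (measure N B / t) \<partial>P)"
      using emP by (simp add: mult.commute)
    also have "\<dots> \<le> (\<integral>\<^sup>+u. emeasure (\<Lambda> u) (D n \<inter> B) \<partial>P)"
    proof (rule nn_integral_mono)
      fix u assume "u \<in> space P"
      then have "0 \<le> u" using spP by simp
      then have "ennreal t * ennreal (measure N B / t) \<le> ennreal t * emeasure (\<Lambda> u) (D n \<inter> B)"
        using le[of u "D n \<inter> B"] B D NB \<open>emeasure N B = ennreal t * _\<close> by simp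
      then show "ennreal (measure N B / t) \<le> emeasure (\<Lambda> u) (D n \<inter> B)"
        using t0 by (simp add: ennreal_mult_le_mult_iff)
    qed
    also have "\<dots> = emeasure (Q n) B" using emQ[OF B] by simp
    finally show ?thesis .
  qed
  have "\<exists>\<kappa>. finite_measure \<kappa> \<and> sets \<kappa> = sets borel \<and>
     (\<forall>\<xi>. (\<integral>y. levy_integrand \<xi> y \<partial>Q n) = (\<integral>y. levy_integrand \<xi> y \<partial>\<kappa>) + (\<integral>y. levy_integrand \<xi> y \<partial>N))" for n
  proof (rule measure_difference_integral[OF finQ N(1)])
    show "sets N = sets (Q n)" using N setsQ by simp
    show "emeasure N B \<le> emeasure (Q n) B" if "B \<in> sets (Q n)" for B
      using that NQ setsQ by simp
    fix \<kappa>
    assume \<kappa>: "finite_measure \<kappa>" "sets \<kappa> = sets (Q n)"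
      "\<And>(f :: 'a \<Rightarrow> complex) B. \<lbrakk>f \<in> borel_measurable (Q n); \<And>x. cmod (f x) \<le> B\<rbrakk> \<Longrightarrow>
       (\<integral>x. f x \<partial>Q n) = (\<integral>x. f x \<partial>\<kappa>) + (\<integral>x. f x \<partial>N)"
    have "levy_integrand \<xi> \<in> borel_measurable (Q n)" for \<xi>
      using measurable_cong_sets[OF setsQ refl] borel_measurable_levy_integrand by blast
    from \<kappa>(3)[OF this norm_levy_integrand_le'] \<kappa>(1,2) setsQ show ?thesis by blast
  qed
  then obtain \<kappa> where \<kappa>: "\<And>n. finite_measure (\<kappa> n)" "\<And>n. sets (\<kappa> n) = sets borel"
    and \<kappa>Q: "\<And>n \<xi>. (\<integral>y. levy_integrand \<xi> y \<partial>Q n) = (\<integral>y. levy_integrand \<xi> y \<partial>\<kappa> n) + (\<integral>y. levy_integrand \<xi> y \<partial>N)"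
    by metis
  define c where "c n = A - small_jump_drift (\<kappa> n) - small_jump_drift N" for n
  show thesis
  proof (rule that[OF \<kappa>])
    fix \<xi> :: 'a
    define Cx where "Cx = 2 + (norm \<xi>)\<^sup>2"
    have intL: "integrable (\<Lambda> u) (levy_integrand \<xi>)" if u: "0 \<le> u" for u
    proof (rule Bochner_Integration.integrable_bound)
      show "integrable (\<Lambda> u) (\<lambda>y. Cx * min 1 ((norm y)\<^sup>2))" using min_int[OF u] by simp
      show "levy_integrand \<xi> \<in> borel_measurable (\<Lambda> u)"
        using measurable_cong_sets[OF sets\<Lambda>[OF u] refl] borel_measurable_levy_integrand by blast
      show "AE y in \<Lambda> u. norm (levy_integrand \<xi> y) \<le> norm (Cx * min 1 ((norm y)\<^sup>2))"
        using norm_levy_integrand_le[of \<xi>] unfolding Cx_def by (intro AE_I2) (simp add: abs_mult order_trans[OF _ abs_ge_self])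
    qed
    have KL: "integrable (K n u) (levy_integrand \<xi>)"
      "(\<integral>y. levy_integrand \<xi> y \<partial>K n u) = (\<integral>y. indicator (D n) y *\<^sub>R levy_integrand \<xi> y \<partial>\<Lambda> u)" if u: "0 \<le> u" for n u
    proof -
      have K: "K n u = density (\<Lambda> u) (\<lambda>y. ennreal (indicator (D n) y))"
        unfolding K_def by (rule arg_cong[where f="density _"]) (auto split: split_indicator)
      have m: "levy_integrand \<xi> \<in> borel_measurable (\<Lambda> u)" "(indicator (D n) :: 'a \<Rightarrow> real) \<in> borel_measurable (\<Lambda> u)"
        using D by (auto intro!: borel_measurable_sets_eq_borel[OF sets\<Lambda>[OF u]])
      have "integrable (\<Lambda> u) (\<lambda>y. indicator (D n) y *\<^sub>R levy_integrand \<xi> y)"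
        using intL[OF u] D sets\<Lambda>[OF u] by (intro integrable_mult_indicator) auto
      then show "integrable (K n u) (levy_integrand \<xi>)"
        unfolding K using m by (subst integrable_density) auto
      show "(\<integral>y. levy_integrand \<xi> y \<partial>K n u) = (\<integral>y. indicator (D n) y *\<^sub>R levy_integrand \<xi> y \<partial>\<Lambda> u)"
        unfolding K using m by (subst integral_density) auto
    qed
    have bound: "norm (indicator (D n) y *\<^sub>R levy_integrand \<xi> y) \<le> Cx * min 1 ((norm y)\<^sup>2)" for n y
      using norm_levy_integrand_le[of \<xi> y] norm_ge_zero[of "levy_integrand \<xi> y"]
      unfolding Cx_def by (simp split: split_indicator)
    \<comment> \<open>A bound free of \<open>n\<close> and \<open>u\<close>; being constant on a
      finite time interval, it dominates the limit in the time integral.\<close>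
    have KLe: "cmod (\<integral>y. levy_integrand \<xi> y \<partial>K n u) \<le> Cx * C"
      if u: "0 \<le> u" and uC: "(\<integral>\<^sup>+y. ennreal (min 1 ((norm y)\<^sup>2)) \<partial>\<Lambda> u) \<le> ennreal C" for n u
    proof -
      have "cmod (\<integral>y. levy_integrand \<xi> y \<partial>K n u) \<le> (\<integral>y. Cx * min 1 ((norm y)\<^sup>2) \<partial>\<Lambda> u)"
        unfolding KL(2)[OF u]
        by (rule Bochner_Integration.integral_norm_bound_integral)
          (use bound intL[OF u] min_int[OF u] D sets\<Lambda>[OF u] in \<open>auto intro!: integrable_mult_indicator\<close>)
      also have "\<dots> = Cx * (\<integral>y. min 1 ((norm y)\<^sup>2) \<partial>\<Lambda> u)" by simp
      also have "(\<integral>y. min 1 ((norm y)\<^sup>2) \<partial>\<Lambda> u) = enn2real (\<integral>\<^sup>+y. ennreal (min 1 ((norm y)\<^sup>2)) \<partial>\<Lambda> u)"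
        using min_int[OF u] by (intro integral_eq_nn_integral) auto
      also have "\<dots> \<le> C" using enn2real_mono[OF uC] C0 by simp
      finally show ?thesis by (simp add: Cx_def mult_left_mono)
    qed
    have Klim: "(\<lambda>n. \<integral>y. levy_integrand \<xi> y \<partial>K n u) \<longlonglongrightarrow> (\<integral>y. levy_integrand \<xi> y \<partial>\<Lambda> u)" if u: "0 \<le> u" for u
      unfolding KL(2)[OF u]
    proof (rule integral_dominated_convergence)
      show "integrable (\<Lambda> u) (\<lambda>y. Cx * min 1 ((norm y)\<^sup>2))" using min_int[OF u] by simp
      show "levy_integrand \<xi> \<in> borel_measurable (\<Lambda> u)"
        "(\<lambda>y. indicator (D n) y *\<^sub>R levy_integrand \<xi> y) \<in> borel_measurable (\<Lambda> u)" for n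
        by (rule borel_measurable_sets_eq_borel[OF sets\<Lambda>[OF u]]; measurable)+
      show "AE y in \<Lambda> u. (\<lambda>n. indicator (D n) y *\<^sub>R levy_integrand \<xi> y) \<longlonglongrightarrow> levy_integrand \<xi> y"
      proof (rule AE_I2)
        fix y :: 'a
        show "(\<lambda>n. indicator (D n) y *\<^sub>R levy_integrand \<xi> y) \<longlonglongrightarrow> levy_integrand \<xi> y"
        proof (cases "y = 0")
          case True
          then show ?thesis by (simp add: levy_integrand_def)
        next
          case False
          obtain k :: nat where k: "\<delta>\<^sub>0 / norm y < real k" using reals_Archimedean2 by blast
          have "y \<in> D n" if "k \<le> n" for n
          proof -
            have "\<delta>\<^sub>0 / norm y < real n + 2" using k that by linarith
            then show ?thesis using False unfolding D_def \<delta>_def by (simp add: field_simps)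
          qed
          then show ?thesis
            by (intro tendsto_eventually eventually_sequentiallyI[of k]) simp
        qed
      qed
    qed (use bound in simp)
    have intQ: "integrable (Q n) (levy_integrand \<xi>)" for n
      using norm_levy_integrand_le'[of \<xi>]
      by (intro finite_measure.integrable_const_bound[OF finQ, of _ Cx] borel_measurable_sets_eq_borel[OF setsQ])
         (auto simp: Cx_def)
    have QK: "integrable P (\<lambda>u. \<integral>y. levy_integrand \<xi> y \<partial>K n u)" "(\<integral>y. levy_integrand \<xi> y \<partial>Q n) = (\<integral>u. \<integral>y. levy_integrand \<xi> y \<partial>K n u \<partial>P)" for n
      using kernel_average_integral_complex[OF Q intQ] KL(1) spP by auto
    \<comment> \<open>Measurability in time of the untruncated complex integral is inherited from
      the truncated ones, whose pointwise limit it is.\<close>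
    have meas_lim: "(\<lambda>u. \<integral>y. levy_integrand \<xi> y \<partial>\<Lambda> u) \<in> borel_measurable P"
      by (rule borel_measurable_LIMSEQ_metric[OF borel_measurable_integrable[OF QK(1)]]) (use Klim spP in auto)
    have dom: "AE u in P. cmod (\<integral>y. levy_integrand \<xi> y \<partial>K n u) \<le> Cx * C" for n
    proof -
      have "AE u in P. 0 \<le> u" using spP by (intro AE_I2) simp
      with C show ?thesis by eventually_elim (rule KLe)
    qed
    have AElim: "AE u in P. (\<lambda>n. \<integral>y. levy_integrand \<xi> y \<partial>K n u) \<longlonglongrightarrow> (\<integral>y. levy_integrand \<xi> y \<partial>\<Lambda> u)"
      using Klim spP by (intro AE_I2) simp
    have limP: "integrable P (\<lambda>u. \<integral>y. levy_integrand \<xi> y \<partial>\<Lambda> u)"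
      "(\<lambda>n. \<integral>u. \<integral>y. levy_integrand \<xi> y \<partial>K n u \<partial>P) \<longlonglongrightarrow> (\<integral>u. \<integral>y. levy_integrand \<xi> y \<partial>\<Lambda> u \<partial>P)"
      using integrable_dominated_convergence[OF meas_lim borel_measurable_integrable[OF QK(1)] P.integrable_const AElim dom]
        integral_dominated_convergence[OF meas_lim borel_measurable_integrable[OF QK(1)] P.integrable_const AElim dom]
      by auto
    have char: "(\<integral>\<omega>. iexp (\<xi> \<bullet> Z t \<omega>) \<partial>M) = exp (\<i> * of_real (A \<bullet> \<xi>) + (\<integral>u. \<integral>y. levy_integrand \<xi> y \<partial>\<Lambda> u \<partial>P))"
    proof -
      have [measurable]: "Z u \<in> borel_measurable M" if "0 \<le> u" for u
      proof -
        have "subalgebra M (F u)" "Z u \<in> borel_measurable (F u)"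
          using add that by (auto simp: additive_process_def usual_filtered_space_def)
        then show ?thesis by (rule measurable_from_subalg)
      qed
      have [measurable]: "Z t \<in> borel_measurable M" "Z 0 \<in> borel_measurable M" using t by auto
      have "AE \<omega> in M. Z 0 \<omega> = 0" using add by (simp add: additive_process_def)
      then have "(\<integral>\<omega>. iexp (\<xi> \<bullet> Z t \<omega>) \<partial>M) = (\<integral>\<omega>. iexp (\<xi> \<bullet> (Z t \<omega> - Z 0 \<omega>)) \<partial>M)"
        by (intro integral_cong_AE) (auto elim!: eventually_mono)
      also have "\<dots> = exp (LINT u:{0..t}|lborel. levy_symbol a \<Lambda> u \<xi>)"
        using add t by (simp add: additive_process_def)
      also have "(LINT u:{0..t}|lborel. levy_symbol a \<Lambda> u \<xi>) = (\<integral>u. levy_symbol a \<Lambda> u \<xi> \<partial>P)"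
        unfolding P_def set_lebesgue_integral_def by (subst integral_restrict_space) auto
      also have "\<dots> = (\<integral>u. \<i> * of_real (a u \<bullet> \<xi>) + (\<integral>y. levy_integrand \<xi> y \<partial>\<Lambda> u) \<partial>P)"
        unfolding levy_symbol_def levy_integrand_def ..
      also have "\<dots> = (\<integral>u. \<i> * of_real (a u \<bullet> \<xi>) \<partial>P) + (\<integral>u. \<integral>y. levy_integrand \<xi> y \<partial>\<Lambda> u \<partial>P)"
        using a_int limP(1)
        by (intro Bochner_Integration.integral_add integrable_mult_right integrable_of_real integrable_inner_left)
      also have "(\<integral>u. \<i> * complex_of_real (a u \<bullet> \<xi>) \<partial>P) = \<i> * of_real (A \<bullet> \<xi>)"
        unfolding A_def using integral_inner_left[of \<xi> P a] a_int by simp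
      finally show ?thesis .
    qed
    \<comment> \<open>The drifts hidden in \<open>c n\<close> cancel against the compensators of
      \<open>\<kappa> n\<close> and \<open>N\<close>, and what is left is the exponent of the
      truncated process.\<close>
    have "\<i> * of_real (c n \<bullet> \<xi>) + (mchar (\<kappa> n) \<xi> - measure (\<kappa> n) (space (\<kappa> n))) + (mchar N \<xi> - measure N (space N)) =
      \<i> * of_real (A \<bullet> \<xi>) + (\<integral>u. \<integral>y. levy_integrand \<xi> y \<partial>K n u \<partial>P)" for n
      unfolding QK(2)[symmetric] \<kappa>Q integral_levy_integrand[OF \<kappa>] integral_levy_integrand[OF N] c_def
      by (simp add: inner_diff_left algebra_simps)
    then show "(\<lambda>n. exp (\<i> * of_real (c n \<bullet> \<xi>) + (mchar (\<kappa> n) \<xi> - measure (\<kappa> n) (space (\<kappa> n)))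
        + (mchar N \<xi> - measure N (space N)))) \<longlonglongrightarrow> (\<integral>\<omega>. iexp (\<xi> \<bullet> Z t \<omega>) \<partial>M)"
      unfolding char by (simp only:) (intro tendsto_exp tendsto_add tendsto_const limP(2))
  qed
qed

section \<open>Fourier inversion\<close>

text \<open>Lebesgue measure is the image of the product of its one-dimensional versions over the
  basis; integrals of products thus reduce to dimension one.\<close>

lemma integrable_lborel_prod_Basis:
  fixes f :: "'a::euclidean_space \<Rightarrow> real \<Rightarrow> 'b::{real_normed_field,banach,second_countable_topology}"
  assumes "\<And>b. b \<in> Basis \<Longrightarrow> integrable lborel (f b)"
  shows "integrable lborel (\<lambda>x. \<Prod>b\<in>Basis. f b (x \<bullet> b))"
    and "(\<integral>x. (\<Prod>b\<in>Basis. f b (x \<bullet> b)) \<partial>lborel) = (\<Prod>b\<in>Basis. \<integral>u. f b u \<partial>lborel)"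
proof -
  interpret product_sigma_finite "\<lambda>_. lborel :: real measure" ..
  have [measurable]: "f b \<in> borel_measurable borel" if "b \<in> Basis" for b
    using borel_measurable_integrable[OF assms[OF that]] by simp
  have m: "(\<lambda>x. \<Prod>b\<in>Basis. f b (x \<bullet> b)) \<in> borel_measurable borel" by measurable
  have eq: "(\<Prod>b\<in>Basis. f b ((\<Sum>b\<in>Basis. g b *\<^sub>R b) \<bullet> b)) = (\<Prod>b\<in>Basis. f b (g b))" for g :: "'a \<Rightarrow> real"
    by (intro prod.cong) auto
  show "integrable lborel (\<lambda>x. \<Prod>b\<in>Basis. f b (x \<bullet> b))"
    unfolding lborel_eq[where 'a='a] using m
    by (subst integrable_distr_eq) (auto simp: eq intro!: product_integrable_prod assms)
  show "(\<integral>x. (\<Prod>b\<in>Basis. f b (x \<bullet> b)) \<partial>lborel) = (\<Prod>b\<in>Basis. \<integral>u. f b u \<partial>lborel)"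
    unfolding lborel_eq[where 'a='a] using m
    by (subst integral_distr) (auto simp: eq intro!: product_integral_prod assms)
qed

lemma lborel_affine_integral:
  fixes f :: "'a::euclidean_space \<Rightarrow> 'b::{banach,second_countable_topology}"
  assumes [measurable]: "f \<in> borel_measurable borel" and "0 < c"
  shows "(\<integral>x. f x \<partial>lborel) = c ^ DIM('a) *\<^sub>R (\<integral>x. f (t + c *\<^sub>R x) \<partial>lborel)"
    and "integrable lborel f \<longleftrightarrow> integrable lborel (\<lambda>x. f (t + c *\<^sub>R x))"
proof -
  have L: "(lborel :: 'a measure) = density (distr lborel borel (\<lambda>x. t + c *\<^sub>R x)) (\<lambda>_. ennreal (c ^ DIM('a)))"
    using lborel_affine[of c t] \<open>0 < c\<close> by simp
  show "(\<integral>x. f x \<partial>lborel) = c ^ DIM('a) *\<^sub>R (\<integral>x. f (t + c *\<^sub>R x) \<partial>lborel)"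
    by (subst L, subst integral_density) (use \<open>0 < c\<close> in \<open>auto simp: integral_distr\<close>)
  show "integrable lborel f \<longleftrightarrow> integrable lborel (\<lambda>x. f (t + c *\<^sub>R x))"
  proof -
    have "integrable lborel f \<longleftrightarrow> integrable lborel (\<lambda>x. c ^ DIM('a) *\<^sub>R f (t + c *\<^sub>R x))"
      by (subst L, subst integrable_density) (use \<open>0 < c\<close> in \<open>auto simp: integrable_distr_eq\<close>)
    moreover have "f (t + c *\<^sub>R x) = inverse (c ^ DIM('a)) *\<^sub>R (c ^ DIM('a) *\<^sub>R f (t + c *\<^sub>R x))" for x
      using \<open>0 < c\<close> by simp
    ultimately show ?thesis by (metis (no_types, lifting) Bochner_Integration.integrable_cong integrable_scaleR_right)
  qed
qed

section \<open>The Gaussian kernel and its Fourier transform\<close>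

lemma gaussian_fourier_real:
  "integrable lborel (\<lambda>x::real. iexp (t * x) * complex_of_real (exp (- (x\<^sup>2 / 2))))"
  "(\<integral>x. iexp (t * x) * complex_of_real (exp (- (x\<^sup>2 / 2))) \<partial>lborel) = complex_of_real (sqrt (2 * pi) * exp (- (t\<^sup>2 / 2)))"
proof -
  have eq: "iexp (t * x) * complex_of_real (exp (- (x\<^sup>2 / 2))) = of_real (sqrt (2 * pi)) * (std_normal_density x *\<^sub>R iexp (t * x))" for x
    by (simp add: std_normal_density_def scaleR_conv_of_real)
  have int: "integrable lborel (\<lambda>x. std_normal_density x *\<^sub>R iexp (t * x))"
    by (rule Bochner_Integration.integrable_bound[OF integrable_normal_density[of 1 0]]) auto
  then show "integrable lborel (\<lambda>x::real. iexp (t * x) * complex_of_real (exp (- (x\<^sup>2 / 2))))"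
    unfolding eq by (rule integrable_mult_right)
  have "(\<integral>x. std_normal_density x *\<^sub>R iexp (t * x) \<partial>lborel) = char std_normal_distribution t"
    unfolding char_def by (subst integral_density) auto
  then show "(\<integral>x. iexp (t * x) * complex_of_real (exp (- (x\<^sup>2 / 2))) \<partial>lborel) = complex_of_real (sqrt (2 * pi) * exp (- (t\<^sup>2 / 2)))"
    unfolding eq integral_mult_right_zero by (simp add: char_std_normal_distribution)
qed

definition gaussian :: "'a::euclidean_space \<Rightarrow> real" where
  "gaussian x = exp (- ((norm x)\<^sup>2 / 2))"

lemma gaussian_prod: "gaussian x = (\<Prod>b\<in>Basis. exp (- ((x \<bullet> b)\<^sup>2 / 2)))"
proof -
  have "(norm x)\<^sup>2 = (\<Sum>b\<in>Basis. (x \<bullet> b)\<^sup>2)"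
    by (subst power2_norm_eq_inner, subst euclidean_inner) (simp add: power2_eq_square)
  then show ?thesis
    by (simp add: gaussian_def exp_sum[symmetric] sum_divide_distrib sum_negf)
qed

lemma gaussian_fourier:
  fixes z :: "'a::euclidean_space"
  shows "integrable lborel (\<lambda>\<xi>. iexp (z \<bullet> \<xi>) * complex_of_real (gaussian \<xi>))"
    and "(\<integral>\<xi>. iexp (z \<bullet> \<xi>) * complex_of_real (gaussian \<xi>) \<partial>lborel) = complex_of_real (sqrt (2 * pi) ^ DIM('a) * gaussian z)"
proof -
  have eq: "iexp (z \<bullet> \<xi>) * complex_of_real (gaussian \<xi>) =
    (\<Prod>b\<in>Basis. iexp ((z \<bullet> b) * (\<xi> \<bullet> b)) * complex_of_real (exp (- ((\<xi> \<bullet> b)\<^sup>2 / 2))))" for \<xi>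
    unfolding gaussian_prod of_real_prod prod.distrib
    by (subst euclidean_inner) (simp add: exp_sum sum_distrib_left)
  note P = integrable_lborel_prod_Basis[where f="\<lambda>b u. iexp ((z \<bullet> b) * u) * complex_of_real (exp (- (u\<^sup>2 / 2)))",
    OF gaussian_fourier_real(1)]
  show "integrable lborel (\<lambda>\<xi>. iexp (z \<bullet> \<xi>) * complex_of_real (gaussian \<xi>))"
    unfolding eq by (rule P(1))
  show "(\<integral>\<xi>. iexp (z \<bullet> \<xi>) * complex_of_real (gaussian \<xi>) \<partial>lborel) = complex_of_real (sqrt (2 * pi) ^ DIM('a) * gaussian z)"
  proof -
    have "(\<integral>\<xi>. iexp (z \<bullet> \<xi>) * complex_of_real (gaussian \<xi>) \<partial>lborel) =
        (\<Prod>b\<in>Basis. complex_of_real (sqrt (2 * pi) * exp (- ((z \<bullet> b)\<^sup>2 / 2))))"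
      unfolding eq P(2) gaussian_fourier_real(2) ..
    also have "\<dots> = complex_of_real (sqrt (2 * pi) ^ DIM('a) * gaussian z)"
      unfolding gaussian_prod by (simp add: prod.distrib)
    finally show ?thesis .
  qed
qed

lemma borel_measurable_gaussian [measurable]: "gaussian \<in> borel_measurable borel"
  unfolding gaussian_def by measurable

lemma gaussian_integral:
  "integrable lborel (gaussian :: 'a::euclidean_space \<Rightarrow> real)"
  "(\<integral>x. gaussian x \<partial>(lborel :: 'a measure)) = sqrt (2 * pi) ^ DIM('a)"
proof -
  have "integrable lborel (\<lambda>\<xi>::'a. complex_of_real (gaussian \<xi>))"
    using gaussian_fourier(1)[of "0::'a"] by simp
  then show "integrable lborel (gaussian :: 'a \<Rightarrow> real)"
    using complex_of_real_integrable_eq by blast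
  have "complex_of_real (\<integral>x. gaussian x \<partial>(lborel :: 'a measure)) = of_real (sqrt (2 * pi) ^ DIM('a))"
    using gaussian_fourier(2)[of "0::'a"] by (simp add: gaussian_def[of "0::'a"])
  then show "(\<integral>x. gaussian x \<partial>(lborel :: 'a measure)) = sqrt (2 * pi) ^ DIM('a)"
    by (simp only: of_real_eq_iff)
qed

text \<open>Gaussian regularization: after the substitutions \<open>y = x + \<sigma>z\<close> and \<open>\<xi> = \<zeta>/\<sigma>\<close> all powers of \<open>\<sigma>\<close> cancel.\<close>

theorem fourier_inversion:
  fixes \<phi> :: "'a::euclidean_space \<Rightarrow> complex"
  assumes cont: "continuous_on UNIV \<phi>" and bnd: "\<And>x. cmod (\<phi> x) \<le> B"
    and \<phi>: "integrable lborel \<phi>" and \<psi>: "integrable lborel (\<lambda>\<xi>. inv_fourier \<phi> (- \<xi>))"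
  shows "inv_fourier (\<lambda>\<xi>. inv_fourier \<phi> (- \<xi>)) x = (2 * pi) ^ DIM('a) *\<^sub>R \<phi> x"
proof -
  have [measurable]: "\<phi> \<in> borel_measurable borel" using \<phi> by auto
  define \<psi>' where "\<psi>' \<xi> = inv_fourier \<phi> (- \<xi>)" for \<xi>
  have [measurable]: "\<psi>' \<in> borel_measurable borel" unfolding \<psi>'_def by measurable
  have \<psi>'_int: "integrable lborel \<psi>'" using \<psi> unfolding \<psi>'_def .
  define L where "L \<sigma> = (\<integral>\<xi>. iexp (x \<bullet> \<xi>) * \<psi>' \<xi> * complex_of_real (gaussian (\<sigma> *\<^sub>R \<xi>)) \<partial>lborel)" for \<sigma>
  \<comment> \<open>With the Gaussian factor the double integral converges absolutely, so the order
    may be exchanged; the inner integral over frequencies is then the Gaussian transform at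
    \<open>- z\<close>.\<close>
  have L_eq: "L \<sigma> = of_real (sqrt (2 * pi) ^ DIM('a)) * (\<integral>z. \<phi> (x + \<sigma> *\<^sub>R z) * complex_of_real (gaussian z) \<partial>lborel)"
    if \<sigma>: "0 < \<sigma>" for \<sigma>
  proof -
    have in1: "integrable lborel (\<lambda>z. \<phi> (x + \<sigma> *\<^sub>R z))"
      using lborel_affine_integral(2)[of \<phi> \<sigma> x] \<sigma> \<phi> by simp
    have sub: "iexp (x \<bullet> (\<zeta> /\<^sub>R \<sigma>)) * \<psi>' (\<zeta> /\<^sub>R \<sigma>) = \<sigma> ^ DIM('a) *\<^sub>R (\<integral>z. iexp (- (\<zeta> \<bullet> z)) * \<phi> (x + \<sigma> *\<^sub>R z) \<partial>lborel)" for \<zeta>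
    proof -
      have "\<psi>' (\<zeta> /\<^sub>R \<sigma>) = \<sigma> ^ DIM('a) *\<^sub>R (\<integral>z. iexp (- (\<zeta> /\<^sub>R \<sigma>) \<bullet> (x + \<sigma> *\<^sub>R z)) * \<phi> (x + \<sigma> *\<^sub>R z) \<partial>lborel)"
        unfolding \<psi>'_def inv_fourier_def by (rule lborel_affine_integral(1)[OF _ \<sigma>]) measurable
      also have "(\<lambda>z. iexp (- (\<zeta> /\<^sub>R \<sigma>) \<bullet> (x + \<sigma> *\<^sub>R z)) * \<phi> (x + \<sigma> *\<^sub>R z)) =
          (\<lambda>z. iexp (- (x \<bullet> (\<zeta> /\<^sub>R \<sigma>))) * (iexp (- (\<zeta> \<bullet> z)) * \<phi> (x + \<sigma> *\<^sub>R z)))"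
        using \<sigma> by (intro ext) (simp add: inner_add_right inner_commute[of x] exp_add[symmetric] field_simps flip: mult.assoc)
      finally show ?thesis by (simp add: exp_minus)
    qed
    have "L \<sigma> = inverse \<sigma> ^ DIM('a) *\<^sub>R (\<integral>\<zeta>. iexp (x \<bullet> (0 + inverse \<sigma> *\<^sub>R \<zeta>)) * \<psi>' (0 + inverse \<sigma> *\<^sub>R \<zeta>) * complex_of_real (gaussian (\<sigma> *\<^sub>R (0 + inverse \<sigma> *\<^sub>R \<zeta>))) \<partial>lborel)"
      unfolding L_def by (rule lborel_affine_integral(1)) (use \<sigma> in auto)
    also have "\<dots> = inverse \<sigma> ^ DIM('a) *\<^sub>R (\<integral>\<zeta>. \<sigma> ^ DIM('a) *\<^sub>R ((\<integral>z. iexp (- (\<zeta> \<bullet> z)) * \<phi> (x + \<sigma> *\<^sub>R z) \<partial>lborel) * complex_of_real (gaussian \<zeta>)) \<partial>lborel)"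
      using \<sigma> sub by simp
    also have "\<dots> = (\<integral>\<zeta>. (\<integral>z. iexp (- (\<zeta> \<bullet> z)) * \<phi> (x + \<sigma> *\<^sub>R z) \<partial>lborel) * complex_of_real (gaussian \<zeta>) \<partial>lborel)"
      using \<sigma> by (simp add: power_inverse)
    also have "\<dots> = (\<integral>\<zeta>. \<integral>z. iexp (- (\<zeta> \<bullet> z)) * \<phi> (x + \<sigma> *\<^sub>R z) * complex_of_real (gaussian \<zeta>) \<partial>lborel \<partial>lborel)"
      by simp
    also have "\<dots> = (\<integral>z. \<integral>\<zeta>. iexp (- (\<zeta> \<bullet> z)) * \<phi> (x + \<sigma> *\<^sub>R z) * complex_of_real (gaussian \<zeta>) \<partial>lborel \<partial>lborel)"
    proof (rule lborel_pair.Fubini_integral, rule lborel_pair.Fubini_integrable)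
      show "(\<lambda>(z, \<zeta>). iexp (- (\<zeta> \<bullet> z)) * \<phi> (x + \<sigma> *\<^sub>R z) * complex_of_real (gaussian \<zeta>)) \<in> borel_measurable (lborel \<Otimes>\<^sub>M lborel)"
        by measurable
      show "integrable lborel (\<lambda>z. \<integral>\<zeta>. norm (case (z, \<zeta>) of (z, \<zeta>) \<Rightarrow> iexp (- (\<zeta> \<bullet> z)) * \<phi> (x + \<sigma> *\<^sub>R z) * complex_of_real (gaussian \<zeta>)) \<partial>lborel)"
        using in1 by (simp add: norm_mult)
      show "AE z in lborel. integrable lborel (\<lambda>\<zeta>. case (z, \<zeta>) of (z, \<zeta>) \<Rightarrow> iexp (- (\<zeta> \<bullet> z)) * \<phi> (x + \<sigma> *\<^sub>R z) * complex_of_real (gaussian \<zeta>))"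
      proof (rule AE_I2)
        fix z
        have "integrable lborel (\<lambda>\<zeta>. \<phi> (x + \<sigma> *\<^sub>R z) * (iexp ((- z) \<bullet> \<zeta>) * complex_of_real (gaussian \<zeta>)))"
          by (intro integrable_mult_right gaussian_fourier)
        then show "integrable lborel (\<lambda>\<zeta>. case (z, \<zeta>) of (z, \<zeta>) \<Rightarrow> iexp (- (\<zeta> \<bullet> z)) * \<phi> (x + \<sigma> *\<^sub>R z) * complex_of_real (gaussian \<zeta>))"
          by (simp add: inner_commute mult_ac)
      qed
    qed
    also have "\<dots> = (\<integral>z. of_real (sqrt (2 * pi) ^ DIM('a)) * (\<phi> (x + \<sigma> *\<^sub>R z) * complex_of_real (gaussian z)) \<partial>lborel)"
    proof (rule Bochner_Integration.integral_cong[OF refl])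
      fix z
      have "(\<integral>\<zeta>. iexp (- (\<zeta> \<bullet> z)) * \<phi> (x + \<sigma> *\<^sub>R z) * complex_of_real (gaussian \<zeta>) \<partial>lborel) =
          (\<integral>\<zeta>. \<phi> (x + \<sigma> *\<^sub>R z) * (iexp ((- z) \<bullet> \<zeta>) * complex_of_real (gaussian \<zeta>)) \<partial>lborel)"
        by (simp add: inner_commute mult_ac)
      also have "\<dots> = \<phi> (x + \<sigma> *\<^sub>R z) * of_real (sqrt (2 * pi) ^ DIM('a) * gaussian (- z))"
        unfolding gaussian_fourier(2)[symmetric] by simp
      finally show "(\<integral>\<zeta>. iexp (- (\<zeta> \<bullet> z)) * \<phi> (x + \<sigma> *\<^sub>R z) * complex_of_real (gaussian \<zeta>) \<partial>lborel) =
          of_real (sqrt (2 * pi) ^ DIM('a)) * (\<phi> (x + \<sigma> *\<^sub>R z) * complex_of_real (gaussian z))"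
        by (simp add: gaussian_def mult_ac)
    qed
    finally show ?thesis by simp
  qed
  define \<sigma> where "\<sigma> n = 1 / real (Suc n)" for n
  have \<sigma>: "\<sigma> \<longlonglongrightarrow> 0" "0 < \<sigma> n" for n
    unfolding \<sigma>_def by (rule LIMSEQ_Suc[OF lim_1_over_n]) simp
  have lim\<psi>: "(\<lambda>n. L (\<sigma> n)) \<longlonglongrightarrow> (\<integral>\<xi>. iexp (x \<bullet> \<xi>) * \<psi>' \<xi> \<partial>lborel)"
    unfolding L_def
  proof (rule integral_dominated_convergence)
    show "integrable lborel (\<lambda>\<xi>. cmod (\<psi>' \<xi>))" using \<psi>'_int by simp
    show "AE \<xi> in lborel. (\<lambda>n. iexp (x \<bullet> \<xi>) * \<psi>' \<xi> * complex_of_real (gaussian (\<sigma> n *\<^sub>R \<xi>))) \<longlonglongrightarrow> iexp (x \<bullet> \<xi>) * \<psi>' \<xi>"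
    proof (rule AE_I2)
      fix \<xi> :: 'a
      have "(\<lambda>n. iexp (x \<bullet> \<xi>) * \<psi>' \<xi> * complex_of_real (gaussian (\<sigma> n *\<^sub>R \<xi>))) \<longlonglongrightarrow> iexp (x \<bullet> \<xi>) * \<psi>' \<xi> * complex_of_real (exp (- ((norm (0 *\<^sub>R \<xi>))\<^sup>2 / 2)))"
        unfolding gaussian_def by (intro tendsto_intros \<sigma>) simp
      then show "(\<lambda>n. iexp (x \<bullet> \<xi>) * \<psi>' \<xi> * complex_of_real (gaussian (\<sigma> n *\<^sub>R \<xi>))) \<longlonglongrightarrow> iexp (x \<bullet> \<xi>) * \<psi>' \<xi>" by simp
    qed
    show "AE \<xi> in lborel. cmod (iexp (x \<bullet> \<xi>) * \<psi>' \<xi> * complex_of_real (gaussian (\<sigma> n *\<^sub>R \<xi>))) \<le> cmod (\<psi>' \<xi>)" for n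
      by (intro AE_I2) (simp add: norm_mult gaussian_def mult_left_le)
  qed measurable
  \<comment> \<open>Here continuity and boundedness of \<phi> are used: the Gaussian averages
    concentrate at \<open>x\<close>, with \<open>B * gaussian z\<close> as dominating
    function.\<close>
  have lim: "(\<lambda>n. \<integral>z. \<phi> (x + \<sigma> n *\<^sub>R z) * complex_of_real (gaussian z) \<partial>lborel) \<longlonglongrightarrow> (\<integral>z. \<phi> x * complex_of_real (gaussian z) \<partial>(lborel :: 'a measure))"
  proof (rule integral_dominated_convergence)
    show "integrable lborel (\<lambda>z::'a. B * gaussian z)" by (intro integrable_mult_right gaussian_integral(1))
    show "AE z in lborel. (\<lambda>n. \<phi> (x + \<sigma> n *\<^sub>R z) * complex_of_real (gaussian z)) \<longlonglongrightarrow> \<phi> x * complex_of_real (gaussian z)"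
    proof (rule AE_I2)
      fix z :: 'a
      have "(\<lambda>n. x + \<sigma> n *\<^sub>R z) \<longlonglongrightarrow> x + 0 *\<^sub>R z" by (intro tendsto_intros \<sigma>)
      then have "(\<lambda>n. \<phi> (x + \<sigma> n *\<^sub>R z)) \<longlonglongrightarrow> \<phi> x"
        using continuous_on_tendsto_compose[OF cont] by simp
      then show "(\<lambda>n. \<phi> (x + \<sigma> n *\<^sub>R z) * complex_of_real (gaussian z)) \<longlonglongrightarrow> \<phi> x * complex_of_real (gaussian z)"
        by (intro tendsto_intros)
    qed
    show "AE z in lborel. cmod (\<phi> (x + \<sigma> n *\<^sub>R z) * complex_of_real (gaussian z)) \<le> B * gaussian z" for n
      using bnd by (intro AE_I2) (simp add: norm_mult gaussian_def mult_right_mono)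
  qed measurable
  have "(\<lambda>n. L (\<sigma> n)) \<longlonglongrightarrow> of_real (sqrt (2 * pi) ^ DIM('a)) * (\<integral>z. \<phi> x * complex_of_real (gaussian z) \<partial>(lborel :: 'a measure))"
    unfolding L_eq[OF \<sigma>(2)] by (intro tendsto_mult tendsto_const lim)
  moreover have "(\<integral>z. \<phi> x * complex_of_real (gaussian z) \<partial>(lborel :: 'a measure)) = \<phi> x * of_real (sqrt (2 * pi) ^ DIM('a))"
    using gaussian_integral(2)[where 'a='a] by simp
  ultimately have "(\<integral>\<xi>. iexp (x \<bullet> \<xi>) * \<psi>' \<xi> \<partial>lborel) = of_real (sqrt (2 * pi) ^ DIM('a)) * (\<phi> x * of_real (sqrt (2 * pi) ^ DIM('a)))"
    using LIMSEQ_unique[OF lim\<psi>] by simp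
  \<comment> \<open>One factor \<open>sqrt (2 * pi)\<close> per dimension comes from the Gaussian
    transform, the other from the total mass of the Gaussian.\<close>
  also have "\<dots> = of_real ((sqrt (2 * pi) * sqrt (2 * pi)) ^ DIM('a)) * \<phi> x"
    unfolding power_mult_distrib by simp
  finally show ?thesis by (simp add: inv_fourier_def[of "\<lambda>\<xi>. inv_fourier \<phi> (- \<xi>)"] \<psi>'_def scaleR_conv_of_real)
qed

section \<open>Decay and integrability of Schwartz functions\<close>

lemma one_plus_norm_le_prod: "1 + norm x \<le> (\<Prod>b\<in>Basis. 1 + \<bar>x \<bullet> b\<bar>)" for x :: "'a::euclidean_space"
proof -
  have "1 + (\<Sum>b\<in>S. \<bar>x \<bullet> b\<bar>) \<le> (\<Prod>b\<in>S. 1 + \<bar>x \<bullet> b\<bar>)" if "finite S" for S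
    using that
  proof induction
    case (insert b S)
    have "1 \<le> (\<Prod>b\<in>S. 1 + \<bar>x \<bullet> b\<bar>)" by (intro prod_ge_1) simp
    then have "\<bar>x \<bullet> b\<bar> * 1 \<le> \<bar>x \<bullet> b\<bar> * (\<Prod>b\<in>S. 1 + \<bar>x \<bullet> b\<bar>)" by (intro mult_left_mono) auto
    with insert show ?case by (simp add: distrib_right)
  qed simp
  from this[of Basis] show ?thesis using norm_le_l1[of x] by simp
qed

text \<open>Expanding the product of \<open>(x \<bullet> b) ^ 4 + 1\<close> over the basis gives one
  monomial per subset, and each is controlled by a Schwartz seminorm without derivatives. In each
  coordinate \<open>u ^ 4 + 1\<close> pays, up to the factor 4, for both the weight
  \<open>1 + \<bar>u\<bar>\<close> and the integrable
  \<open>inverse (1 + u\<^sup>2)\<close>.\<close>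

lemma schwartz_decay:
  fixes \<phi> :: "'a::euclidean_space \<Rightarrow> complex"
  assumes "schwartz \<phi>"
  obtains C where "0 \<le> C" "\<And>x. (1 + norm x) * cmod (\<phi> x) \<le> C * (\<Prod>b\<in>Basis. inverse (1 + (x \<bullet> b)\<^sup>2))"
proof -
  have "\<exists>c. \<forall>x. cmod ((\<Prod>b\<in>S. (x \<bullet> b) ^ 4) *\<^sub>R \<phi> x) \<le> c" if "S \<subseteq> Basis" for S
  proof -
    define \<alpha> :: "'a \<Rightarrow> nat" where "\<alpha> b = (if b \<in> S then 4 else 0)" for b
    have "bounded (range (\<lambda>x. (\<Prod>b\<in>Basis. (x \<bullet> b) ^ \<alpha> b) *\<^sub>R \<phi> x))"
      using assms unfolding schwartz_def by (auto dest!: spec[of _ \<alpha>] bspec[of _ _ "[]"])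
    moreover have "(\<Prod>b\<in>Basis. (x \<bullet> b) ^ \<alpha> b) = (\<Prod>b\<in>S. (x \<bullet> b) ^ 4)" for x :: 'a
      by (rule prod.mono_neutral_cong_right) (use that in \<open>auto simp: \<alpha>_def\<close>)
    ultimately show ?thesis by (auto simp: bounded_iff)
  qed
  then obtain c where c: "\<And>S x. S \<subseteq> Basis \<Longrightarrow> cmod ((\<Prod>b\<in>S. (x \<bullet> b) ^ 4) *\<^sub>R \<phi> x) \<le> c S" by metis
  define C where "C = (\<Sum>S\<in>Pow Basis. c S)"
  have C: "(\<Prod>b\<in>Basis. (x \<bullet> b) ^ 4 + 1) * cmod (\<phi> x) \<le> C" for x :: 'a
  proof -
    have "(\<Prod>b\<in>Basis. (x \<bullet> b) ^ 4 + 1) * cmod (\<phi> x) = (\<Sum>S\<in>Pow Basis. (\<Prod>b\<in>S. (x \<bullet> b) ^ 4) * cmod (\<phi> x))"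
      by (subst prod_add) (auto simp: sum_distrib_right)
    also have "\<dots> \<le> C" unfolding C_def
    proof (rule sum_mono)
      fix S :: "'a set" assume "S \<in> Pow Basis"
      moreover have "0 \<le> (\<Prod>b\<in>S. (x \<bullet> b) ^ 4)" by (intro prod_nonneg) simp
      ultimately show "(\<Prod>b\<in>S. (x \<bullet> b) ^ 4) * cmod (\<phi> x) \<le> c S" using c[of S x] by simp
    qed
    finally show ?thesis .
  qed
  have elem: "(1 + \<bar>u\<bar>) * (1 + u\<^sup>2) \<le> 4 * (u ^ 4 + 1)" for u :: real
  proof -
    have *: "\<bar>u\<bar> \<le> 1 + u ^ 4 \<and> u\<^sup>2 \<le> 1 + u ^ 4 \<and> \<bar>u\<bar> ^ 3 \<le> 1 + u ^ 4"
    proof (cases "\<bar>u\<bar> \<le> 1")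
      case True
      then have "u\<^sup>2 \<le> 1" "\<bar>u\<bar> ^ 3 \<le> 1" using power_le_one[OF abs_ge_zero True, of 3] by (auto simp: abs_square_le_1)
      then show ?thesis using True by (simp add: add_increasing2)
    next
      case False
      then have "\<bar>u\<bar> ^ m \<le> \<bar>u\<bar> ^ 4" if "m \<le> 4" for m using that by (intro power_increasing) auto
      from this[of 1] this[of 2] this[of 3] have "\<bar>u\<bar> \<le> u ^ 4" "u\<^sup>2 \<le> u ^ 4" "\<bar>u\<bar> ^ 3 \<le> u ^ 4" by simp_all
      then show ?thesis by simp
    qed
    have gen: "1 + a + b + c \<le> 4 * (d + 1)" if "a \<le> 1 + d" "b \<le> 1 + d" "c \<le> 1 + d" "0 \<le> d" for a b c d :: real
      using that by simp
    have "1 + \<bar>u\<bar> + u\<^sup>2 + \<bar>u\<bar> ^ 3 \<le> 4 * (u ^ 4 + 1)"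
      using * by (intro gen) auto
    moreover have "(1 + \<bar>u\<bar>) * (1 + u\<^sup>2) = 1 + \<bar>u\<bar> + u\<^sup>2 + \<bar>u\<bar> ^ 3"
      by (simp add: algebra_simps power3_eq_cube power2_eq_square)
    ultimately show ?thesis by (simp only:)
  qed
  show thesis
  proof (rule that[of "4 ^ DIM('a) * C"])
    have "0 \<le> (\<Prod>b\<in>Basis. ((0::'a) \<bullet> b) ^ 4 + 1) * cmod (\<phi> 0)" by (intro mult_nonneg_nonneg prod_nonneg) auto
    also have "\<dots> \<le> C" by (rule C)
    finally show "0 \<le> 4 ^ DIM('a) * C" by simp
    fix x :: 'a
    let ?P = "\<Prod>b\<in>Basis. 1 + (x \<bullet> b)\<^sup>2"
    have P: "0 < ?P" by (intro prod_pos) (simp add: add_pos_nonneg)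
    have "(1 + norm x) * ?P * cmod (\<phi> x) \<le> (\<Prod>b\<in>Basis. 1 + \<bar>x \<bullet> b\<bar>) * ?P * cmod (\<phi> x)"
      using one_plus_norm_le_prod[of x] P by (intro mult_right_mono) auto
    also have "(\<Prod>b\<in>Basis. 1 + \<bar>x \<bullet> b\<bar>) * ?P = (\<Prod>b\<in>Basis. (1 + \<bar>x \<bullet> b\<bar>) * (1 + (x \<bullet> b)\<^sup>2))" by (simp add: prod.distrib)
    also have "\<dots> * cmod (\<phi> x) \<le> (\<Prod>b\<in>Basis. 4 * ((x \<bullet> b) ^ 4 + 1)) * cmod (\<phi> x)"
      using elem by (intro mult_right_mono prod_mono) auto
    also have "\<dots> = 4 ^ DIM('a) * ((\<Prod>b\<in>Basis. (x \<bullet> b) ^ 4 + 1) * cmod (\<phi> x))"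
      unfolding prod.distrib by simp
    also have "\<dots> \<le> 4 ^ DIM('a) * C" using C by simp
    finally have le: "(1 + norm x) * ?P * cmod (\<phi> x) \<le> 4 ^ DIM('a) * C" .
    show "(1 + norm x) * cmod (\<phi> x) \<le> 4 ^ DIM('a) * C * (\<Prod>b\<in>Basis. inverse (1 + (x \<bullet> b)\<^sup>2))"
    proof -
      have "(\<Prod>b\<in>Basis. inverse (1 + (x \<bullet> b)\<^sup>2)) = inverse ?P"
        using prod_inversef[of "\<lambda>b. 1 + (x \<bullet> b)\<^sup>2" Basis] by (simp add: o_def)
      moreover have "(1 + norm x) * cmod (\<phi> x) \<le> 4 ^ DIM('a) * C / ?P"
        using le P by (subst pos_le_divide_eq) (simp_all add: mult_ac)
      ultimately show ?thesis by (simp add: divide_inverse)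
    qed
  qed
qed

lemma schwartz_integrable:
  fixes \<phi> :: "'a::euclidean_space \<Rightarrow> complex"
  assumes "schwartz \<phi>"
  shows "continuous_on UNIV \<phi>" "\<exists>B. \<forall>x. cmod (\<phi> x) \<le> B"
    "integrable lborel (\<lambda>x. (1 + norm x) * cmod (\<phi> x))" "integrable lborel \<phi>"
proof -
  obtain C where C: "0 \<le> C" "\<And>x. (1 + norm x) * cmod (\<phi> x) \<le> C * (\<Prod>b\<in>Basis. inverse (1 + (x \<bullet> b)\<^sup>2))"
    using schwartz_decay[OF assms] by blast
  have "iter_deriv [] \<phi> differentiable_on UNIV"
    using assms unfolding schwartz_def smooth_def by (metis lists.Nil)
  then show cont: "continuous_on UNIV \<phi>" by (simp add: differentiable_imp_continuous_on)
  then have [measurable]: "\<phi> \<in> borel_measurable borel" by (rule borel_measurable_continuous_onI)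
  have le: "cmod (\<phi> x) \<le> (1 + norm x) * cmod (\<phi> x)" for x by (simp add: distrib_right)
  show "\<exists>B. \<forall>x. cmod (\<phi> x) \<le> B"
  proof (intro exI allI)
    fix x :: 'a
    have "(\<Prod>b\<in>Basis. inverse (1 + (x \<bullet> b)\<^sup>2)) \<le> 1"
      by (intro prod_le_1) (auto simp: inverse_le_1_iff)
    then show "cmod (\<phi> x) \<le> C" using le[of x] C(2)[of x] mult_left_le[OF _ C(1)] by (meson order_trans)
  qed
  have "integrable lborel (\<lambda>u::real. inverse (1 + u\<^sup>2))"
    using integrable_inverse_1_plus_square by (simp add: set_integrable_def)
  then have "integrable lborel (\<lambda>x::'a. C * (\<Prod>b\<in>Basis. inverse (1 + (x \<bullet> b)\<^sup>2)))"
    by (intro integrable_mult_right integrable_lborel_prod_Basis(1))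
  then show int: "integrable lborel (\<lambda>x. (1 + norm x) * cmod (\<phi> x))"
  proof (rule Bochner_Integration.integrable_bound)
    show "AE x in lborel. norm ((1 + norm x) * cmod (\<phi> x)) \<le> norm (C * (\<Prod>b\<in>Basis. inverse (1 + (x \<bullet> b)\<^sup>2)))"
    proof (rule AE_I2)
      fix x
      have "norm ((1 + norm x) * cmod (\<phi> x)) = (1 + norm x) * cmod (\<phi> x)" by (simp add: abs_mult)
      then show "norm ((1 + norm x) * cmod (\<phi> x)) \<le> norm (C * (\<Prod>b\<in>Basis. inverse (1 + (x \<bullet> b)\<^sup>2)))"
        using C(2)[of x] by (metis abs_ge_self order_trans real_norm_def)
    qed
  qed measurable
  show "integrable lborel \<phi>"
  proof (rule Bochner_Integration.integrable_bound[OF int])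
    show "AE x in lborel. norm (\<phi> x) \<le> norm ((1 + norm x) * cmod (\<phi> x))"
      using le by (intro AE_I2) (metis abs_ge_self order_trans real_norm_def)
  qed measurable
qed

section \<open>Exponential decay\<close>

text \<open>The modulus of \<open>mchar\<close> is at most the total mass; hence exponentials of
  such exponents have modulus at most 1.\<close>

lemma Re_mchar_le:
  assumes "finite_measure \<kappa>"
  shows "Re (mchar \<kappa> \<xi> - measure \<kappa> (space \<kappa>)) \<le> 0"
  using complex_Re_le_cmod[of "mchar \<kappa> \<xi>"] norm_mchar_le[OF assms, of \<xi>] by simp

text \<open>Taylor's formula of order 4: the remainder is at most \<open>x ^ 4 / 24\<close>, which
  for \<open>\<bar>x\<bar> \<le> 1\<close> costs less than half of the quadratic term.\<close>

lemma cos_le_quadratic: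
  assumes "\<bar>x\<bar> \<le> (1::real)"
  shows "cos x \<le> 1 - x\<^sup>2 / 4"
proof -
  obtain u where "cos x = (\<Sum>m<4. cos_coeff m * x ^ m) + (cos (u + 1/2 * real 4 * pi) / fact 4) * x ^ 4"
    using Maclaurin_cos_expansion[of x 4] by blast
  moreover have "(\<Sum>m<4. cos_coeff m * x ^ m) = 1 - x\<^sup>2 / 2"
  proof -
    have "{..<4::nat} = {0, 1, 2, 3}" by auto
    then show ?thesis by (simp add: cos_coeff_def)
  qed
  moreover have "(cos (u + 1/2 * real 4 * pi) / fact 4) * x ^ 4 \<le> (1 / fact 4) * x ^ 4"
    by (intro mult_right_mono divide_right_mono) auto
  moreover have "\<bar>x\<bar> ^ 4 \<le> \<bar>x\<bar> ^ 2" using assms by (intro power_decreasing) auto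
  moreover have "1 - s / 2 + q \<le> 1 - s / 4" if "q \<le> (1 / fact 4) * p" "p \<le> s" "0 \<le> s" for p q s :: real
    using that by (simp add: fact_numeral)
  ultimately show ?thesis by simp
qed

text \<open>The left side is the integral of \<open>cos (y \<bullet> \<xi>) - 1\<close>, to which
  the quadratic bound applies pointwise. This turns nondegeneracy of the jumps into damping.\<close>

lemma Re_mchar_le_second_moment:
  assumes "finite_measure \<kappa>" and sets: "sets \<kappa> = sets borel" and small: "AE y in \<kappa>. \<bar>y \<bullet> \<xi>\<bar> \<le> 1"
    and b: "0 \<le> b" "ennreal b \<le> (\<integral>\<^sup>+y. ennreal ((y \<bullet> \<xi>)\<^sup>2) \<partial>\<kappa>)"
  shows "Re (mchar \<kappa> \<xi>) - measure \<kappa> (space \<kappa>) \<le> - (b / 4)"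
proof -
  interpret finite_measure \<kappa> by fact
  have m: "f \<in> borel_measurable \<kappa>" if "f \<in> borel_measurable borel" for f :: "'a \<Rightarrow> real"
    using borel_measurable_sets_eq_borel[OF sets that] .
  have mc: "(\<lambda>y. iexp (y \<bullet> \<xi>)) \<in> borel_measurable \<kappa>"
    by (rule borel_measurable_sets_eq_borel[OF sets]) measurable
  have int: "integrable \<kappa> (\<lambda>y. (y \<bullet> \<xi>)\<^sup>2)" "integrable \<kappa> (\<lambda>y. cos (y \<bullet> \<xi>))"
    using small by (auto intro!: integrable_const_bound[of _ 1] m elim!: eventually_mono simp: abs_square_le_1)
  have "Re (mchar \<kappa> \<xi>) = (\<integral>y. Re (iexp (y \<bullet> \<xi>)) \<partial>\<kappa>)"
    unfolding mchar_def using mc by (intro integral_Re[symmetric] integrable_const_bound[of _ 1]) auto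
  also have "\<dots> = (\<integral>y. cos (y \<bullet> \<xi>) \<partial>\<kappa>)" by (simp add: Re_exp)
  also have "\<dots> \<le> (\<integral>y. 1 - (y \<bullet> \<xi>)\<^sup>2 / 4 \<partial>\<kappa>)"
    using int small by (intro integral_mono_AE) (auto elim!: eventually_mono intro: cos_le_quadratic)
  also have "\<dots> = measure \<kappa> (space \<kappa>) - (\<integral>y. (y \<bullet> \<xi>)\<^sup>2 \<partial>\<kappa>) / 4"
    using int by simp
  finally have "Re (mchar \<kappa> \<xi>) - measure \<kappa> (space \<kappa>) \<le> - ((\<integral>y. (y \<bullet> \<xi>)\<^sup>2 \<partial>\<kappa>) / 4)" by simp
  moreover have "b \<le> (\<integral>y. (y \<bullet> \<xi>)\<^sup>2 \<partial>\<kappa>)"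
    using b int by (subst (asm) nn_integral_eq_integral) (auto simp: ennreal_le_iff)
  ultimately show ?thesis by linarith
qed

text \<open>
  Multiplying by \<open>exp (i c \<bullet> \<xi> + mchar (\<kappa> n) \<xi> - \<kappa> n (UNIV))\<close> is convolution with a probability law,
  so it does not increase the \<open>L\<^sub>1\<close> norm; Fatou's lemma carries this over to the limit.
\<close>

lemma nn_integral_convolution_le_compound_poisson:
  fixes h :: "'a::euclidean_space \<Rightarrow> complex" and c :: "nat \<Rightarrow> 'a"
  assumes h: "integrable lborel h"
    and Q: "finite_measure Q" "sets Q = sets borel"
    and N: "finite_measure N" "sets N = sets borel"
    and \<kappa>: "\<And>n. finite_measure (\<kappa> n)" "\<And>n. sets (\<kappa> n) = sets borel"
    and lim: "\<And>\<xi>. (\<lambda>n. exp (\<i> * of_real (c n \<bullet> \<xi>) + (mchar (\<kappa> n) \<xi> - measure (\<kappa> n) (space (\<kappa> n)))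
        + (mchar N \<xi> - measure N (space N)))) \<longlonglongrightarrow> mchar Q \<xi>"
  shows "(\<integral>\<^sup>+x. ennreal (cmod (\<integral>y. inv_fourier h (x + y) \<partial>Q)) \<partial>lborel)
    \<le> (\<integral>\<^sup>+x. ennreal (cmod (inv_fourier (\<lambda>\<xi>. exp (mchar N \<xi> - measure N (space N)) * h \<xi>) x)) \<partial>lborel)"
proof -
  note [measurable] = borel_measurable_integrable[OF h] borel_measurable_mchar[OF Q] borel_measurable_mchar[OF N] borel_measurable_mchar[OF \<kappa>]
  define h2 where "h2 \<xi> = exp (mchar N \<xi> - measure N (space N)) * h \<xi>" for \<xi>
  have [measurable]: "h2 \<in> borel_measurable borel" unfolding h2_def by measurable
  have h2: "integrable lborel h2"
    unfolding h2_def
    by (rule integrable_mult_bounded[OF h, of _ 1]) (use Re_mchar_le[OF N(1)] in auto)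
  define h3 where "h3 n \<xi> = exp (mchar (\<kappa> n) \<xi> - measure (\<kappa> n) (space (\<kappa> n))) * h2 \<xi>" for n \<xi>
  have [measurable]: "h3 n \<in> borel_measurable borel" for n unfolding h3_def by measurable
  define E where "E n \<xi> = exp (\<i> * of_real (c n \<bullet> \<xi>) + (mchar (\<kappa> n) \<xi> - measure (\<kappa> n) (space (\<kappa> n)))
        + (mchar N \<xi> - measure N (space N)))" for n \<xi>
  have [measurable]: "E n \<in> borel_measurable borel" for n unfolding E_def by measurable
  have E_le: "cmod (E n \<xi>) \<le> 1" for n \<xi>
    using Re_mchar_le[OF N(1), of \<xi>] Re_mchar_le[OF \<kappa>(1)[of n], of \<xi>] by (simp add: E_def)
  \<comment> \<open>The drift factor on the frequency side is a translation by \<open>c n\<close> in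
    space.\<close>
  have E_eq: "inv_fourier (\<lambda>\<xi>. E n \<xi> * h \<xi>) x = inv_fourier (h3 n) (x + c n)" for n x
    unfolding inv_fourier_def h3_def h2_def E_def
    by (intro Bochner_Integration.integral_cong) (auto simp: inner_add_left exp_add distrib_left mult_ac)
  have "(\<lambda>n. inv_fourier (\<lambda>\<xi>. E n \<xi> * h \<xi>) x) \<longlonglongrightarrow> inv_fourier (\<lambda>\<xi>. mchar Q \<xi> * h \<xi>) x" for x
    unfolding inv_fourier_def
  proof (rule integral_dominated_convergence)
    show "integrable lborel (\<lambda>\<xi>. cmod (h \<xi>))" using h by simp
    show "AE \<xi> in lborel. (\<lambda>n. iexp (x \<bullet> \<xi>) * (E n \<xi> * h \<xi>)) \<longlonglongrightarrow> iexp (x \<bullet> \<xi>) * (mchar Q \<xi> * h \<xi>)"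
      using lim unfolding E_def[symmetric] by (intro AE_I2 tendsto_mult tendsto_const)
    show "AE \<xi> in lborel. cmod (iexp (x \<bullet> \<xi>) * (E n \<xi> * h \<xi>)) \<le> cmod (h \<xi>)" for n
      using E_le by (intro AE_I2) (auto simp: norm_mult intro!: mult_left_le_one_le)
  qed measurable
  then have lim': "(\<lambda>n. inv_fourier (h3 n) (x + c n)) \<longlonglongrightarrow> (\<integral>y. inv_fourier h (x + y) \<partial>Q)" for x
    unfolding E_eq inv_fourier_mult_mchar[OF Q h] .
  have "(\<integral>\<^sup>+x. ennreal (cmod (\<integral>y. inv_fourier h (x + y) \<partial>Q)) \<partial>lborel) =
      (\<integral>\<^sup>+x. liminf (\<lambda>n. ennreal (cmod (inv_fourier (h3 n) (x + c n)))) \<partial>lborel)"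
    by (intro nn_integral_cong lim_imp_Liminf[symmetric] tendsto_ennrealI tendsto_norm lim') auto
  also have "\<dots> \<le> liminf (\<lambda>n. \<integral>\<^sup>+x. ennreal (cmod (inv_fourier (h3 n) (x + c n))) \<partial>lborel)"
    by (rule nn_integral_liminf) measurable
  also have "\<dots> \<le> (\<integral>\<^sup>+x. ennreal (cmod (inv_fourier h2 x)) \<partial>lborel)"
  proof (rule Liminf_le[OF sequentially_bot eventuallyI])
    fix n
    have "(\<integral>\<^sup>+x. ennreal (cmod (inv_fourier (h3 n) (x + c n))) \<partial>lborel) = (\<integral>\<^sup>+x. ennreal (cmod (inv_fourier (h3 n) x)) \<partial>lborel)"
      by (rule nn_integral_lborel_shift) measurable
    \<comment> \<open>Constant weight and \<open>K = 1\<close>, so the growth factor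
      \<open>exp ((K - 1) * _)\<close> is 1.\<close>
    also have "\<dots> \<le> (\<integral>\<^sup>+x. ennreal (cmod (inv_fourier h2 x)) \<partial>lborel)"
      using weighted_nn_integral_compound_poisson_le[OF \<kappa>(1)[of n] \<kappa>(2)[of n] h2, of "\<lambda>_. 1" 1]
      by (simp add: h3_def[abs_def])
    finally show "(\<integral>\<^sup>+x. ennreal (cmod (inv_fourier (h3 n) (x + c n))) \<partial>lborel) \<le> (\<integral>\<^sup>+x. ennreal (cmod (inv_fourier h2 x)) \<partial>lborel)" .
  qed
  finally show ?thesis by (simp add: h2_def[abs_def])
qed

section \<open>Restricting a Levy measure to an annulus\<close>

lemma levy_measure_annulus_finite:
  assumes \<nu>: "levy_measure \<nu>" and "0 < \<delta>"
  shows "emeasure \<nu> {y. \<delta> \<le> norm y \<and> norm y \<le> R} < \<infinity>"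
proof -
  have sets: "sets \<nu> = sets borel" using \<nu> by (simp add: levy_measure_def)
  let ?A = "{y. \<delta> \<le> norm y \<and> norm y \<le> R}"
  have A: "?A \<in> sets \<nu>" unfolding sets by measurable
  have "emeasure \<nu> ?A = (\<integral>\<^sup>+y. indicator ?A y \<partial>\<nu>)" using A by simp
  also have "\<dots> \<le> (\<integral>\<^sup>+y. ennreal (1 / min 1 (\<delta>\<^sup>2)) * ennreal (min 1 ((norm y)\<^sup>2)) \<partial>\<nu>)"
  proof (rule nn_integral_mono)
    fix y :: 'a
    show "indicator ?A y \<le> ennreal (1 / min 1 (\<delta>\<^sup>2)) * ennreal (min 1 ((norm y)\<^sup>2))"
    proof (cases "y \<in> ?A")
      case True
      then have "\<delta>\<^sup>2 \<le> (norm y)\<^sup>2" using \<open>0 < \<delta>\<close> by (intro power_mono) auto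
      then have "min 1 (\<delta>\<^sup>2) \<le> min 1 ((norm y)\<^sup>2)" by auto
      then have "1 \<le> 1 / min 1 (\<delta>\<^sup>2) * min 1 ((norm y)\<^sup>2)"
        using \<open>0 < \<delta>\<close> by (simp add: min_def divide_simps)
      then have "ennreal 1 \<le> ennreal (1 / min 1 (\<delta>\<^sup>2) * min 1 ((norm y)\<^sup>2))" by (rule ennreal_leI)
      then show ?thesis using True \<open>0 < \<delta>\<close> by (subst (asm) ennreal_mult) auto
    qed simp
  qed
  also have "\<dots> = ennreal (1 / min 1 (\<delta>\<^sup>2)) * (\<integral>\<^sup>+y. ennreal (min 1 ((norm y)\<^sup>2)) \<partial>\<nu>)"
    by (intro nn_integral_cmult borel_measurable_sets_eq_borel[OF sets]) measurable
  also have "\<dots> < \<infinity>" using \<nu> by (simp add: levy_measure_def ennreal_mult_less_top)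
  finally show ?thesis .
qed

text \<open>Removing a small ball loses at most the integral of \<open>(norm y)\<^sup>2\<close> over
  it, uniformly in the unit vector \<xi> by Cauchy-Schwarz. This loss tends to 0, so for a small
  enough ball it is below \<open>e / 2\<close>, where \<open>e\<close> lies below the infimum.
  Homogeneity gives the bound for all \<xi>.\<close>

lemma levy_measure_nondegenerate_annulus:
  fixes \<nu> :: "'a::euclidean_space measure"
  assumes \<nu>: "levy_measure \<nu>" and R: "0 < R"
    and pos: "(INF \<xi>\<in>sphere 0 1. \<integral>\<^sup>+ y\<in>cball 0 R. ennreal (\<bar>y \<bullet> \<xi>\<bar>\<^sup>2) \<partial>\<nu>) > 0"
  obtains \<delta> k where "0 < \<delta>" "0 < k"
    "\<And>\<xi>. ennreal (k * (norm \<xi>)\<^sup>2) \<le> (\<integral>\<^sup>+y. indicator {y. \<delta> \<le> norm y \<and> norm y \<le> R} y * ennreal ((y \<bullet> \<xi>)\<^sup>2) \<partial>\<nu>)"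
proof -
  have sets: "sets \<nu> = sets borel" using \<nu> by (simp add: levy_measure_def)
  have m: "f \<in> borel_measurable \<nu>" if "f \<in> borel_measurable borel" for f :: "'a \<Rightarrow> ennreal"
    using borel_measurable_sets_eq_borel[OF sets that] .
  obtain e where e: "0 < e" "ennreal e < (INF \<xi>\<in>sphere 0 1. \<integral>\<^sup>+ y\<in>cball 0 R. ennreal (\<bar>y \<bullet> \<xi>\<bar>\<^sup>2) \<partial>\<nu>)"
  proof -
    obtain x where x: "0 < x" "x < (INF \<xi>\<in>sphere 0 1. \<integral>\<^sup>+ y\<in>cball 0 R. ennreal (\<bar>y \<bullet> \<xi>\<bar>\<^sup>2) \<partial>\<nu>)"
      using dense[OF pos] by blast
    then have "x < top" by (meson less_le_trans top_greatest)
    with x show thesis by (cases x) (auto intro: that)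
  qed
  define W where "W y = indicator (cball 0 R) y * ennreal ((norm y)\<^sup>2)" for y :: 'a
  \<comment> \<open>The loss caused by removing a ball, bounded independently of \<xi>;
    \<open>W\<close> is its integrable majorant.\<close>
  define U where "U n y = indicator (ball 0 (1 / real (Suc n))) y * W y" for n and y :: 'a
  have [measurable]: "W \<in> borel_measurable borel"
    unfolding W_def by (intro borel_measurable_times_ennreal borel_measurable_indicator) auto
  have [measurable]: "U n \<in> borel_measurable borel" for n
    unfolding U_def by (intro borel_measurable_times_ennreal borel_measurable_indicator) auto
  have "(\<integral>\<^sup>+y. W y \<partial>\<nu>) \<le> (\<integral>\<^sup>+y. ennreal (max 1 (R\<^sup>2)) * ennreal (min 1 ((norm y)\<^sup>2)) \<partial>\<nu>)"
  proof (rule nn_integral_mono)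
    fix y :: 'a
    show "W y \<le> ennreal (max 1 (R\<^sup>2)) * ennreal (min 1 ((norm y)\<^sup>2))"
    proof (cases "norm y \<le> R")
      case True
      have "(norm y)\<^sup>2 \<le> max 1 (R\<^sup>2) * min 1 ((norm y)\<^sup>2)"
      proof (cases "(norm y)\<^sup>2 \<le> 1")
        case True
        then show ?thesis by (simp add: mult_le_cancel_right1)
      next
        case False
        moreover have "(norm y)\<^sup>2 \<le> R\<^sup>2" using \<open>norm y \<le> R\<close> by (intro power_mono) auto
        ultimately show ?thesis by simp
      qed
      then have "ennreal ((norm y)\<^sup>2) \<le> ennreal (max 1 (R\<^sup>2) * min 1 ((norm y)\<^sup>2))" by (rule ennreal_leI)
      then show ?thesis using True by (subst (asm) ennreal_mult) (auto simp: W_def)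
    qed (simp add: W_def)
  qed
  also have "\<dots> = ennreal (max 1 (R\<^sup>2)) * (\<integral>\<^sup>+y. ennreal (min 1 ((norm y)\<^sup>2)) \<partial>\<nu>)"
    by (intro nn_integral_cmult m) measurable
  also have "\<dots> < \<infinity>" using \<nu> by (simp add: levy_measure_def ennreal_mult_less_top)
  finally have W: "(\<integral>\<^sup>+y. W y \<partial>\<nu>) < \<infinity>" .
  have "(\<lambda>n. \<integral>\<^sup>+y. U n y \<partial>\<nu>) \<longlonglongrightarrow> (\<integral>\<^sup>+y. 0 \<partial>\<nu>)"
  proof (rule nn_integral_dominated_convergence[where w=W])
    show "AE y in \<nu>. (\<lambda>n. U n y) \<longlonglongrightarrow> 0"
    proof (rule AE_I2)
      fix y :: 'a
      show "(\<lambda>n. U n y) \<longlonglongrightarrow> 0"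
      proof (cases "y = 0")
        case True
        then show ?thesis by (simp add: U_def W_def)
      next
        case False
        obtain k :: nat where k: "1 / norm y < real k" using reals_Archimedean2 by blast
        have "U n y = 0" if "k \<le> n" for n
        proof -
          have "1 / norm y < real (Suc n)" using k that by linarith
          then have "1 / real (Suc n) < norm y" using False by (simp add: field_simps)
          then show ?thesis by (simp add: U_def)
        qed
        then show ?thesis by (intro tendsto_eventually eventually_sequentiallyI[of k])
      qed
    qed
    show "AE y in \<nu>. U n y \<le> W y" for n by (intro AE_I2) (simp add: U_def split: split_indicator)
  qed (use W in \<open>auto intro!: m\<close>)
  then have "\<forall>\<^sub>F n in sequentially. (\<integral>\<^sup>+y. U n y \<partial>\<nu>) < ennreal (e / 2)"
    using e(1) by (intro order_tendstoD(2)) auto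
  then obtain n where n: "(\<integral>\<^sup>+y. U n y \<partial>\<nu>) < ennreal (e / 2)" by (auto simp: eventually_sequentially)
  define \<delta> where "\<delta> = 1 / real (Suc n)"
  define V where "V \<xi> y = indicator {y. \<delta> \<le> norm y \<and> norm y \<le> R} y * ennreal ((y \<bullet> \<xi>)\<^sup>2)" for \<xi> y :: 'a
  have [measurable]: "V \<xi> \<in> borel_measurable borel" for \<xi>
    unfolding V_def by (intro borel_measurable_times_ennreal borel_measurable_indicator) auto
  have unit: "ennreal (e / 2) \<le> (\<integral>\<^sup>+y. V \<xi> y \<partial>\<nu>)" if "norm \<xi> = 1" for \<xi>
  proof (rule ccontr)
    assume less: "\<not> ?thesis"
    have "ennreal e < (\<integral>\<^sup>+ y\<in>cball 0 R. ennreal (\<bar>y \<bullet> \<xi>\<bar>\<^sup>2) \<partial>\<nu>)"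
      using e(2) that by (elim less_le_trans) (auto intro: INF_lower)
    also have "\<dots> \<le> (\<integral>\<^sup>+y. V \<xi> y + U n y \<partial>\<nu>)"
    proof (rule nn_integral_mono)
      fix y :: 'a
      have "(y \<bullet> \<xi>)\<^sup>2 \<le> (norm y)\<^sup>2"
        using Cauchy_Schwarz_ineq2[of y \<xi>] that by (simp add: abs_le_square_iff[symmetric])
      then have "ennreal ((y \<bullet> \<xi>)\<^sup>2) \<le> ennreal ((norm y)\<^sup>2)" by (rule ennreal_leI)
      then show "ennreal (\<bar>y \<bullet> \<xi>\<bar>\<^sup>2) * indicator (cball 0 R) y \<le> V \<xi> y + U n y"
        unfolding V_def U_def W_def \<delta>_def by (auto split: split_indicator)
    qed
    also have "\<dots> = (\<integral>\<^sup>+y. V \<xi> y \<partial>\<nu>) + (\<integral>\<^sup>+y. U n y \<partial>\<nu>)"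
      by (intro nn_integral_add m) measurable
    also have "\<dots> < ennreal (e / 2) + ennreal (e / 2)"
    proof (rule le_less_trans)
      show "(\<integral>\<^sup>+y. V \<xi> y \<partial>\<nu>) + (\<integral>\<^sup>+y. U n y \<partial>\<nu>) \<le> ennreal (e / 2) + (\<integral>\<^sup>+y. U n y \<partial>\<nu>)"
        using less by (intro add_right_mono) auto
    qed (use n in \<open>simp add: ennreal_add_left_cancel_less\<close>)
    also have "\<dots> = ennreal e" using e(1) by (simp add: ennreal_plus[symmetric] del: ennreal_plus)
    finally show False by simp
  qed
  show thesis
  proof (rule that[of \<delta> "e / 2"])
    show "0 < \<delta>" "0 < e / 2" using e(1) by (auto simp: \<delta>_def)
    fix \<xi> :: 'a
    have "ennreal (e / 2 * (norm \<xi>)\<^sup>2) \<le> (\<integral>\<^sup>+y. V \<xi> y \<partial>\<nu>)"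
    proof (cases "\<xi> = 0")
      case False
      define \<eta> where "\<eta> = \<xi> /\<^sub>R norm \<xi>"
      have \<eta>: "norm \<eta> = 1" "\<xi> = norm \<xi> *\<^sub>R \<eta>" using False by (auto simp: \<eta>_def)
      have "V \<xi> y = ennreal ((norm \<xi>)\<^sup>2) * V \<eta> y" for y
        unfolding V_def by (subst \<eta>(2)) (simp add: power_mult_distrib ennreal_mult mult_ac)
      then have "(\<integral>\<^sup>+y. V \<xi> y \<partial>\<nu>) = ennreal ((norm \<xi>)\<^sup>2) * (\<integral>\<^sup>+y. V \<eta> y \<partial>\<nu>)"
        by (simp add: nn_integral_cmult m)
      also have "\<dots> \<ge> ennreal ((norm \<xi>)\<^sup>2) * ennreal (e / 2)"
        by (intro mult_left_mono unit \<eta>) simp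
      finally show ?thesis using e(1) by (subst ennreal_mult) (auto simp: mult.commute)
    qed simp
    then show "ennreal (e / 2 * (norm \<xi>)\<^sup>2) \<le> (\<integral>\<^sup>+y. indicator {y. \<delta> \<le> norm y \<and> norm y \<le> R} y * ennreal ((y \<bullet> \<xi>)\<^sup>2) \<partial>\<nu>)"
      by (simp add: V_def)
  qed
qed

section \<open>Dilations of finite measures\<close>

lemma mchar_distr:
  fixes \<kappa> :: "'a::euclidean_space measure"
  assumes "sets \<kappa> = sets borel"
  shows "mchar (distr \<kappa> borel (\<lambda>y. c *\<^sub>R y)) \<xi> = mchar \<kappa> (c *\<^sub>R \<xi>)"
proof -
  have "(\<lambda>y. c *\<^sub>R y) \<in> measurable \<kappa> borel"
    by (rule borel_measurable_sets_eq_borel[OF assms]) measurable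
  then show ?thesis unfolding mchar_def by (subst integral_distr) auto
qed

lemma finite_measure_distr_borel:
  assumes "finite_measure \<kappa>" "f \<in> borel_measurable \<kappa>"
  shows "finite_measure (distr \<kappa> borel f)"
    "measure (distr \<kappa> borel f) (space (distr \<kappa> borel f)) = measure \<kappa> (space \<kappa>)"
proof -
  interpret finite_measure \<kappa> by fact
  show "finite_measure (distr \<kappa> borel f)" by (rule finite_measure_distr) fact
  show "measure (distr \<kappa> borel f) (space (distr \<kappa> borel f)) = measure \<kappa> (space \<kappa>)"
    using assms(2) measurable_space[OF assms(2)]
    by (simp add: measure_distr vimage_def Int_absorb1 subset_eq)
qed

text \<open>For \<open>\<rho> = \<epsilon> r\<close> and \<open>\<tau> = t / s \<rho>\<close> the following measure is dominated by \<open>t \<Lambda>\<^sub>u\<close> for each \<open>u\<close>.\<close>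

definition scaled_restriction :: "real \<Rightarrow> real \<Rightarrow> 'a::euclidean_space set \<Rightarrow> 'a measure \<Rightarrow> 'a measure" where
  "scaled_restriction \<tau> \<rho> Y \<nu> = distr (density \<nu> (\<lambda>y. ennreal \<tau> * indicator Y y)) borel (\<lambda>y. \<rho> *\<^sub>R y)"

lemma sets_scaled_restriction [simp]: "sets (scaled_restriction \<tau> \<rho> Y \<nu>) = sets borel"
  by (simp add: scaled_restriction_def)

lemma nn_integral_scaled_restriction:
  assumes \<nu>: "sets \<nu> = sets borel" and [measurable]: "Y \<in> sets borel" "f \<in> borel_measurable borel"
  shows "(\<integral>\<^sup>+y. f y \<partial>scaled_restriction \<tau> \<rho> Y \<nu>) = ennreal \<tau> * (\<integral>\<^sup>+y. indicator Y y * f (\<rho> *\<^sub>R y) \<partial>\<nu>)"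
proof -
  note m = borel_measurable_sets_eq_borel[OF \<nu>]
  have "(\<lambda>y. \<rho> *\<^sub>R y) \<in> borel_measurable (density \<nu> (\<lambda>y. ennreal \<tau> * indicator Y y))"
    by (rule borel_measurable_sets_eq_borel) (use \<nu> in auto)
  then have "(\<integral>\<^sup>+y. f y \<partial>scaled_restriction \<tau> \<rho> Y \<nu>) = (\<integral>\<^sup>+y. f (\<rho> *\<^sub>R y) \<partial>density \<nu> (\<lambda>y. ennreal \<tau> * indicator Y y))"
    unfolding scaled_restriction_def by (rule nn_integral_distr) measurable
  also have "\<dots> = (\<integral>\<^sup>+y. ennreal \<tau> * indicator Y y * f (\<rho> *\<^sub>R y) \<partial>\<nu>)"
    by (intro nn_integral_density m) measurable
  also have "\<dots> = ennreal \<tau> * (\<integral>\<^sup>+y. indicator Y y * f (\<rho> *\<^sub>R y) \<partial>\<nu>)"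
    unfolding mult.assoc by (intro nn_integral_cmult m) measurable
  finally show ?thesis .
qed

lemma emeasure_scaled_restriction:
  assumes \<nu>: "sets \<nu> = sets borel" and [measurable]: "Y \<in> sets borel" "B \<in> sets borel"
  shows "emeasure (scaled_restriction \<tau> \<rho> Y \<nu>) B = ennreal \<tau> * (\<integral>\<^sup>+y. indicator Y y * indicator B (\<rho> *\<^sub>R y) \<partial>\<nu>)"
proof -
  have "emeasure (scaled_restriction \<tau> \<rho> Y \<nu>) B = (\<integral>\<^sup>+y. indicator B y \<partial>scaled_restriction \<tau> \<rho> Y \<nu>)"
    using assms(3) by simp
  then show ?thesis using nn_integral_scaled_restriction[OF assms(1,2), of "indicator B"] by simp
qed

lemma finite_measure_scaled_restriction:
  assumes \<nu>: "sets \<nu> = sets borel" and Y: "Y \<in> sets borel" "emeasure \<nu> Y < \<infinity>" and "0 \<le> \<tau>"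
  shows "finite_measure (scaled_restriction \<tau> \<rho> Y \<nu>)"
    "measure (scaled_restriction \<tau> \<rho> Y \<nu>) (space (scaled_restriction \<tau> \<rho> Y \<nu>)) = \<tau> * measure \<nu> Y"
proof -
  let ?N = "scaled_restriction \<tau> \<rho> Y \<nu>"
  have sp: "space ?N = UNIV" by (simp add: scaled_restriction_def)
  have "emeasure ?N (space ?N) = ennreal \<tau> * emeasure \<nu> Y"
    using emeasure_scaled_restriction[OF \<nu> Y(1), of UNIV] Y \<nu> by (simp add: sp)
  also have "\<dots> = ennreal (\<tau> * measure \<nu> Y)"
    using Y(2) \<open>0 \<le> \<tau>\<close> by (simp add: emeasure_eq_ennreal_measure ennreal_mult)
  finally have *: "emeasure ?N (space ?N) = ennreal (\<tau> * measure \<nu> Y)" .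
  then show "finite_measure ?N" by (intro finite_measureI) simp
  show "measure ?N (space ?N) = \<tau> * measure \<nu> Y"
    using * \<open>0 \<le> \<tau>\<close> by (simp add: measure_def)
qed

lemma AE_scaled_restriction:
  assumes \<nu>: "sets \<nu> = sets borel" and Y: "Y \<in> sets borel"
    and "Measurable.pred borel P" "\<And>y. y \<in> Y \<Longrightarrow> P (\<rho> *\<^sub>R y)"
  shows "AE y in scaled_restriction \<tau> \<rho> Y \<nu>. P y"
proof (rule AE_I)
  let ?B = "{y. \<not> P y}"
  note [measurable] = assms(3)
  have B: "?B \<in> sets borel" by measurable
  have "emeasure (scaled_restriction \<tau> \<rho> Y \<nu>) ?B = ennreal \<tau> * (\<integral>\<^sup>+y. 0 \<partial>\<nu>)"
    unfolding emeasure_scaled_restriction[OF \<nu> Y B]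
    by (intro arg_cong[where f="(*) _"] nn_integral_cong) (use assms(4) in \<open>auto split: split_indicator\<close>)
  then show "emeasure (scaled_restriction \<tau> \<rho> Y \<nu>) ?B = 0" by simp
  show "?B \<in> sets (scaled_restriction \<tau> \<rho> Y \<nu>)" using B by simp
qed auto

text \<open>\<open>h\<close> is the Fourier transform of \<phi> up to a constant. Bounded and
  supported in a ball, it is integrable, which is what inversion requires.\<close>

lemma fourier_inversion_schwartz:
  fixes \<phi> :: "'a::euclidean_space \<Rightarrow> complex"
  assumes \<phi>: "schwartz \<phi>" and Cc: "Cc_infty (ball 0 c - ball 0 (inverse c)) (fourier \<phi>)"
  obtains h where "integrable lborel h" "\<And>x. inv_fourier h x = \<phi> x"
    "\<And>\<xi>. h \<xi> \<noteq> 0 \<Longrightarrow> inverse c \<le> norm \<xi> \<and> norm \<xi> \<le> c"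
proof -
  note S = schwartz_integrable[OF \<phi>]
  obtain B where B: "\<And>x. cmod (\<phi> x) \<le> B" using S(2) by blast
  define \<psi> where "\<psi> \<xi> = inv_fourier \<phi> (- \<xi>)" for \<xi>
  have four: "fourier \<phi> \<xi> = of_real ((2 * pi) powr (- (real DIM('a) / 2))) * \<psi> \<xi>" for \<xi>
    unfolding fourier_def \<psi>_def inv_fourier_def by simp
  have [measurable]: "\<phi> \<in> borel_measurable borel" using S(4) by auto
  have [measurable]: "\<psi> \<in> borel_measurable borel" unfolding \<psi>_def by measurable
  have supp: "inverse c \<le> norm \<xi> \<and> norm \<xi> \<le> c" if "\<psi> \<xi> \<noteq> 0" for \<xi>
  proof -
    have "\<xi> \<in> support_on UNIV (fourier \<phi>)" using that by (simp add: support_on_def four)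
    then have "\<xi> \<in> ball 0 c - ball 0 (inverse c)"
      using Cc closure_subset unfolding Cc_infty_def by blast
    then show ?thesis by auto
  qed
  have "integrable lborel \<psi>"
  proof (rule Bochner_Integration.integrable_bound)
    have "emeasure lborel (cball (0::'a) c) < \<infinity>" by (intro emeasure_bounded_finite bounded_cball)
    then show "integrable lborel (\<lambda>\<xi>. (\<integral>x. cmod (\<phi> x) \<partial>lborel) * indicator (cball (0::'a) c) \<xi>)"
      by (intro integrable_mult_right integrable_real_indicator) auto
    have "norm (\<psi> \<xi>) \<le> norm ((\<integral>x. cmod (\<phi> x) \<partial>lborel) * indicator (cball (0::'a) c) \<xi>)" for \<xi>
      using supp[of \<xi>] norm_inv_fourier_le[of \<phi> "- \<xi>"] by (cases "\<psi> \<xi> = 0") (auto simp: \<psi>_def)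
    then show "AE \<xi> in lborel. norm (\<psi> \<xi>) \<le> norm ((\<integral>x. cmod (\<phi> x) \<partial>lborel) * indicator (cball (0::'a) c) \<xi>)"
      by simp
  qed measurable
  \<comment> \<open>\<open>inv_fourier\<close> carries no normalizing factor, so inversion produces
    this constant; it is divided out in \<open>h\<close>.\<close>
  moreover define K where "K = (2 * pi) ^ DIM('a)"
  then have K: "K \<noteq> 0" by simp
  have "inv_fourier \<psi> x = K *\<^sub>R \<phi> x" for x
    using fourier_inversion[OF S(1) B S(4)] \<open>integrable lborel \<psi>\<close> unfolding \<psi>_def[abs_def] K_def by blast
  then have "inv_fourier (\<lambda>\<xi>. inverse K *\<^sub>R \<psi> \<xi>) x = \<phi> x" for x
    using K by (simp add: inv_fourier_def)
  ultimately show thesis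
    using supp by (intro that[of "\<lambda>\<xi>. inverse K *\<^sub>R \<psi> \<xi>"]) auto
qed

lemma distr_scaled_restriction:
  assumes "sets \<nu> = sets borel"
  shows "distr (scaled_restriction \<tau> \<rho> Y \<nu>) borel (\<lambda>y. c *\<^sub>R y) = scaled_restriction \<tau> (c * \<rho>) Y \<nu>"
proof -
  have "(\<lambda>y. \<rho> *\<^sub>R y) \<in> borel_measurable (density \<nu> (\<lambda>y. ennreal \<tau> * indicator Y y))"
    by (rule borel_measurable_sets_eq_borel) (use assms in auto)
  then show ?thesis
    unfolding scaled_restriction_def by (subst distr_distr) (auto simp: o_def)
qed

theorem proposition3p4:
  fixes s sL sU :: "real \<Rightarrow> real"
    and M :: "'w measure" and F :: "real \<Rightarrow> 'w measure"
    and Z :: "real \<Rightarrow> 'w \<Rightarrow> 'a::euclidean_space"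
    and a :: "real \<Rightarrow> 'a" and \<Lambda> :: "real \<Rightarrow> 'a measure"
    and \<nu> :: "'a measure" and N\<nu> :: real
  assumes "scaling_triple s sL sU"
    and "additive_process M F Z a \<Lambda>"
    and "levy_measure \<nu>"
    and "0 < N\<nu>"
    and "\<And>t f r. \<lbrakk>0 \<le> t; f \<in> borel_measurable borel; \<And>y. 0 \<le> f y; 0 < r\<rbrakk> \<Longrightarrow>
           ennreal (s r) * (\<integral>\<^sup>+ y. ennreal (f (y /\<^sub>R r)) \<partial>\<Lambda> t) \<ge> (\<integral>\<^sup>+ y. ennreal (f y) \<partial>\<nu>)"
    and "(INF \<xi>\<in>sphere 0 1. \<integral>\<^sup>+ y\<in>cball 0 N\<nu>. ennreal (\<bar>y \<bullet> \<xi>\<bar>\<^sup>2) \<partial>\<nu>) > 0"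
  shows "\<forall>T>0. \<forall>\<phi> :: 'a \<Rightarrow> complex. schwartz \<phi> \<longrightarrow>
           Cc_infty (ball 0 (scaling_c sL) - ball 0 (inverse (scaling_c sL))) (fourier \<phi>) \<longrightarrow>
           (\<exists>N\<^sub>0>0. \<exists>N\<^sub>1>0. \<forall>r\<in>{0<..<1}. \<forall>t\<in>{0..T}.
              (\<integral>\<^sup>+ x. ennreal (cmod (\<integral>\<omega>. \<phi> (x + Z t \<omega> /\<^sub>R r) \<partial>M)) \<partial>lborel)
                \<le> ennreal (N\<^sub>0 * exp (- (N\<^sub>1 * t / s r))))"
proof (intro allI impI)
  fix T :: real and \<phi> :: "'a \<Rightarrow> complex"
  assume \<phi>: "schwartz \<phi>" and Cc: "Cc_infty (ball 0 (scaling_c sL) - ball 0 (inverse (scaling_c sL))) (fourier \<phi>)"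
  define c where "c = scaling_c sL"
  have c: "1 \<le> c" by (simp add: c_def scaling_c_def)
  obtain h where h: "integrable lborel h" "\<And>x. inv_fourier h x = \<phi> x"
    and h_supp: "\<And>\<xi>. h \<xi> \<noteq> 0 \<Longrightarrow> inverse c \<le> norm \<xi> \<and> norm \<xi> \<le> c"
    using fourier_inversion_schwartz[OF \<phi> Cc[folded c_def]] by blast
  obtain \<delta> k where \<delta>: "0 < \<delta>" and k: "0 < k"
    and moment: "\<And>\<xi>. ennreal (k * (norm \<xi>)\<^sup>2) \<le>
      (\<integral>\<^sup>+y. indicator {y. \<delta> \<le> norm y \<and> norm y \<le> N\<nu>} y * ennreal ((y \<bullet> \<xi>)\<^sup>2) \<partial>\<nu>)"
    using levy_measure_nondegenerate_annulus[OF assms(3,4,6)] by blast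
  define Y where "Y = {y :: 'a. \<delta> \<le> norm y \<and> norm y \<le> N\<nu>}"
  have Y: "Y \<in> sets borel" "emeasure \<nu> Y < \<infinity>"
    using levy_measure_annulus_finite[OF assms(3) \<delta>] unfolding Y_def by measurable
  note [measurable] = Y(1)
  have sets\<nu>: "sets \<nu> = sets borel" using assms(3) by (simp add: levy_measure_def)
  \<comment> \<open>Jumps of size at most \<open>\<epsilon> * N\<nu>\<close> meet frequencies of
    size at most \<open>c\<close>, so the product stays below 1. The added 1 also gives a simple
    proof of \<open>\<epsilon> \<le> 1\<close>, needed to compare the scales
    \<open>\<epsilon> * r\<close> and \<open>r\<close>.\<close>
  define \<epsilon> where "\<epsilon> = 1 / (N\<nu> * c + 1)"
  have \<epsilon>: "0 < \<epsilon>" "\<epsilon> \<le> 1" "\<epsilon> * N\<nu> * c \<le> 1"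
    using assms(4) c by (auto simp: \<epsilon>_def add_pos_pos divide_simps)
  have s_pos: "0 < s r" if "0 < r" for r using assms(1) that by (simp add: scaling_triple_def)
  have sL_pos: "0 < sL (1 / \<epsilon>)" using assms(1) \<epsilon>(1) by (simp add: scaling_triple_def)
  have s_ratio: "sL (1 / \<epsilon>) \<le> s r / s (\<epsilon> * r)" if "0 < r" for r
  proof -
    have "0 < \<epsilon> * r" "\<epsilon> * r \<le> r" using that \<epsilon> by (auto simp: mult_le_cancel_right1)
    then have "sL (r / (\<epsilon> * r)) \<le> s r / s (\<epsilon> * r)" using assms(1) unfolding scaling_triple_def by blast
    then show ?thesis using that by simp
  qed
  have [measurable]: "\<phi> \<in> borel_measurable borel" using schwartz_integrable(4)[OF \<phi>] by auto
  have fin: "(\<integral>\<^sup>+x. ennreal ((1 + norm x) * cmod (inv_fourier h x)) \<partial>lborel) < \<infinity>"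
    using schwartz_integrable(3)[OF \<phi>] unfolding h(2) by (subst nn_integral_eq_integral) auto
  \<comment> \<open>The second moment bound \<open>k * (norm \<xi>)\<^sup>2\<close>, with jumps
    shrunk by \<epsilon> and \<open>norm \<xi>\<close> at least \<open>inverse c\<close>; the 4 is
    that of the cosine estimate.\<close>
  have rate: "0 < k * \<epsilon>\<^sup>2 / c\<^sup>2 / 4" using k \<epsilon> c by simp
  have \<epsilon>N: "0 \<le> \<epsilon> * N\<nu>" using \<epsilon> assms(4) by simp
  obtain C c' where C: "0 < C" "0 < c'" and decay:
    "\<And>\<tau> \<kappa>. \<lbrakk>0 \<le> \<tau>; finite_measure \<kappa>; sets \<kappa> = sets borel; AE y in \<kappa>. norm y \<le> \<epsilon> * N\<nu>;
       measure \<kappa> (space \<kappa>) \<le> measure \<nu> Y * \<tau>;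
       \<forall>\<xi>. h \<xi> \<noteq> 0 \<longrightarrow> Re (mchar \<kappa> \<xi>) - measure \<kappa> (space \<kappa>) \<le> - (k * \<epsilon>\<^sup>2 / c\<^sup>2 / 4 * \<tau>)\<rbrakk> \<Longrightarrow>
       (\<integral>\<^sup>+x. ennreal (cmod (inv_fourier (\<lambda>\<xi>. exp (mchar \<kappa> \<xi> - measure \<kappa> (space \<kappa>)) * h \<xi>) x)) \<partial>lborel)
       \<le> ennreal (C * exp (- (c' * \<tau>)))"
    by (rule compound_poisson_exponential_decay[OF rate measure_nonneg[of \<nu> Y] \<epsilon>N h(1) fin]) blast
  have bound: "(\<integral>\<^sup>+ x. ennreal (cmod (\<integral>\<omega>. \<phi> (x + Z t \<omega> /\<^sub>R r) \<partial>M)) \<partial>lborel)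
                \<le> ennreal (C * exp (- (c' * sL (1 / \<epsilon>) * t / s r)))"
    if r: "0 < r" and t: "0 \<le> t" for r t
  proof -
    define \<rho> where "\<rho> = \<epsilon> * r"
    have \<rho>: "0 < \<rho>" using \<epsilon> r by (simp add: \<rho>_def)
    define \<tau> where "\<tau> = t / s \<rho>"
    have \<tau>: "0 \<le> \<tau>" "\<tau> * s \<rho> = t" using t s_pos[OF \<rho>] by (auto simp: \<tau>_def)
    define N where "N = scaled_restriction \<tau> \<rho> Y \<nu>"
    \<comment> \<open>The image of \<open>N\<close> under division by \<open>r\<close>. It depends
      on \<open>r\<close> and \<open>t\<close> only through \<tau>, which makes the decay constants
      uniform.\<close>
    define N' where "N' = scaled_restriction \<tau> \<epsilon> Y \<nu>"
    have N: "finite_measure N" "sets N = sets borel"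
      unfolding N_def by (auto intro: finite_measure_scaled_restriction[OF sets\<nu> Y \<tau>(1)])
    have N': "finite_measure N'" "sets N' = sets borel" "measure N' (space N') = \<tau> * measure \<nu> Y"
      unfolding N'_def by (auto intro: finite_measure_scaled_restriction[OF sets\<nu> Y \<tau>(1)])
    have N'_eq: "N' = distr N borel (\<lambda>y. inverse r *\<^sub>R y)"
    proof -
      have "inverse r * \<rho> = \<epsilon>" using r by (simp add: \<rho>_def field_simps)
      then show ?thesis unfolding N'_def N_def distr_scaled_restriction[OF sets\<nu>] by (simp only:)
    qed
    have N_large: "AE y in N. \<rho> * \<delta> \<le> norm y"
      unfolding N_def using \<rho> by (intro AE_scaled_restriction[OF sets\<nu> Y(1)]) (auto simp: Y_def)
    have N_le: "emeasure N B \<le> ennreal t * emeasure (\<Lambda> u) B" if u: "0 \<le> u" and B: "B \<in> sets borel" for u B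
    proof -
      \<comment> \<open>Tested on \<open>f\<close>, the hypothesis has \<open>emeasure N B\<close>
        up to the factor \<tau> on the side of \<nu>, whereas \<open>f (y /\<^sub>R \<rho>)\<close>
        is at most the indicator of \<open>B\<close> on the side of \<Lambda> u. The factors combine
        through \<open>\<tau> * s \<rho> = t\<close>.\<close>
      define f :: "'a \<Rightarrow> real" where "f y = indicator Y y * indicator B (\<rho> *\<^sub>R y)" for y
      have [measurable]: "Y \<in> sets borel" "B \<in> sets borel" by fact+
      have f: "f \<in> borel_measurable borel" unfolding f_def by measurable
      have sets\<Lambda>: "sets (\<Lambda> u) = sets borel"
        using assms(2) u by (simp add: additive_process_def bounded_triplet_def measurable_levy_family_def levy_measure_def)
      have "emeasure N B = ennreal \<tau> * (\<integral>\<^sup>+y. ennreal (f y) \<partial>\<nu>)"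
        unfolding N_def emeasure_scaled_restriction[OF sets\<nu> Y(1) B] f_def
        by (intro arg_cong[where f="(*) _"] nn_integral_cong) (simp split: split_indicator)
      also have "\<dots> \<le> ennreal \<tau> * (ennreal (s \<rho>) * (\<integral>\<^sup>+y. ennreal (f (y /\<^sub>R \<rho>)) \<partial>\<Lambda> u))"
        by (intro mult_left_mono assms(5) u f \<rho>) (auto simp: f_def)
      also have "\<dots> \<le> ennreal \<tau> * (ennreal (s \<rho>) * (\<integral>\<^sup>+y. indicator B y \<partial>\<Lambda> u))"
        using \<rho> by (intro mult_left_mono nn_integral_mono) (auto simp: f_def split: split_indicator)
      also have "\<dots> = ennreal t * emeasure (\<Lambda> u) B"
        using B sets\<Lambda> \<tau> s_pos[OF \<rho>] by (simp add: ennreal_mult[symmetric] flip: mult.assoc)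
      finally show ?thesis .
    qed
    obtain \<kappa> :: "nat \<Rightarrow> 'a measure" and d :: "nat \<Rightarrow> 'a" where
      \<kappa>: "\<And>n. finite_measure (\<kappa> n)" "\<And>n. sets (\<kappa> n) = sets borel"
      and lim: "\<And>\<xi>. (\<lambda>n. exp (\<i> * of_real (d n \<bullet> \<xi>) + (mchar (\<kappa> n) \<xi> - measure (\<kappa> n) (space (\<kappa> n)))
        + (mchar N \<xi> - measure N (space N)))) \<longlonglongrightarrow> (\<integral>\<omega>. iexp (\<xi> \<bullet> Z t \<omega>) \<partial>M)"
      by (rule additive_process_char_limit[OF assms(2) t N mult_pos_pos[OF \<rho> \<delta>] N_large N_le]) (assumption, assumption, blast)
    have M: "prob_space M" and ZF: "subalgebra M (F t)" "Z t \<in> borel_measurable (F t)"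
      using assms(2) t by (auto simp: additive_process_def usual_filtered_space_def)
    have Zt: "Z t \<in> borel_measurable M" by (rule measurable_from_subalg[OF ZF])
    then have Zr: "(\<lambda>\<omega>. Z t \<omega> /\<^sub>R r) \<in> borel_measurable M" by measurable
    interpret prob_space M by fact
    define Q where "Q = distr M borel (\<lambda>\<omega>. Z t \<omega> /\<^sub>R r)"
    have Q: "finite_measure Q" "sets Q = sets borel"
      unfolding Q_def using finite_measure_distr[OF Zr] by auto
    have mQ: "mchar Q \<xi> = (\<integral>\<omega>. iexp ((inverse r *\<^sub>R \<xi>) \<bullet> Z t \<omega>) \<partial>M)" for \<xi>
      unfolding mchar_def Q_def using Zr by (subst integral_distr) (auto simp: inner_commute)
    define \<kappa>' where "\<kappa>' n = distr (\<kappa> n) borel (\<lambda>y. inverse r *\<^sub>R y)" for n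
    have sc: "(\<lambda>y. inverse r *\<^sub>R y) \<in> borel_measurable \<mu>" if "sets \<mu> = sets borel" for \<mu> :: "'a measure"
      by (rule borel_measurable_sets_eq_borel[OF that]) measurable
    have \<kappa>': "finite_measure (\<kappa>' n)" "sets (\<kappa>' n) = sets borel" for n
      unfolding \<kappa>'_def using finite_measure_distr_borel(1)[OF \<kappa>(1) sc[OF \<kappa>(2)]] by auto
    \<comment> \<open>The previous limit at frequency \<open>inverse r *\<^sub>R \<xi>\<close>,
      rewritten with the dilated measures and the dilated drift.\<close>
    have lim': "(\<lambda>n. exp (\<i> * of_real ((inverse r *\<^sub>R d n) \<bullet> \<xi>) + (mchar (\<kappa>' n) \<xi> - measure (\<kappa>' n) (space (\<kappa>' n)))
        + (mchar N' \<xi> - measure N' (space N')))) \<longlonglongrightarrow> mchar Q \<xi>" for \<xi>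
      using lim[of "inverse r *\<^sub>R \<xi>"]
      unfolding mQ \<kappa>'_def N'_eq mchar_distr[OF \<kappa>(2)] mchar_distr[OF N(2)]
        finite_measure_distr_borel(2)[OF \<kappa>(1) sc[OF \<kappa>(2)]] finite_measure_distr_borel(2)[OF N(1) sc[OF N(2)]]
      by simp
    have "(\<integral>\<^sup>+ x. ennreal (cmod (\<integral>\<omega>. \<phi> (x + Z t \<omega> /\<^sub>R r) \<partial>M)) \<partial>lborel) =
        (\<integral>\<^sup>+ x. ennreal (cmod (\<integral>y. inv_fourier h (x + y) \<partial>Q)) \<partial>lborel)"
      unfolding h(2) Q_def using Zr by (subst integral_distr) auto
    also have "\<dots> \<le> (\<integral>\<^sup>+x. ennreal (cmod (inv_fourier (\<lambda>\<xi>. exp (mchar N' \<xi> - measure N' (space N')) * h \<xi>) x)) \<partial>lborel)"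
      by (rule nn_integral_convolution_le_compound_poisson[OF h(1) Q N'(1,2) \<kappa>' lim'])
    also have "\<dots> \<le> ennreal (C * exp (- (c' * \<tau>)))"
    proof (rule decay[OF \<tau>(1) N'(1,2)])
      show "AE y in N'. norm y \<le> \<epsilon> * N\<nu>"
        unfolding N'_def using \<epsilon> by (intro AE_scaled_restriction[OF sets\<nu> Y(1)]) (auto simp: Y_def)
      show "measure N' (space N') \<le> measure \<nu> Y * \<tau>" using N'(3) by simp
      show "\<forall>\<xi>. h \<xi> \<noteq> 0 \<longrightarrow> Re (mchar N' \<xi>) - measure N' (space N') \<le> - (k * \<epsilon>\<^sup>2 / c\<^sup>2 / 4 * \<tau>)"
      proof (intro allI impI)
        fix \<xi> assume "h \<xi> \<noteq> 0"
        then have \<xi>: "inverse c \<le> norm \<xi>" "norm \<xi> \<le> c" using h_supp by auto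
        have "Re (mchar N' \<xi>) - measure N' (space N') \<le> - ((k * \<epsilon>\<^sup>2 / c\<^sup>2 * \<tau>) / 4)"
        proof (rule Re_mchar_le_second_moment[OF N'(1,2)])
          show "0 \<le> k * \<epsilon>\<^sup>2 / c\<^sup>2 * \<tau>" using k \<tau> by simp
          show "AE y in N'. \<bar>y \<bullet> \<xi>\<bar> \<le> 1"
            unfolding N'_def
          proof (rule AE_scaled_restriction[OF sets\<nu> Y(1)])
            fix y assume "y \<in> Y"
            then have "norm y * norm \<xi> \<le> N\<nu> * c" using \<xi> assms(4) by (intro mult_mono) (auto simp: Y_def)
            then have "\<bar>y \<bullet> \<xi>\<bar> \<le> N\<nu> * c" using Cauchy_Schwarz_ineq2[of y \<xi>] by linarith
            then have "\<epsilon> * \<bar>y \<bullet> \<xi>\<bar> \<le> \<epsilon> * (N\<nu> * c)" by (rule mult_left_mono) (use \<epsilon> in simp)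
            also have "\<dots> \<le> 1" using \<epsilon>(3) by (simp add: mult.assoc)
            finally show "\<bar>(\<epsilon> *\<^sub>R y) \<bullet> \<xi>\<bar> \<le> 1" using \<epsilon>(1) by (simp add: abs_mult)
          qed measurable
          have "k * \<epsilon>\<^sup>2 / c\<^sup>2 * \<tau> = \<tau> * (\<epsilon>\<^sup>2 * (k * (inverse c)\<^sup>2))"
            by (simp add: divide_inverse power_inverse mult_ac)
          also have "\<dots> \<le> \<tau> * (\<epsilon>\<^sup>2 * (k * (norm \<xi>)\<^sup>2))"
            using \<xi>(1) k \<tau>(1) c by (intro mult_left_mono power_mono) auto
          finally have "ennreal (k * \<epsilon>\<^sup>2 / c\<^sup>2 * \<tau>) \<le> ennreal (\<tau> * (\<epsilon>\<^sup>2 * (k * (norm \<xi>)\<^sup>2)))" by (rule ennreal_leI)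
          also have "\<dots> = ennreal \<tau> * (ennreal (\<epsilon>\<^sup>2) * ennreal (k * (norm \<xi>)\<^sup>2))"
            using \<tau> k by (simp add: ennreal_mult)
          also have "\<dots> \<le> ennreal \<tau> * (ennreal (\<epsilon>\<^sup>2) * (\<integral>\<^sup>+y. indicator Y y * ennreal ((y \<bullet> \<xi>)\<^sup>2) \<partial>\<nu>))"
            using moment[of \<xi>] unfolding Y_def by (intro mult_left_mono) auto
          also have "ennreal (\<epsilon>\<^sup>2) * (\<integral>\<^sup>+y. indicator Y y * ennreal ((y \<bullet> \<xi>)\<^sup>2) \<partial>\<nu>) =
              (\<integral>\<^sup>+y. ennreal (\<epsilon>\<^sup>2) * (indicator Y y * ennreal ((y \<bullet> \<xi>)\<^sup>2)) \<partial>\<nu>)"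
            by (intro nn_integral_cmult[symmetric] borel_measurable_sets_eq_borel[OF sets\<nu>]) measurable
          also have "\<dots> = (\<integral>\<^sup>+y. indicator Y y * ennreal (((\<epsilon> *\<^sub>R y) \<bullet> \<xi>)\<^sup>2) \<partial>\<nu>)"
            by (intro nn_integral_cong) (auto simp: power_mult_distrib ennreal_mult split: split_indicator)
          also have "ennreal \<tau> * \<dots> = (\<integral>\<^sup>+y. ennreal ((y \<bullet> \<xi>)\<^sup>2) \<partial>N')"
            unfolding N'_def by (rule nn_integral_scaled_restriction[OF sets\<nu> Y(1), symmetric]) measurable
          finally show "ennreal (k * \<epsilon>\<^sup>2 / c\<^sup>2 * \<tau>) \<le> (\<integral>\<^sup>+y. ennreal ((y \<bullet> \<xi>)\<^sup>2) \<partial>N')" .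
        qed
        then show "Re (mchar N' \<xi>) - measure N' (space N') \<le> - (k * \<epsilon>\<^sup>2 / c\<^sup>2 / 4 * \<tau>)" by simp
      qed
    qed
    also have "\<dots> \<le> ennreal (C * exp (- (c' * sL (1 / \<epsilon>) * t / s r)))"
    proof -
      \<comment> \<open>Returns from the scale \<rho> to the scale \<open>r\<close>: \<tau> is at
        least \<open>sL (1 / \<epsilon>)\<close> times \<open>t / s r\<close>.\<close>
      have "sL (1 / \<epsilon>) * (t / s r) \<le> s r / s \<rho> * (t / s r)"
        using s_ratio[OF r] t s_pos[OF r] unfolding \<rho>_def by (intro mult_right_mono) auto
      also have "\<dots> = \<tau>" using s_pos[OF r] by (simp add: \<tau>_def)
      finally have "c' * (sL (1 / \<epsilon>) * (t / s r)) \<le> c' * \<tau>" using C by (intro mult_left_mono) auto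
      then show ?thesis using C by (intro ennreal_leI mult_left_mono) (auto simp: mult.assoc)
    qed
    finally show ?thesis .
  qed
  show "\<exists>N\<^sub>0>0. \<exists>N\<^sub>1>0. \<forall>r\<in>{0<..<1}. \<forall>t\<in>{0..T}.
      (\<integral>\<^sup>+ x. ennreal (cmod (\<integral>\<omega>. \<phi> (x + Z t \<omega> /\<^sub>R r) \<partial>M)) \<partial>lborel) \<le> ennreal (N\<^sub>0 * exp (- (N\<^sub>1 * t / s r)))"
    using C sL_pos bound by (intro exI[of _ C] conjI exI[of _ "c' * sL (1 / \<epsilon>)"]) auto
qed

end
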